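(* Let $n\ge2$. Label the generators $\ell^{\pm}_{ij}[\mp r]$ of $U(\overline R^{[n-1]})$ by indices $2\le i,j\le 2'=2n-1$. The mappings $q^{\pm c/2}\mapsto q^{\pm c/2}$ and $$\ell^{\pm}_{ij}(u)\mapsto \ell^{\pm}_{ij}(u)-\ell^{\pm}_{i1}(u)\,\ell^{\pm}_{11}(u)^{-1}\,\ell^{\pm}_{1j}(u),\qquad 2\le i,j\le 2',$$ (the series on the right being those of $U(\overline R^{[n]})$; the right side is the quasideterminant of $\begin{bmatrix}\ell^\pm_{11}(u)&\ell^\pm_{1j}(u)\\ \ell^\pm_{i1}(u)&\ell^\pm_{ij}(u)\end{bmatrix}$ with respect to its lower right entry) define an algebra homomorphism $U(\overline{R}^{[n-1]})\to U(\overline{R}^{[n]})$.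
   Context: $q$ is a variable and algebras are over $\mathbb C(q)$. For $1\le i\le 2n$ put $i'=2n+1-i$; $\varepsilon_i=1$ for $i\le n$, $\varepsilon_i=-1$ for $i>n$; $\bar i=n+1-i$ for $i\le n$, $\bar i=n-i$ for $i>n$. For $0\le m<n$ let $I_m=\{m+1,\dots,(m+1)'\}$ and $\xi_m=q^{-2(n-m)-2}$. With all indices running over $I_m$ and $e_{ij}$ the matrix units of $\mathrm{End}\,\mathbb C^{I_m}$ set $P=\sum e_{ij}\otimes e_{ji}$, $Q=\sum q^{\bar i-\bar j}\varepsilon_i\varepsilon_je_{i'j'}\otimes e_{ij}$, $$R=q\sum_ie_{ii}\otimes e_{ii}+\sum_{i\ne j,j'}e_{ii}\otimes e_{jj}+q^{-1}\sum_{i}e_{ii}\otimes e_{i'i'}+(q-q^{-1})\sum_{i<j}e_{ij}\otimes e_{ji}-(q-q^{-1})\sum_{i>j}q^{\bar i-\bar j}\varepsilon_i\varepsilon_je_{i'j'}\otimes e_{ij},$$ $$\overline R^{[n-m]}(u)=\frac{u-1}{uq-q^{-1}}R+\frac{q-q^{-1}}{uq-q^{-1}}P-\frac{(q-q^{-1})(u-1)\xi_m}{(uq-q^{-1})(u-\xi_m)}Q.$$ The algebra $U(\overline R^{[n-m]})$ is generated by an invertible central element $q^{c/2}$ and elements $\ell^\pm_{ij}[\mp r]$ ($i,j\in I_m$, $r\ge0$). Put $\ell^\pm_{ij}(u)=\sum_{r\ge0}\ell^\pm_{ij}[\mp r]u^{\pm r}$, $\mathcal L^\pm(u)=\sum e_{ij}\otimes\ell^\pm_{ij}(u)$,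 $\mathcal L^\pm_1(u)=\sum e_{ij}\otimes1\otimes\ell_{ij}^\pm(u)$, $\mathcal L^\pm_2(u)=\sum1\otimes e_{ij}\otimes\ell_{ij}^\pm(u)$. Relations: $\ell^+_{ij}[0]=\ell^-_{ji}[0]=0$ for $i<j$; $\ell^+_{nn}[0]\ell^+_{n+1,n+1}[0]=1$; $\ell^+_{ii}[0]\ell^-_{ii}[0]=\ell^-_{ii}[0]\ell^+_{ii}[0]=1$; $$\overline R^{[n-m]}(u/v)\mathcal L_1^\pm(u)\mathcal L_2^\pm(v)=\mathcal L_2^\pm(v)\mathcal L_1^\pm(u)\overline R^{[n-m]}(u/v),$$ $$\overline R^{[n-m]}(uq^c/v)\mathcal L_1^+(u)\mathcal L_2^-(v)=\mathcal L_2^-(v)\mathcal L_1^+(u)\overline R^{[n-m]}(uq^{-c}/v),$$ where in the last relation rational functions are expanded in nonnegative powers of $u/v$. Here $U(\overline R^{[n]})$ is the case $m=0$ and $U(\overline R^{[n-1]})$ the case $m=1$. *)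

theory Defs
  imports
    "HOL-Computational_Algebra.Computational_Algebra"
    "HOL-Library.Poly_Mapping"
    "HOL-Library.FuncSet"
    "HOL-Algebra.QuotRing"
    "HOL-Algebra.Module"
begin

type_synonym K = "complex poly fract"

definition q :: K where
  "q = Fract [:0, 1:] 1"

text \<open>The finitely supported functions from words to \<^typ>\<open>K\<close> carry the convolution product of
  the monoid algebra, which is noncommutative because concatenation of words is.\<close>

datatype 'g word = Word (letters: "'g list")

instantiation word :: (type) monoid_add
begin

definition zero_word :: "'g word" where
  "zero_word = Word []"

definition plus_word :: "'g word \<Rightarrow> 'g word \<Rightarrow> 'g word" where
  "plus_word v w = Word (letters v @ letters w)"

instance
  by standard (simp_all add: zero_word_def plus_word_def)

end

type_synonym 'g free = "'g word \<Rightarrow>\<^sub>0 K"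

definition scal :: "K \<Rightarrow> 'g free" where
  "scal k = Poly_Mapping.single 0 k"

definition gen :: "'g \<Rightarrow> 'g free" where
  "gen g = Poly_Mapping.single (Word [g]) 1"

definition free_algebra :: "'g set \<Rightarrow> 'g free ring" where
  "free_algebra X =
     \<lparr>carrier = {f. \<forall>w \<in> Poly_Mapping.keys f. set (letters w) \<subseteq> X},
      mult = (*), one = 1, zero = 0, add = (+)\<rparr>"

text \<open>The associative unital algebra presented by generators \<open>X\<close> and relations \<open>x = 0\<close> for
  \<open>x \<in> S\<close>. The ideals of \<^theory>\<open>HOL-Algebra.Ideal\<close> are two-sided.\<close>

definition rel_ideal :: "'g set \<Rightarrow> 'g free set \<Rightarrow> 'g free set" where
  "rel_ideal X S = Idl\<^bsub>free_algebra X\<^esub> S"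

definition pres_class :: "'g set \<Rightarrow> 'g free set \<Rightarrow> 'g free \<Rightarrow> 'g free set" where
  "pres_class X S f = rel_ideal X S +>\<^bsub>free_algebra X\<^esub> f"

definition presented_algebra :: "'g set \<Rightarrow> 'g free set \<Rightarrow> (K, 'g free set) module" where
  "presented_algebra X S =
     (let A = free_algebra X Quot rel_ideal X S in
       \<lparr>carrier = carrier A, mult = mult A, one = one A, zero = zero A, add = add A,
        smult = (\<lambda>k a. pres_class X S (scal k) \<otimes>\<^bsub>A\<^esub> a)\<rparr>)"

definition alg_hom :: "(K, 'a) module \<Rightarrow> (K, 'b) module \<Rightarrow> ('a \<Rightarrow> 'b) set" where
  "alg_hom A B = {h \<in> ring_hom A B. \<forall>k. \<forall>x \<in> carrier A. h (k \<odot>\<^bsub>A\<^esub> x) = k \<odot>\<^bsub>B\<^esub> h x}"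

definition ser_ring :: "('a, 'm) ring_scheme \<Rightarrow> (nat \<Rightarrow> 'a) ring" where
  "ser_ring A =
     \<lparr>carrier = UNIV \<rightarrow> carrier A,
      mult = (\<lambda>f g r. \<Oplus>\<^bsub>A\<^esub>k\<in>{..r}. f k \<otimes>\<^bsub>A\<^esub> g (r - k)),
      one = (\<lambda>r. if r = 0 then \<one>\<^bsub>A\<^esub> else \<zero>\<^bsub>A\<^esub>),
      zero = (\<lambda>r. \<zero>\<^bsub>A\<^esub>),
      add = (\<lambda>f g r. f r \<oplus>\<^bsub>A\<^esub> g r)\<rparr>"

definition idx :: "nat \<Rightarrow> nat \<Rightarrow> nat set" where
  "idx n m = {m + 1 .. 2 * n - m}"

text \<open>For an index \<open>i\<close>, \<open>prm n i\<close> is \<open>i'\<close>, \<open>sg n i\<close> is the sign \<open>\<epsilon>\<^sub>i\<close>, and \<open>br n i\<close> is the integer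
  written as \<open>i\<close> with a bar in the exponents of \<open>q\<close>.\<close>

definition prm :: "nat \<Rightarrow> nat \<Rightarrow> nat" where
  "prm n i = 2 * n + 1 - i"

definition sg :: "nat \<Rightarrow> nat \<Rightarrow> K" where
  "sg n i = (if i \<le> n then 1 else - 1)"

definition br :: "nat \<Rightarrow> nat \<Rightarrow> int" where
  "br n i = (if i \<le> n then int n + 1 - int i else int n - int i)"

definition xi :: "nat \<Rightarrow> nat \<Rightarrow> K" where
  "xi n m = q powi (- 2 * (int n - int m) - 2)"

text \<open>An element \<open>\<Sum> e\<^sub>i\<^sub>j \<otimes> e\<^sub>k\<^sub>l \<otimes> x\<^sub>i\<^sub>j\<^sub>k\<^sub>l\<close> of \<open>End C\<^sup>I \<otimes> End C\<^sup>I \<otimes> A\<close> is the matrix with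
  entry \<open>x\<^sub>i\<^sub>j\<^sub>k\<^sub>l\<close> in row \<open>(i, k)\<close> and column \<open>(j, l)\<close>.\<close>

type_synonym 'a op2 = "nat \<times> nat \<Rightarrow> nat \<times> nat \<Rightarrow> 'a"

definition ee :: "nat \<Rightarrow> nat \<Rightarrow> nat \<Rightarrow> nat \<Rightarrow> K op2" where
  "ee i j k l x y = (if x = (i, k) \<and> y = (j, l) then 1 else 0)"

definition P_op :: "nat \<Rightarrow> nat \<Rightarrow> K op2" where
  "P_op n m x y = (\<Sum>i\<in>idx n m. \<Sum>j\<in>idx n m. ee i j j i x y)"

definition Q_op :: "nat \<Rightarrow> nat \<Rightarrow> K op2" where
  "Q_op n m x y = (\<Sum>i\<in>idx n m. \<Sum>j\<in>idx n m.
     q powi (br n i - br n j) * sg n i * sg n j * ee (prm n i) (prm n j) i j x y)"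

definition R_op :: "nat \<Rightarrow> nat \<Rightarrow> K op2" where
  "R_op n m x y =
     q * (\<Sum>i\<in>idx n m. ee i i i i x y)
     + (\<Sum>i\<in>idx n m. \<Sum>j\<in>{j \<in> idx n m. i \<noteq> j \<and> i \<noteq> prm n j}. ee i i j j x y)
     + inverse q * (\<Sum>i\<in>idx n m. ee i i (prm n i) (prm n i) x y)
     + (q - inverse q) * (\<Sum>i\<in>idx n m. \<Sum>j\<in>{j \<in> idx n m. i < j}. ee i j j i x y)
     - (q - inverse q) * (\<Sum>i\<in>idx n m. \<Sum>j\<in>{j \<in> idx n m. i > j}.
         q powi (br n i - br n j) * sg n i * sg n j * ee (prm n i) (prm n j) i j x y)"

text \<open>The rational function \<open>u \<mapsto> R(u)\<close> is taken as its expansion in nonnegative powers of \<open>u\<close>.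
  The denominators have nonzero constant term, so the quotients below are the honest
  inverses in the ring of power series.\<close>

definition R_bar :: "nat \<Rightarrow> nat \<Rightarrow> K fps op2" where
  "R_bar n m x y =
     (let u = fps_X; c = fps_const; d = u * c q - c (inverse q) in
       (u - 1) / d * c (R_op n m x y)
       + c (q - inverse q) / d * c (P_op n m x y)
       - (c (q - inverse q) * (u - 1) * c (xi n m)) / (d * (u - c (xi n m))) * c (Q_op n m x y))"

text \<open>A function \<open>f\<close> stands for \<open>\<Sum> f a b u\<^sup>a v\<^sup>b\<close>, summed over all integers \<open>a\<close> and \<open>b\<close>. Products
  are used only where every coefficient is a finite sum, which is needed for \<^const>\<open>Sum_any\<close>
  not to degenerate to \<open>0\<close>.\<close>

type_synonym 'a ser2 = "int \<Rightarrow> int \<Rightarrow> 'a"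

definition ser2_mult :: "'a::semiring_0 ser2 \<Rightarrow> 'a ser2 \<Rightarrow> 'a ser2" where
  "ser2_mult f g a b = Sum_any (\<lambda>(c, d). f c d * g (a - c) (b - d))"

definition op_mult :: "nat set \<Rightarrow> 'a::semiring_0 ser2 op2 \<Rightarrow> 'a ser2 op2 \<Rightarrow> 'a ser2 op2" where
  "op_mult I X Y x y a b = (\<Sum>z\<in>I \<times> I. ser2_mult (X x z) (Y z y) a b)"

datatype pm = Pl | Mi

text \<open>\<open>Ell s i j r\<close> is the coefficient of \<open>u\<^sup>r\<close> in the series \<open>\<ell>\<^sub>i\<^sub>j\<close> with superscript plus if
  \<open>s = Pl\<close>, and that of the power \<open>u\<close> to the \<open>-r\<close> in the one with superscript minus if
  \<open>s = Mi\<close>. \<open>Cen\<close> and \<open>CenInv\<close> are \<open>q\<close> to the powers \<open>c/2\<close> and \<open>-c/2\<close>.\<close>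

datatype gens = Cen | CenInv | Ell pm nat nat nat

definition gen_set :: "nat \<Rightarrow> nat \<Rightarrow> gens set" where
  "gen_set n m = {Cen, CenInv} \<union> {Ell s i j r | s i j r. i \<in> idx n m \<and> j \<in> idx n m}"

definition ell_coeff :: "pm \<Rightarrow> nat \<Rightarrow> nat \<Rightarrow> int \<Rightarrow> gens free" where
  "ell_coeff s i j a =
     (case s of
        Pl \<Rightarrow> if a \<ge> 0 then gen (Ell Pl i j (nat a)) else 0
      | Mi \<Rightarrow> if a \<le> 0 then gen (Ell Mi i j (nat (- a))) else 0)"

text \<open>\<open>L1 s\<close> is a series in \<open>u\<close> and \<open>L2 s\<close> is a series in \<open>v\<close>.\<close>

definition L1 :: "pm \<Rightarrow> gens free ser2 op2" where
  "L1 s x y a b =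
     (if snd x = snd y \<and> b = 0 then ell_coeff s (fst x) (fst y) a else 0)"

definition L2 :: "pm \<Rightarrow> gens free ser2 op2" where
  "L2 s x y a b =
     (if fst x = fst y \<and> a = 0 then ell_coeff s (snd x) (snd y) b else 0)"

text \<open>\<open>R_ser n m z\<close> is \<open>R(z u / v)\<close> expanded in nonnegative powers of \<open>u / v\<close>.\<close>

definition R_ser :: "nat \<Rightarrow> nat \<Rightarrow> gens free \<Rightarrow> gens free ser2 op2" where
  "R_ser n m z x y a b =
     (if 0 \<le> a \<and> b = - a
      then scal (fps_nth (R_bar n m x y) (nat a)) * z ^ nat a else 0)"

text \<open>All coefficients of all entries of
  \<open>R(z u / v) L\<^sub>1(u) L\<^sub>2(v) - L\<^sub>2(v) L\<^sub>1(u) R(w u / v)\<close>, the signs of the two series being \<open>s\<close> and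
  \<open>t\<close>. For \<open>s = t\<close> the direction in which \<open>R(u / v)\<close> is expanded is immaterial: the component
  of \<open>L\<^sub>1(u) L\<^sub>2(v)\<close> of a given total degree in \<open>u\<close> and \<open>v\<close> has only finitely many terms.\<close>

definition rll_rels ::
    "nat \<Rightarrow> nat \<Rightarrow> gens free \<Rightarrow> gens free \<Rightarrow> pm \<Rightarrow> pm \<Rightarrow> gens free set" where
  "rll_rels n m z w s t =
     {op_mult (idx n m) (R_ser n m z) (op_mult (idx n m) (L1 s) (L2 t)) x y a b
      - op_mult (idx n m) (op_mult (idx n m) (L2 t) (L1 s)) (R_ser n m w) x y a b
      | x y a b. x \<in> idx n m \<times> idx n m \<and> y \<in> idx n m \<times> idx n m}"

definition rels :: "nat \<Rightarrow> nat \<Rightarrow> gens free set" where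
  "rels n m =
     {gen Cen * gen CenInv - 1, gen CenInv * gen Cen - 1}
     \<union> {gen Cen * gen g - gen g * gen Cen | g. g \<in> gen_set n m}
     \<union> {gen (Ell Pl i j 0) | i j. i \<in> idx n m \<and> j \<in> idx n m \<and> i < j}
     \<union> {gen (Ell Mi j i 0) | i j. i \<in> idx n m \<and> j \<in> idx n m \<and> i < j}
     \<union> {gen (Ell Pl n n 0) * gen (Ell Pl (n + 1) (n + 1) 0) - 1}
     \<union> {gen (Ell Pl i i 0) * gen (Ell Mi i i 0) - 1 | i. i \<in> idx n m}
     \<union> {gen (Ell Mi i i 0) * gen (Ell Pl i i 0) - 1 | i. i \<in> idx n m}
     \<union> rll_rels n m 1 1 Pl Pl
     \<union> rll_rels n m 1 1 Mi Mi
     \<union> rll_rels n m (gen Cen ^ 2) (gen CenInv ^ 2) Pl Mi"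

text \<open>\<open>U_alg n m\<close> is the algebra attached to the R-matrix with superscript \<open>[n - m]\<close>, with
  generators labelled by \<open>idx n m\<close>.\<close>

definition U_alg :: "nat \<Rightarrow> nat \<Rightarrow> (K, gens free set) module" where
  "U_alg n m = presented_algebra (gen_set n m) (rels n m)"

definition U_gen :: "nat \<Rightarrow> nat \<Rightarrow> gens \<Rightarrow> gens free set" where
  "U_gen n m g = pres_class (gen_set n m) (rels n m) (gen g)"

text \<open>The generating series as a power series in \<open>u\<close> for \<open>s = Pl\<close> and in the inverse of \<open>u\<close>
  for \<open>s = Mi\<close>.\<close>

definition ell_ser :: "nat \<Rightarrow> nat \<Rightarrow> pm \<Rightarrow> nat \<Rightarrow> nat \<Rightarrow> nat \<Rightarrow> gens free set" where
  "ell_ser n m s i j r = U_gen n m (Ell s i j r)"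

definition quasidet :: "nat \<Rightarrow> pm \<Rightarrow> nat \<Rightarrow> nat \<Rightarrow> nat \<Rightarrow> gens free set" where
  "quasidet n s i j =
     (let S = ser_ring (U_alg n 0) in
       ell_ser n 0 s i j
       \<ominus>\<^bsub>S\<^esub> ell_ser n 0 s i 1 \<otimes>\<^bsub>S\<^esub> inv\<^bsub>S\<^esub> ell_ser n 0 s 1 1 \<otimes>\<^bsub>S\<^esub> ell_ser n 0 s 1 j)"

end

theory Submission
  imports Defs
begin

text \<open>
  Write \<open>V'\<close> for the span of the basis vectors other than the first and the last one. At
  \<open>u = q\<^sup>2 v\<close> the R-matrix is singular on the span of \<open>e\<^sub>1 \<otimes> e\<^sub>c\<close> and \<open>e\<^sub>c \<otimes> e\<^sub>1\<close>, so that
  \<open>L(u) \<otimes> L(q\<^sup>-\<^sup>2 u)\<close> maps \<open>w\<^sub>c = e\<^sub>1 \<otimes> e\<^sub>c - q\<^sup>-\<^sup>1 e\<^sub>c \<otimes> e\<^sub>1\<close>, \<open>c\<close> in \<open>V'\<close>, to \<open>\<Sum> w\<^sub>a D\<^sub>a\<^sub>c\<close> plus terms of other weight,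
  and \<open>D\<close> is the quasideterminant matrix \<open>S(u)\<close> times \<open>\<ell>\<^sub>1\<^sub>1(q\<^sup>-\<^sup>2 u)\<close>. The product
  \<open>R\<^sub>1\<^sub>3(x) R\<^sub>2\<^sub>3(q\<^sup>-\<^sup>2 x)\<close> acts on \<open>w\<^sub>c \<otimes> e\<^sub>d\<close>, up to vectors ending in \<open>e\<^sub>1\<close>, as a scalar times the
  R-matrix of rank \<open>n - 1\<close>; the correction to the coefficient of \<open>Q\<close> comes from the path through
  \<open>e\<^sub>1 \<otimes> e\<^sub>1\<^sub>'\<close>. The vectors ending in \<open>e\<^sub>1\<close> are eliminated with the relation in the row \<open>b = 1\<close>, which
  turns \<open>\<ell>\<^sub>b\<^sub>d(v)\<close> into the quasideterminant \<open>S\<^sub>b\<^sub>d(v)\<close>. The same elimination shows that \<open>\<ell>\<^sub>1\<^sub>1\<close>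
  commutes with \<open>S\<close> up to the scalar that has to be cancelled.
\<close>

section \<open>Entries of the R-matrix\<close>

lemma finite_idx [simp]: "finite (idx n m)"
  by (simp add: idx_def)

lemma prm_prm: "i \<in> idx n m \<Longrightarrow> prm n (prm n i) = i"
  by (auto simp: idx_def prm_def)

lemma prm_eq_iff: "i \<in> idx n m \<Longrightarrow> j \<in> idx n m \<Longrightarrow> prm n i = j \<longleftrightarrow> i = prm n j"
  by (auto simp: idx_def prm_def)

lemma prm_neq: "i \<in> idx n m \<Longrightarrow> prm n i \<noteq> i"
  by (auto simp: idx_def prm_def) presburger

lemma sum_if_conj_delta:
  fixes f :: "'a \<Rightarrow> 'b::comm_monoid_add"
  assumes "finite A"
  shows "(\<Sum>i\<in>A. if a = i \<and> P i then f i else 0) = (if a \<in> A \<and> P a then f a else 0)"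
proof -
  have "(\<Sum>i\<in>A. if a = i \<and> P i then f i else 0) = (\<Sum>i\<in>A. if a = i then (if P a then f a else 0) else 0)"
    by (intro sum.cong) auto
  then show ?thesis using assms by simp
qed

lemma sum_ee:
  assumes "finite A" "\<And>i. finite (B i)"
  shows "(\<Sum>i\<in>A. \<Sum>j\<in>B i. g i j * ee i j j i (a, b) (c, d))
           = (if a \<in> A \<and> b \<in> B a \<and> c = b \<and> d = a then g a b else 0)"
    and "(\<Sum>i\<in>A. \<Sum>j\<in>B i. g i j * ee i i j j (a, b) (c, d))
           = (if a \<in> A \<and> b \<in> B a \<and> c = a \<and> d = b then g a b else 0)"
proof -
  have *: "(\<Sum>j\<in>B i. g i j * ee i j j i (a, b) (c, d)) =
      (if a = i \<and> (b \<in> B i \<and> c = b \<and> d = i) then g i b else 0)" for i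
  proof -
    have "(\<Sum>j\<in>B i. g i j * ee i j j i (a, b) (c, d)) =
       (\<Sum>j\<in>B i. if b = j \<and> (a = i \<and> c = j \<and> d = i) then g i j else 0)"
      by (intro sum.cong) (auto simp: ee_def)
    then show ?thesis using assms by (subst (asm) sum_if_conj_delta) auto
  qed
  show "(\<Sum>i\<in>A. \<Sum>j\<in>B i. g i j * ee i j j i (a, b) (c, d))
           = (if a \<in> A \<and> b \<in> B a \<and> c = b \<and> d = a then g a b else 0)"
    unfolding * using assms by (subst sum_if_conj_delta) auto
  have *: "(\<Sum>j\<in>B i. g i j * ee i i j j (a, b) (c, d)) =
      (if a = i \<and> (b \<in> B i \<and> c = i \<and> d = b) then g i b else 0)" for i
  proof -
    have "(\<Sum>j\<in>B i. g i j * ee i i j j (a, b) (c, d)) =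
       (\<Sum>j\<in>B i. if b = j \<and> (a = i \<and> c = i \<and> d = j) then g i j else 0)"
      by (intro sum.cong) (auto simp: ee_def)
    then show ?thesis using assms by (subst (asm) sum_if_conj_delta) auto
  qed
  show "(\<Sum>i\<in>A. \<Sum>j\<in>B i. g i j * ee i i j j (a, b) (c, d))
           = (if a \<in> A \<and> b \<in> B a \<and> c = a \<and> d = b then g a b else 0)"
    unfolding * using assms by (subst sum_if_conj_delta) auto
qed

lemma sum_ee_prm:
  assumes "\<And>i. i \<in> A \<Longrightarrow> B i \<subseteq> idx n m" "A = idx n m" "{b, d} \<subseteq> idx n m"
  shows "(\<Sum>i\<in>A. \<Sum>j\<in>B i. g i j * ee (prm n i) (prm n j) i j (a, b) (c, d))
           = (if d \<in> B b \<and> a = prm n b \<and> c = prm n d then g b d else 0)"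
proof -
  have *: "(\<Sum>j\<in>B i. g i j * ee (prm n i) (prm n j) i j (a, b) (c, d)) =
      (if b = i \<and> (d \<in> B i \<and> a = prm n i \<and> c = prm n d) then g i d else 0)" if "i \<in> A" for i
  proof -
    have "(\<Sum>j\<in>B i. g i j * ee (prm n i) (prm n j) i j (a, b) (c, d)) =
       (\<Sum>j\<in>B i. if d = j \<and> (b = i \<and> a = prm n i \<and> c = prm n j) then g i j else 0)"
      by (intro sum.cong) (auto simp: ee_def)
    moreover have "finite (B i)"
      using assms(1)[OF that] finite_idx finite_subset by blast
    ultimately show ?thesis by (simp add: sum_if_conj_delta)
  qed
  have "(\<Sum>i\<in>A. \<Sum>j\<in>B i. g i j * ee (prm n i) (prm n j) i j (a, b) (c, d)) =
    (\<Sum>i\<in>A. if b = i \<and> (d \<in> B i \<and> a = prm n i \<and> c = prm n d) then g i d else 0)"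
    by (intro sum.cong refl *)
  also have "\<dots> = (if d \<in> B b \<and> a = prm n b \<and> c = prm n d then g b d else 0)"
    using assms by (subst sum_if_conj_delta) auto
  finally show ?thesis .
qed

definition Qc :: "nat \<Rightarrow> nat \<Rightarrow> nat \<Rightarrow> K" where
  "Qc n b d = q powi (br n b - br n d) * sg n b * sg n d"

lemma q_neq_0 [simp]: "q \<noteq> 0"
  by (simp add: q_def Zero_fract_def eq_fract)

lemma sg_sq [simp]: "sg n i * sg n i = 1"
  by (simp add: sg_def)

lemma Qc_trans: "Qc n b k * Qc n k d = Qc n b d"
proof -
  have "Qc n b k * Qc n k d =
     (q powi (br n b - br n k) * q powi (br n k - br n d)) * (sg n k * sg n k) * sg n b * sg n d"
    by (simp add: Qc_def mult_ac)
  also have "\<dots> = Qc n b d"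
    by (simp add: power_int_add[symmetric] Qc_def mult_ac)
  finally show ?thesis .
qed

lemma Qc_refl [simp]: "Qc n b b = 1"
  by (simp add: Qc_def mult.assoc)

lemma P_op_entry:
  assumes "{a, b, c, d} \<subseteq> idx n m"
  shows "P_op n m (a, b) (c, d) = (if c = b \<and> d = a then 1 else 0)"
  using sum_ee(1)[of "idx n m" "\<lambda>_. idx n m" "\<lambda>_ _. 1" a b c d] assms
  by (simp add: P_op_def)

lemma Q_op_entry:
  assumes "{a, b, c, d} \<subseteq> idx n m"
  shows "Q_op n m (a, b) (c, d) = (if a = prm n b \<and> c = prm n d then Qc n b d else 0)"
  using sum_ee_prm[of "idx n m" "\<lambda>_. idx n m" n m b d
    "\<lambda>i j. q powi (br n i - br n j) * sg n i * sg n j" a c] assms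
  by (simp add: Q_op_def Qc_def)

lemma R_op_entry:
  assumes "{a, b, c, d} \<subseteq> idx n m"
  shows "R_op n m (a, b) (c, d) =
     (if c = a \<and> d = b then (if a = b then q else if a = prm n b then inverse q else 1) else 0)
     + (if c = b \<and> d = a \<and> a < b then q - inverse q else 0)
     - (if a = prm n b \<and> c = prm n d \<and> d < b then (q - inverse q) * Qc n b d else 0)"
proof -
  let ?I = "idx n m"
  have 1: "(\<Sum>i\<in>?I. ee i i i i (a, b) (c, d)) = (if a = b \<and> c = a \<and> d = b then 1 else 0)"
    using sum_ee(2)[of ?I "\<lambda>i. {i}" "\<lambda>_ _. 1" a b c d] assms by auto
  have 2: "(\<Sum>i\<in>?I. \<Sum>j\<in>{j \<in> ?I. i \<noteq> j \<and> i \<noteq> prm n j}. ee i i j j (a, b) (c, d))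
     = (if a \<noteq> b \<and> a \<noteq> prm n b \<and> c = a \<and> d = b then 1 else 0)"
    using sum_ee(2)[of ?I "\<lambda>i. {j \<in> ?I. i \<noteq> j \<and> i \<noteq> prm n j}" "\<lambda>_ _. 1" a b c d] assms by auto
  have 3: "(\<Sum>i\<in>?I. ee i i (prm n i) (prm n i) (a, b) (c, d))
     = (if a = prm n b \<and> c = a \<and> d = b then 1 else 0)"
    using sum_ee(2)[of ?I "\<lambda>i. {prm n i}" "\<lambda>_ _. 1" a b c d] assms
    by (auto simp: prm_prm)
  have 4: "(\<Sum>i\<in>?I. \<Sum>j\<in>{j \<in> ?I. i < j}. ee i j j i (a, b) (c, d))
     = (if c = b \<and> d = a \<and> a < b then 1 else 0)"
    using sum_ee(1)[of ?I "\<lambda>i. {j \<in> ?I. i < j}" "\<lambda>_ _. 1" a b c d] assms by auto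
  have 5: "(\<Sum>i\<in>?I. \<Sum>j\<in>{j \<in> ?I. i > j}.
         q powi (br n i - br n j) * sg n i * sg n j * ee (prm n i) (prm n j) i j (a, b) (c, d))
     = (if a = prm n b \<and> c = prm n d \<and> d < b then Qc n b d else 0)"
    using sum_ee_prm[of ?I "\<lambda>i. {j \<in> ?I. i > j}" n m b d
      "\<lambda>i j. q powi (br n i - br n j) * sg n i * sg n j" a c] assms
    by (auto simp: Qc_def)
  have "a = prm n b \<Longrightarrow> a \<noteq> b" using assms prm_neq by auto
  then have 6: "q * (if a = b \<and> c = a \<and> d = b then 1 else 0)
      + (if a \<noteq> b \<and> a \<noteq> prm n b \<and> c = a \<and> d = b then 1 else 0)
      + inverse q * (if a = prm n b \<and> c = a \<and> d = b then 1 else 0)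
    = (if c = a \<and> d = b then (if a = b then q else if a = prm n b then inverse q else 1) else 0)"
    by (cases "c = a \<and> d = b"; cases "a = b"; cases "a = prm n b"; simp)
  show ?thesis unfolding R_op_def 1 2 3 4 5 6
    by (simp only: if_distrib[of "\<lambda>x. (q - inverse q) * x"] mult_1_right mult_zero_right)
qed

definition dn :: "K fps \<Rightarrow> K fps" where
  "dn u = u * fps_const q - fps_const (inverse q)"

definition rr :: "K fps \<Rightarrow> K fps" where
  "rr u = (u - 1) * inverse (dn u)"

definition hh :: "K fps" where
  "hh = fps_const (q - inverse q)"

lemma hh_eq: "hh = fps_const q - fps_const (inverse q)"
  by (simp add: hh_def)

definition pp :: "K fps \<Rightarrow> K fps" where
  "pp u = hh * inverse (dn u)"

definition ss :: "K \<Rightarrow> K fps \<Rightarrow> K fps" where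
  "ss s u = fps_const s * inverse (u - fps_const s)"

definition Rb :: "nat \<Rightarrow> nat \<Rightarrow> K fps \<Rightarrow> K fps op2" where
  "Rb n m u x y = rr u * fps_const (R_op n m x y) + pp u * fps_const (P_op n m x y)
     - hh * rr u * ss (xi n m) u * fps_const (Q_op n m x y)"

lemma xi_neq_0 [simp]: "xi n m \<noteq> 0"
  by (simp add: xi_def)

lemma xi_1: "xi n 1 = q\<^sup>2 * xi n 0"
proof -
  have "xi n 1 = q powi (2 + (- 2 * int n - 2))"
    by (simp add: xi_def)
  also have "\<dots> = q powi 2 * q powi (- 2 * int n - 2)"
    by (subst power_int_add) auto
  finally show ?thesis by (simp add: xi_def)
qed

lemma dn_inverse: "fps_nth u 0 = 0 \<Longrightarrow> dn u * inverse (dn u) = 1"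
  by (rule inverse_mult_eq_1') (simp add: dn_def)

lemma dn_neq_0: "fps_nth u 0 = 0 \<Longrightarrow> dn u \<noteq> 0"
  using dn_inverse by fastforce

lemma ss_denom_inverse:
  "fps_nth u 0 = 0 \<Longrightarrow> s \<noteq> 0 \<Longrightarrow> (u - fps_const s) * inverse (u - fps_const (s :: K)) = 1"
  by (intro inverse_mult_eq_1') simp

lemma dn_rr: "fps_nth u 0 = 0 \<Longrightarrow> dn u * rr u = u - 1"
  using dn_inverse by (simp add: rr_def mult.left_commute)

lemma dn_pp: "fps_nth u 0 = 0 \<Longrightarrow> dn u * pp u = hh"
  using dn_inverse by (simp add: pp_def mult.left_commute)

lemma denom_ss: "fps_nth u 0 = 0 \<Longrightarrow> s \<noteq> 0 \<Longrightarrow> (u - fps_const s) * ss s u = fps_const s"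
  using ss_denom_inverse by (simp add: ss_def mult.left_commute)

lemma R_bar_eq_Rb: "R_bar n m = Rb n m fps_X"
proof (intro ext)
  fix x y
  let ?d = "fps_X * fps_const q - fps_const (inverse q) :: K fps"
  let ?e = "fps_X - fps_const (xi n m) :: K fps"
  have d: "fps_nth ?d 0 \<noteq> 0" and de: "fps_nth (?d * ?e) 0 \<noteq> 0"
    by simp_all
  have "inverse (?d * ?e) = inverse ?d * inverse ?e"
    by (simp add: fps_inverse_mult)
  then show "R_bar n m x y = Rb n m fps_X x y"
    unfolding R_bar_def Let_def fps_divide_unit[OF d] fps_divide_unit[OF de]
    by (simp add: Rb_def rr_def pp_def ss_def hh_def dn_def mult_ac)
qed

lemma rr_pp: "fps_nth u 0 = 0 \<Longrightarrow> rr u * fps_const q + pp u = 1"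
proof -
  assume u: "fps_nth u 0 = 0"
  have "dn u * (rr u * fps_const q + pp u) = dn u * rr u * fps_const q + dn u * pp u"
    by (simp add: algebra_simps)
  also have "\<dots> = dn u * 1"
    unfolding dn_rr[OF u] dn_pp[OF u] hh_eq unfolding dn_def by (simp add: algebra_simps)
  finally show ?thesis using dn_neq_0[OF u] by simp
qed

lemma rr_hh_pp: "fps_nth u 0 = 0 \<Longrightarrow> rr u * hh + pp u = u * pp u"
proof -
  assume u: "fps_nth u 0 = 0"
  have "dn u * (rr u * hh + pp u) = dn u * rr u * hh + dn u * pp u"
    by (simp add: algebra_simps)
  also have "\<dots> = u * (dn u * pp u)"
    unfolding dn_rr[OF u] dn_pp[OF u] by (simp add: algebra_simps)
  finally have "dn u * (rr u * hh + pp u) = dn u * (u * pp u)"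
    by (simp only: mult.left_commute)
  then show ?thesis using dn_neq_0[OF u] by simp
qed

lemma Rb_entry:
  assumes "{a, b, c, d} \<subseteq> idx n m" "fps_nth u 0 = 0"
  shows "Rb n m u (a, b) (c, d) =
    (if c = a \<and> d = b then rr u * (if a = b then fps_const q
       else if a = prm n b then fps_const (inverse q) else 1) else 0)
    + (if c = b \<and> d = a then (if a < b then u * pp u else pp u) else 0)
    - (if a = prm n b \<and> c = prm n d then
         hh * rr u * (if d < b then 1 + ss (xi n m) u else ss (xi n m) u) * fps_const (Qc n b d) else 0)"
proof -
  have 1: "rr u * fps_const (if c = a \<and> d = b then (if a = b then q else if a = prm n b then inverse q else 1) else 0)
    = (if c = a \<and> d = b then rr u * (if a = b then fps_const q
       else if a = prm n b then fps_const (inverse q) else 1) else 0)"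
    by simp
  have 2: "rr u * fps_const (if c = b \<and> d = a \<and> a < b then q - inverse q else 0)
     + pp u * fps_const (if c = b \<and> d = a then 1 else 0) =
     (if c = b \<and> d = a then (if a < b then u * pp u else pp u) else 0)"
    using rr_hh_pp[OF assms(2)] by (simp add: hh_def)
  have 3: "rr u * fps_const (if a = prm n b \<and> c = prm n d \<and> d < b then (q - inverse q) * Qc n b d else 0)
    + hh * rr u * ss (xi n m) u * fps_const (if a = prm n b \<and> c = prm n d then Qc n b d else 0)
    = (if a = prm n b \<and> c = prm n d then
         hh * rr u * (if d < b then 1 + ss (xi n m) u else ss (xi n m) u) * fps_const (Qc n b d) else 0)"
  proof -
    have "fps_const ((q - inverse q) * Qc n b d) = hh * fps_const (Qc n b d)"
      by (simp add: hh_def)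
    then show ?thesis by (simp add: distrib_left distrib_right mult_ac)
  qed
  have split: "rr u * fps_const (A1 + A2 - A3) + z - w
    = rr u * fps_const A1 + (rr u * fps_const A2 + z) - (rr u * fps_const A3 + w)" for A1 A2 A3 z w
    by (simp add: algebra_simps flip: fps_const_add fps_const_sub)
  show ?thesis
    unfolding Rb_def R_op_entry[OF assms(1)] P_op_entry[OF assms(1)] Q_op_entry[OF assms(1)] split 1 2 3 ..
qed

abbreviation X1 :: "K fps" where "X1 \<equiv> fps_X"

definition X2 :: "K fps" where "X2 = fps_const (inverse q ^ 2) * fps_X"

lemma X2_0 [simp]: "fps_nth X2 0 = 0"
  by (simp add: X2_def)

lemma cq_inv: "fps_const q * fps_const (inverse q) = 1"
  by simp

lemma X1_X2: "X1 = fps_const q * fps_const q * X2"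
proof -
  have "fps_const q * fps_const q * X2 = fps_const (q * q * (inverse q) ^ 2) * fps_X"
    by (simp add: X2_def mult.assoc[symmetric])
  also have "q * q * (inverse q) ^ 2 = 1"
    by (simp add: power2_eq_square field_simps)
  finally show ?thesis by simp
qed

lemma ss_shift: "ss (xi n 1) X1 = ss (xi n 0) X2"
proof -
  let ?s = "fps_const (xi n 0)"
  have 1: "(X1 - fps_const (xi n 1)) * ss (xi n 1) X1 = fps_const (xi n 1)"
    and 2: "(X2 - ?s) * ss (xi n 0) X2 = ?s"
    by (simp_all add: denom_ss)
  have 3: "fps_const (xi n 1) = fps_const q * fps_const q * ?s"
    using xi_1[of n] by (simp add: power2_eq_square)
  have "(X1 - fps_const (xi n 1)) * ss (xi n 1) X1 = (X1 - fps_const (xi n 1)) * ss (xi n 0) X2"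
  proof -
    have "(X1 - fps_const (xi n 1)) * ss (xi n 0) X2
        = fps_const q * fps_const q * ((X2 - ?s) * ss (xi n 0) X2)"
      unfolding 3 by (subst X1_X2) (simp only: algebra_simps)
    also have "\<dots> = fps_const (xi n 1)"
      by (simp only: 2 3)
    finally show ?thesis
      by (rule trans[OF 1 sym])
  qed
  moreover have "X1 - fps_const (xi n 1) \<noteq> 0"
    using ss_denom_inverse[of X1 "xi n 1"] by fastforce
  ultimately show ?thesis by simp
qed

lemma swap_polynomial:
  fixes a b D1 D2 r1 r2 p1 p2 x y h :: "'a::idom"
  assumes "D1 * r1 = x - 1" "D2 * r2 = y - 1" "D1 * p1 = h" "D2 * p2 = h" "x = a * a * y" "h = a - b" "a * b = 1"
  shows "D1 * D2 * (r1 * (y * p2) - b * (x * p1 * p2)) = D1 * D2 * (r2 * (x * p1))"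
    "D1 * D2 * (r1 * p2 - b * (x * p1 * p2)) = D1 * D2 * (r2 * p1)"
proof -
  have bx: "b * x = a * y"
    using assms(7) unfolding assms(5) by (metis mult.assoc mult.left_commute mult_1_right)
  have "D1 * D2 * (r1 * (y * p2) - b * (x * p1 * p2))
      = (D1 * r1) * (D2 * p2) * y - (b * x) * (D1 * p1) * (D2 * p2)"
    by (simp add: algebra_simps)
  also have "\<dots> = (D1 * p1) * (y * (x - 1 - a * h))"
    unfolding bx assms(1-4) by (simp add: algebra_simps)
  also have "x - 1 - a * h = a * a * (y - 1)"
    unfolding assms(5,6) using assms(7) by (simp add: algebra_simps)
  also have "y * (a * a * (y - 1)) = x * (y - 1)"
    unfolding assms(5) by (simp add: mult_ac)
  finally show "D1 * D2 * (r1 * (y * p2) - b * (x * p1 * p2)) = D1 * D2 * (r2 * (x * p1))"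
    unfolding assms(2)[symmetric] by (simp add: mult_ac)
  have "D1 * D2 * (r1 * p2 - b * (x * p1 * p2)) = (D1 * r1) * (D2 * p2) - (b * x) * (D1 * p1) * (D2 * p2)"
    by (simp add: algebra_simps)
  also have "\<dots> = (D1 * p1) * (x - 1 - a * y * h)"
    unfolding bx assms(1-4) by (simp add: algebra_simps)
  also have "x - 1 - a * y * h = y - 1"
    unfolding assms(5,6) using assms(7) by (simp add: algebra_simps)
  finally show "D1 * D2 * (r1 * p2 - b * (x * p1 * p2)) = D1 * D2 * (r2 * p1)"
    unfolding assms(2)[symmetric] by (simp add: mult_ac)
qed

lemma swap_less: "rr X1 * (X2 * pp X2) - fps_const (inverse q) * (X1 * pp X1 * pp X2) = rr X2 * (X1 * pp X1)"
  and swap_ge: "rr X1 * pp X2 - fps_const (inverse q) * (X1 * pp X1 * pp X2) = rr X2 * pp X1"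
  and swap_vac: "rr X1 * (X2 * pp X2) = fps_const (inverse q) * (X1 * pp X1)"
proof -
  have D: "dn X1 * dn X2 \<noteq> 0" by (simp add: dn_neq_0)
  note f = dn_rr[of X1, simplified] dn_rr[of X2, simplified] dn_pp[of X1, simplified]
    dn_pp[of X2, simplified] X1_X2 hh_eq cq_inv
  show "rr X1 * (X2 * pp X2) - fps_const (inverse q) * (X1 * pp X1 * pp X2) = rr X2 * (X1 * pp X1)"
    "rr X1 * pp X2 - fps_const (inverse q) * (X1 * pp X1 * pp X2) = rr X2 * pp X1"
    using swap_polynomial[OF f] D by simp_all
  have y: "fps_const (inverse q) * X1 = X2 * fps_const q"
    using cq_inv by (subst X1_X2) (simp add: mult_ac del: fps_const_mult)
  have D2: "dn X2 = fps_const (inverse q) * (X1 - 1)"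
    unfolding dn_def using y by (simp add: algebra_simps)
  have "dn X1 * dn X2 * (rr X1 * (X2 * pp X2)) = (dn X1 * rr X1) * (dn X2 * pp X2) * X2"
    by (simp only: mult_ac)
  also have "\<dots> = (X1 - 1) * hh * X2"
    by (simp add: dn_rr dn_pp)
  also have "\<dots> = dn X2 * hh * (X2 * fps_const q)"
    unfolding D2 using cq_inv by (simp add: mult_ac)
  also have "\<dots> = dn X2 * (dn X1 * pp X1) * (fps_const (inverse q) * X1)"
    by (simp add: dn_pp y)
  also have "\<dots> = dn X1 * dn X2 * (fps_const (inverse q) * (X1 * pp X1))"
    by (simp only: mult_ac)
  finally show "rr X1 * (X2 * pp X2) = fps_const (inverse q) * (X1 * pp X1)"
    using D by simp
qed

lemma ss_polynomial:
  fixes a b s s1 s2 x y h :: "'a::idom"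
  assumes "(x - s) * s1 = s" "(y - s) * s2 = s" "x = a * a * y" "h = a - b" "a * b = 1"
  shows "(x - s) * (y - s) * ((b - h * s1) * (1 + s2)) = (x - s) * (y - s) * (b * (1 + s1))"
    "(x - s) * (y - s) * (h * (s1 * (1 + s2))) = (x - s) * (y - s) * (b * (s2 - s1))"
proof -
  have bx: "b * x = a * y"
    using assms(5) unfolding assms(3) by (metis mult.assoc mult.left_commute mult_1_right)
  have gen: "X * Y * ((b - h * s1) * Z) = (b * X - h * (X * s1)) * (Y * Z)" for X Y Z
    by (simp add: algebra_simps)
  have gen': "b * (X * (Y * s2) - Y * (X * s1)) = X * Y * (b * (s2 - s1))" for X Y
    by (simp add: algebra_simps)
  have x: "(x - s) * (1 + s1) = x" and y: "(y - s) * (1 + s2) = y"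
    using assms(1,2) by (simp_all add: distrib_left)
  have "(x - s) * (y - s) * ((b - h * s1) * (1 + s2))
      = (b * (x - s) - h * ((x - s) * s1)) * ((y - s) * (1 + s2))"
    by (rule gen)
  also have "\<dots> = (b * x - a * s) * y"
    unfolding assms(1) y assms(4) by (simp add: algebra_simps)
  also have "\<dots> = (y - s) * (b * x)"
    unfolding bx by (simp add: algebra_simps)
  also have "\<dots> = (y - s) * (b * ((x - s) * (1 + s1)))"
    unfolding x ..
  finally show "(x - s) * (y - s) * ((b - h * s1) * (1 + s2)) = (x - s) * (y - s) * (b * (1 + s1))"
    by (simp only: mult_ac)
  have "(x - s) * (y - s) * (h * (s1 * (1 + s2))) = h * ((x - s) * s1) * ((y - s) * (1 + s2))"
    by (simp only: mult_ac)
  also have "\<dots> = s * (a * y - b * y)"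
    unfolding assms(1) y assms(4) by (simp add: algebra_simps)
  also have "\<dots> = b * ((x - s) * s - (y - s) * s)"
    unfolding bx[symmetric] by (simp add: algebra_simps)
  also have "\<dots> = b * ((x - s) * ((y - s) * s2) - (y - s) * ((x - s) * s1))"
    unfolding assms(1,2) ..
  finally show "(x - s) * (y - s) * (h * (s1 * (1 + s2))) = (x - s) * (y - s) * (b * (s2 - s1))"
    by (simp only: gen')
qed

lemma ss_outer: "(fps_const (inverse q) - hh * ss s X1) * (1 + ss s X2) = fps_const (inverse q) * (1 + ss s X1)"
  and ss_inner: "hh * (ss s X1 * (1 + ss s X2)) = fps_const (inverse q) * (ss s X2 - ss s X1)"
  if s: "s \<noteq> 0"
proof -
  have D: "(X1 - fps_const s) * (X2 - fps_const s) \<noteq> 0"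
    using ss_denom_inverse[of X1 s] ss_denom_inverse[of X2 s] s by fastforce
  note f = denom_ss[of X1 s, simplified, OF s] denom_ss[of X2 s, simplified, OF s] X1_X2 hh_eq cq_inv
  show "(fps_const (inverse q) - hh * ss s X1) * (1 + ss s X2) = fps_const (inverse q) * (1 + ss s X1)"
    "hh * (ss s X1 * (1 + ss s X2)) = fps_const (inverse q) * (ss s X2 - ss s X1)"
    using ss_polynomial[OF f] D by simp_all
qed

section \<open>Free and presented algebras\<close>

lemma scal_add: "scal (a + b) = scal a + scal b"
  by (simp add: scal_def single_add)

lemma scal_mult: "scal (a * b) = scal a * scal b"
  by (simp add: scal_def mult_single)

lemma scal_0 [simp]: "scal 0 = 0"
  by (simp add: scal_def)

lemma scal_1 [simp]: "scal 1 = 1"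
  by (simp add: scal_def)

lemma letters_plus: "letters (v + w) = letters v @ letters w"
  by (simp add: plus_word_def)

lemma letters_0 [simp]: "letters 0 = []"
  by (simp add: zero_word_def)

lemma single_Word_Cons: "Poly_Mapping.single (Word (g # ws)) k = gen g * Poly_Mapping.single (Word ws) k"
  by (simp add: gen_def mult_single plus_word_def)

lemma free_induct_single:
  fixes f :: "'g free"
  assumes "\<And>w k. P (Poly_Mapping.single w k)" "\<And>f g. P f \<Longrightarrow> P g \<Longrightarrow> P (f + g)"
  shows "P f"
proof (induction f rule: update_induct)
  case const
  have "P (Poly_Mapping.single 0 0)" by (rule assms)
  then show ?case by simp
next
  case (update f a b)
  have "Poly_Mapping.update a b f = Poly_Mapping.single a b + f"
    using update(1)
    by (intro poly_mapping_eqI) (auto simp: lookup_update lookup_add lookup_single in_keys_iff when_def)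
  then show ?case using assms update by simp
qed

lemma free_induct [case_names scal gen add mult]:
  fixes f :: "'g free"
  assumes scal: "\<And>k. P (scal k)" and gen: "\<And>g. P (gen g)"
    and add: "\<And>f g. P f \<Longrightarrow> P g \<Longrightarrow> P (f + g)" and mult: "\<And>f g. P f \<Longrightarrow> P g \<Longrightarrow> P (f * g)"
  shows "P f"
proof (rule free_induct_single)
  fix w k
  have "P (Poly_Mapping.single (Word ws) k)" for ws
  proof (induction ws)
    case Nil
    show ?case using scal[of k] by (simp add: scal_def zero_word_def)
  next
    case (Cons g ws)
    then show ?case using gen mult by (simp add: single_Word_Cons)
  qed
  then show "P (Poly_Mapping.single w k)" by (metis word.collapse)
qed (rule add)

lemma scal_commute: "scal k * f = f * scal k"
  by (induction f rule: free_induct_single)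
    (simp_all add: scal_def mult_single mult.commute distrib_left distrib_right)

definition ev :: "('g \<Rightarrow> 'h free) \<Rightarrow> 'g free \<Rightarrow> 'h free" where
  "ev \<theta> f = (\<Sum>w\<in>Poly_Mapping.keys f. scal (Poly_Mapping.lookup f w) * prod_list (map \<theta> (letters w)))"

lemma ev_superset:
  assumes "finite A" "Poly_Mapping.keys f \<subseteq> A"
  shows "ev \<theta> f = (\<Sum>w\<in>A. scal (Poly_Mapping.lookup f w) * prod_list (map \<theta> (letters w)))"
  unfolding ev_def using assms by (intro sum.mono_neutral_left) (auto simp: in_keys_iff)

lemma ev_add: "ev \<theta> (f + g) = ev \<theta> f + ev \<theta> g"
proof -
  let ?A = "Poly_Mapping.keys f \<union> Poly_Mapping.keys g"
  have "finite ?A" by simp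
  then show ?thesis
    using keys_add[of f g]
    by (simp add: ev_superset[of ?A] lookup_add scal_add distrib_right sum.distrib)
qed

lemma ev_single: "ev \<theta> (Poly_Mapping.single w k) = scal k * prod_list (map \<theta> (letters w))"
  by (subst ev_superset[of "{w}"]) auto

lemma ev_mult: "ev \<theta> (f * g) = ev \<theta> f * ev \<theta> g"
proof (induction f rule: free_induct_single)
  case (1 v a)
  show ?case
  proof (induction g rule: free_induct_single)
    case (1 w b)
    have "scal a * scal b * (prod_list (map \<theta> (letters v)) * y)
      = scal a * prod_list (map \<theta> (letters v)) * (scal b * y)" for y
    proof -
      have "scal b * (P * y) = P * (scal b * y)" for P
        by (simp only: mult.assoc[symmetric] scal_commute[of b P])
      then show ?thesis by (simp only: mult.assoc)
    qed
    then show ?case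
      by (simp add: mult_single ev_single letters_plus scal_mult)
  qed (simp_all add: distrib_left ev_add)
qed (simp_all add: distrib_right ev_add)

lemma ev_scal [simp]: "ev \<theta> (scal k) = scal k"
  by (simp add: scal_def[of k] ev_single)

lemma ev_gen [simp]: "ev \<theta> (gen g) = \<theta> g"
  by (simp add: gen_def ev_single)

lemma ev_1 [simp]: "ev \<theta> 1 = 1"
  using ev_scal[of \<theta> 1] by simp

definition retr :: "'g set \<Rightarrow> 'g free \<Rightarrow> 'g free" where
  "retr X = ev (\<lambda>g. if g \<in> X then gen g else 0)"

lemma retr_add: "retr X (f + g) = retr X f + retr X g"
  and retr_mult: "retr X (f * g) = retr X f * retr X g"
  and retr_scal [simp]: "retr X (scal k) = scal k"
  and retr_gen: "retr X (gen x) = (if x \<in> X then gen x else 0)"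
  and retr_1 [simp]: "retr X 1 = 1"
  by (simp_all add: retr_def ev_add ev_mult)

lemma retr_0 [simp]: "retr X 0 = 0"
  using retr_scal[of X 0] by simp

lemma retr_minus: "retr X (- f) = - retr X f"
  using retr_add[of X f "- f"] by (simp add: eq_neg_iff_add_eq_0 add.commute)

lemma retr_diff: "retr X (f - g) = retr X f - retr X g"
  using retr_add[of X f "- g"] by (simp add: retr_minus)

definition words_in :: "'g set \<Rightarrow> 'g free set" where
  "words_in X = {f. \<forall>w \<in> Poly_Mapping.keys f. set (letters w) \<subseteq> X}"

lemma words_in_closed:
  "0 \<in> words_in X" "1 \<in> words_in X" "scal k \<in> words_in X" "g \<in> X \<Longrightarrow> gen g \<in> words_in X"
  "f \<in> words_in X \<Longrightarrow> - f \<in> words_in X"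
  "f \<in> words_in X \<Longrightarrow> h \<in> words_in X \<Longrightarrow> f + h \<in> words_in X"
  "f \<in> words_in X \<Longrightarrow> h \<in> words_in X \<Longrightarrow> f * h \<in> words_in X"
proof -
  show "f \<in> words_in X \<Longrightarrow> h \<in> words_in X \<Longrightarrow> f + h \<in> words_in X"
    using keys_add[of f h] by (auto simp: words_in_def)
  show "f \<in> words_in X \<Longrightarrow> h \<in> words_in X \<Longrightarrow> f * h \<in> words_in X"
    using keys_mult[of f h] by (fastforce simp: letters_plus words_in_def)
  show "g \<in> X \<Longrightarrow> gen g \<in> words_in X"
    by (simp add: gen_def words_in_def)
  show scal: "scal k \<in> words_in X" for k
    by (simp add: scal_def words_in_def)
  show "1 \<in> words_in X"
    using scal[of 1] by simp
qed (simp_all add: words_in_def)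

lemma retr_in: "retr X f \<in> words_in X"
  by (induction f rule: free_induct)
    (auto simp only: retr_add retr_mult retr_scal retr_gen words_in_closed split: if_splits)

lemma retr_id:
  assumes "f \<in> words_in X"
  shows "retr X f = f"
proof -
  have mono: "scal k * prod_list (map (\<lambda>g. if g \<in> X then gen g else 0) (letters w)) = Poly_Mapping.single w k"
    if "set (letters w) \<subseteq> X" for w k
  proof -
    have "prod_list (map (\<lambda>g. if g \<in> X then gen g else 0) ws) = Poly_Mapping.single (Word ws) 1"
      if "set ws \<subseteq> X" for ws
      using that by (induction ws) (simp_all add: single_Word_Cons zero_word_def[symmetric])
    from this[OF that] show ?thesis by (simp add: scal_def mult_single)
  qed
  have "retr X f = (\<Sum>w\<in>Poly_Mapping.keys f. Poly_Mapping.single w (Poly_Mapping.lookup f w))"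
    unfolding retr_def ev_def using assms by (intro sum.cong refl mono) (auto simp: words_in_def)
  also have "\<dots> = f"
    by (intro poly_mapping_eqI)
      (simp add: lookup_sum lookup_single when_def in_keys_iff)
  finally show ?thesis .
qed

lemma carrier_free: "carrier (free_algebra X) = words_in X"
  by (simp add: free_algebra_def words_in_def)

lemma free_algebra_simps:
  "mult (free_algebra X) = (*)" "one (free_algebra X) = 1" "zero (free_algebra X) = 0" "add (free_algebra X) = (+)"
  by (simp_all add: free_algebra_def)

lemma ring_free_algebra: "ring (free_algebra X)"
proof (intro ringI abelian_groupI monoidI; unfold carrier_free free_algebra_simps)
  fix f :: "'a free" assume "f \<in> words_in X"
  then show "\<exists>g\<in>words_in X. g + f = 0"
    by (intro bexI[of _ "- f"] words_in_closed(5)) simp_all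
qed (simp_all add: words_in_closed ac_simps mult.assoc distrib_left distrib_right)

locale presentation =
  fixes X :: "'g set" and S :: "'g free set"
  assumes S: "S \<subseteq> words_in X"
begin

abbreviation F where "F \<equiv> free_algebra X"
abbreviation J where "J \<equiv> rel_ideal X S"
abbreviation A where "A \<equiv> presented_algebra X S"

sublocale F: ring F by (rule ring_free_algebra)

sublocale J: ideal J F
  unfolding rel_ideal_def by (rule F.genideal_ideal) (use S in \<open>simp add: carrier_free\<close>)

lemma S_J: "S \<subseteq> J"
  unfolding rel_ideal_def by (rule F.genideal_self) (use S in \<open>simp add: carrier_free\<close>)

lemma J_0: "0 \<in> J"
  using J.zero_closed by (simp add: free_algebra_simps)

lemma J_add: "f \<in> J \<Longrightarrow> g \<in> J \<Longrightarrow> f + g \<in> J"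
  using J.a_closed by (simp add: free_algebra_simps)

lemma J_lmult: "f \<in> J \<Longrightarrow> g \<in> words_in X \<Longrightarrow> g * f \<in> J"
  using J.I_l_closed by (simp add: free_algebra_simps carrier_free)

lemma J_rmult: "f \<in> J \<Longrightarrow> g \<in> words_in X \<Longrightarrow> f * g \<in> J"
  using J.I_r_closed by (simp add: free_algebra_simps carrier_free)

lemma J_minus: "f \<in> J \<Longrightarrow> - f \<in> J"
  using J_lmult[of f "- 1"] words_in_closed(2,5) by fastforce

lemma J_diff: "f \<in> J \<Longrightarrow> g \<in> J \<Longrightarrow> f - g \<in> J"
  using J_add[of f "- g"] J_minus[of g] by simp

definition PC :: "'g free \<Rightarrow> 'g free set" where
  "PC f = pres_class X S (retr X f)"

definition Jh :: "'g free set" where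
  "Jh = {f. retr X f \<in> J}"

lemma pres_class_eq: "pres_class X S f = {h + f | h. h \<in> J}"
  by (auto simp: pres_class_def a_r_coset_def' free_algebra_simps)

lemma PC_eq_iff: "PC f = PC g \<longleftrightarrow> f - g \<in> Jh"
proof
  assume "PC f = PC g"
  moreover have "retr X f \<in> PC f" unfolding PC_def pres_class_eq using J_0 by force
  ultimately obtain h where "h \<in> J" "retr X f = h + retr X g" unfolding PC_def pres_class_eq by auto
  then show "f - g \<in> Jh" by (simp add: Jh_def retr_diff)
next
  assume "f - g \<in> Jh"
  then have h: "retr X f - retr X g \<in> J" by (simp add: Jh_def retr_diff)
  have sub: "{h + a | h. h \<in> J} \<subseteq> {h + b | h. h \<in> J}" if "a - b \<in> J" for a b
  proof
    fix x assume "x \<in> {h + a | h. h \<in> J}"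
    then obtain h where "h \<in> J" "x = h + a" by blast
    then have "h + (a - b) \<in> J" "x = (h + (a - b)) + b" using that J_add by auto
    then show "x \<in> {h + b | h. h \<in> J}" by blast
  qed
  from h have "retr X g - retr X f \<in> J" using J_minus by fastforce
  with h show "PC f = PC g" unfolding PC_def pres_class_eq using sub by (intro equalityI) auto
qed

lemma pres_class_PC: "f \<in> words_in X \<Longrightarrow> pres_class X S f = PC f"
  by (simp only: PC_def retr_id)

lemma A_simps:
  "carrier A = carrier (F Quot J)" "mult A = mult (F Quot J)" "one A = one (F Quot J)"
  "zero A = zero (F Quot J)" "add A = add (F Quot J)"
  "smult A = (\<lambda>k a. pres_class X S (scal k) \<otimes>\<^bsub>F Quot J\<^esub> a)"
  by (simp_all add: presented_algebra_def Let_def)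

lemma PC_hom: "pres_class X S \<in> ring_hom F (F Quot J)"
  using J.rcos_ring_hom by (simp add: pres_class_def[abs_def])

lemma PC_add: "PC f \<oplus>\<^bsub>A\<^esub> PC g = PC (f + g)"
  using ring_hom_add[OF PC_hom, unfolded carrier_free free_algebra_simps, OF retr_in retr_in]
  by (simp add: PC_def A_simps retr_add)

lemma PC_mult: "PC f \<otimes>\<^bsub>A\<^esub> PC g = PC (f * g)"
  using ring_hom_mult[OF PC_hom, unfolded carrier_free free_algebra_simps, OF retr_in retr_in]
  by (simp add: PC_def A_simps retr_mult)

lemma PC_1: "\<one>\<^bsub>A\<^esub> = PC 1"
  using ring_hom_one[OF PC_hom]
  by (simp add: PC_def A_simps free_algebra_simps)

lemma PC_smult: "k \<odot>\<^bsub>A\<^esub> PC f = PC (scal k * f)"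
  using PC_mult[of "scal k" f] words_in_closed(3)[of k X]
  by (simp only: A_simps pres_class_PC)

lemma A_carrier: "carrier A = range PC"
proof -
  have "carrier A = pres_class X S ` words_in X"
    by (auto simp: A_simps FactRing_def A_RCOSETS_def' pres_class_def carrier_free)
  also have "\<dots> = range PC"
  proof (intro equalityI subsetI)
    fix c assume "c \<in> pres_class X S ` words_in X"
    then show "c \<in> range PC" using pres_class_PC by blast
  next
    fix c assume "c \<in> range PC"
    then show "c \<in> pres_class X S ` words_in X" using retr_in unfolding PC_def by blast
  qed
  finally show ?thesis .
qed

lemma PC_zero: "\<zero>\<^bsub>A\<^esub> = PC 0"
proof -
  interpret Q: ring "F Quot J" by (rule J.quotient_is_ring)
  have "PC 0 \<oplus>\<^bsub>F Quot J\<^esub> PC 0 = PC 0" using PC_add[of 0 0] by (simp add: A_simps)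
  moreover have "PC 0 \<in> carrier (F Quot J)" using A_carrier by (auto simp: A_simps)
  ultimately show ?thesis by (simp add: A_simps)
qed

lemma A_ring: "ring A"
proof (intro ringI abelian_groupI monoidI; unfold A_carrier PC_1 PC_zero; (elim imageE)?)
  fix c f assume "c = PC f"
  then show "\<exists>g\<in>range PC. g \<oplus>\<^bsub>A\<^esub> c = PC 0"
    by (intro bexI[of _ "PC (- f)"]) (simp_all add: PC_add)
qed (simp_all add: PC_add PC_mult ac_simps mult.assoc distrib_left distrib_right)

lemma Jh_closed:
  "0 \<in> Jh" "f \<in> Jh \<Longrightarrow> g \<in> Jh \<Longrightarrow> f - g \<in> Jh" "f \<in> Jh \<Longrightarrow> g * f \<in> Jh" "f \<in> Jh \<Longrightarrow> f * g \<in> Jh"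
  by (simp_all add: Jh_def retr_diff retr_mult J_0 J_diff J_lmult J_rmult retr_in)

lemma S_Jh: "S \<subseteq> Jh"
  using S S_J by (auto simp: Jh_def retr_id subset_iff)

lemma Jh_kernel:
  fixes \<Psi> :: "'g free \<Rightarrow> 'b::ring"
  assumes add: "\<And>f g. \<Psi> (f + g) = \<Psi> f + \<Psi> g" and mult: "\<And>f g. \<Psi> (f * g) = \<Psi> f * \<Psi> g"
    and S0: "\<And>f. f \<in> S \<Longrightarrow> \<Psi> f = 0" and f: "f \<in> Jh"
  shows "\<Psi> (retr X f) = 0"
proof -
  have zero: "\<Psi> 0 = 0" using add[of 0 0] by simp
  have minus: "\<Psi> (- f) = - \<Psi> f" for f
    using add[of f "- f"] by (simp add: zero eq_neg_iff_add_eq_0 add.commute)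
  let ?K = "{f \<in> words_in X. \<Psi> f = 0}"
  have "ideal ?K F"
  proof (intro idealI)
    show "ring F" by (rule ring_free_algebra)
    have inv: "inv\<^bsub>add_monoid F\<^esub> f = - f" if "f \<in> words_in X" for f
      using F.minus_equality[of "- f" f] that words_in_closed(5)[OF that]
      by (simp add: a_inv_def carrier_free free_algebra_simps)
    show "subgroup ?K (add_monoid F)"
    proof (rule group.subgroupI[OF F.a_group])
      show "?K \<subseteq> carrier (add_monoid F)" by (auto simp: carrier_free)
      show "?K \<noteq> {}" using zero words_in_closed(1) by blast
      show "inv\<^bsub>add_monoid F\<^esub> f \<in> ?K" if "f \<in> ?K" for f
        using that inv[of f] by (simp add: words_in_closed minus)
      show "f \<otimes>\<^bsub>add_monoid F\<^esub> g \<in> ?K" if "f \<in> ?K" "g \<in> ?K" for f g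
        using that by (simp add: free_algebra_simps words_in_closed add)
    qed
  qed (auto simp only: carrier_free free_algebra_simps words_in_closed mult mem_Collect_eq mult_zero_left mult_zero_right)
  moreover have "S \<subseteq> ?K" using S S0 by auto
  ultimately have "J \<subseteq> ?K" unfolding rel_ideal_def by (rule F.genideal_minimal)
  with f show ?thesis by (auto simp: Jh_def)
qed

end

text \<open>
  The quotient by an ideal that depends on a variable of the logic is not a type. The next type
  collects the quotients by all two-sided ideals at once, so that identities in each of them can be
  computed in the class \<^class>\<open>ring_1\<close>. The image of \<open>1\<close> under \<open>quot_at J\<close> is an idempotent other than \<open>1\<close>.
\<close>

definition tsideal :: "'a::ring_1 set \<Rightarrow> bool" where
  "tsideal J \<longleftrightarrow> 0 \<in> J \<and> (\<forall>x\<in>J. \<forall>y\<in>J. x - y \<in> J) \<and> (\<forall>x\<in>J. \<forall>r. r * x \<in> J \<and> x * r \<in> J)"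

lemma tsidealD:
  assumes "tsideal J"
  shows "0 \<in> J" "x \<in> J \<Longrightarrow> y \<in> J \<Longrightarrow> x - y \<in> J" "x \<in> J \<Longrightarrow> r * x \<in> J" "x \<in> J \<Longrightarrow> x * r \<in> J"
  using assms by (auto simp: tsideal_def)

lemma tsideal_uminus: "tsideal J \<Longrightarrow> x \<in> J \<Longrightarrow> - x \<in> J"
  using tsidealD(2)[of J 0 x] by (simp add: tsidealD(1))

lemma tsideal_add: "tsideal J \<Longrightarrow> x \<in> J \<Longrightarrow> y \<in> J \<Longrightarrow> x + y \<in> J"
  using tsidealD(2)[of J x "- y"] by (simp add: tsideal_uminus)

definition cong_all :: "('a::ring_1 set \<Rightarrow> 'a) \<Rightarrow> ('a set \<Rightarrow> 'a) \<Rightarrow> bool" where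
  "cong_all f g \<longleftrightarrow> (\<forall>J. tsideal J \<longrightarrow> f J - g J \<in> J)"

lemma equivp_cong_all: "equivp (cong_all :: ('a::ring_1 set \<Rightarrow> 'a) \<Rightarrow> _)"
proof (rule equivpI)
  show "reflp (cong_all :: ('a set \<Rightarrow> 'a) \<Rightarrow> _)" by (auto simp: reflp_def cong_all_def tsidealD)
  show "symp (cong_all :: ('a set \<Rightarrow> 'a) \<Rightarrow> _)"
  proof (rule sympI)
    fix f g :: "'a set \<Rightarrow> 'a" assume "cong_all f g"
    then show "cong_all g f" unfolding cong_all_def by (metis minus_diff_eq tsideal_uminus)
  qed
  show "transp (cong_all :: ('a set \<Rightarrow> 'a) \<Rightarrow> _)"
  proof (rule transpI)
    fix f g h :: "'a set \<Rightarrow> 'a" assume *: "cong_all f g" "cong_all g h"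
    show "cong_all f h" unfolding cong_all_def
    proof (intro allI impI)
      fix J :: "'a set" assume J: "tsideal J"
      then have "(f J - g J) + (g J - h J) \<in> J"
        using * by (intro tsideal_add) (auto simp: cong_all_def)
      then show "f J - h J \<in> J" by simp
    qed
  qed
qed

quotient_type (overloaded) 'a quots = "'a::ring_1 set \<Rightarrow> 'a" / cong_all
  by (rule equivp_cong_all)

instantiation quots :: (ring_1) ring_1
begin

lift_definition zero_quots :: "'a quots" is "\<lambda>_. 0" .

lift_definition one_quots :: "'a quots" is "\<lambda>_. 1" .

lift_definition plus_quots :: "'a quots \<Rightarrow> 'a quots \<Rightarrow> 'a quots" is "\<lambda>f g J. f J + g J"
  unfolding cong_all_def by (metis add_diff_add tsideal_add)

lift_definition minus_quots :: "'a quots \<Rightarrow> 'a quots \<Rightarrow> 'a quots" is "\<lambda>f g J. f J - g J"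
proof -
  fix f f' g g' :: "'a set \<Rightarrow> 'a" assume *: "cong_all f f'" "cong_all g g'"
  show "cong_all (\<lambda>J. f J - g J) (\<lambda>J. f' J - g' J)"
    unfolding cong_all_def
  proof (intro allI impI)
    fix J :: "'a set" assume J: "tsideal J"
    have eq: "f J - g J - (f' J - g' J) = (f J - f' J) - (g J - g' J)" by simp
    show "f J - g J - (f' J - g' J) \<in> J"
      unfolding eq using * J by (intro tsidealD(2)[OF J, of "f J - f' J"]) (auto simp: cong_all_def)
  qed
qed

lift_definition uminus_quots :: "'a quots \<Rightarrow> 'a quots" is "\<lambda>f J. - f J"
proof -
  fix f f' :: "'a set \<Rightarrow> 'a" assume *: "cong_all f f'"
  show "cong_all (\<lambda>J. - f J) (\<lambda>J. - f' J)"
    unfolding cong_all_def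
  proof (intro allI impI)
    fix J :: "'a set" assume J: "tsideal J"
    have eq: "- f J - - f' J = - (f J - f' J)" by simp
    show "- f J - - f' J \<in> J"
      unfolding eq using * J by (intro tsideal_uminus) (auto simp: cong_all_def)
  qed
qed

lift_definition times_quots :: "'a quots \<Rightarrow> 'a quots \<Rightarrow> 'a quots" is "\<lambda>f g J. f J * g J"
proof -
  fix f f' g g' :: "'a set \<Rightarrow> 'a" assume *: "cong_all f f'" "cong_all g g'"
  show "cong_all (\<lambda>J. f J * g J) (\<lambda>J. f' J * g' J)"
    unfolding cong_all_def
  proof (intro allI impI)
    fix J :: "'a set" assume J: "tsideal J"
    have eq: "f J * g J - f' J * g' J = (f J - f' J) * g J + f' J * (g J - g' J)"
      by (simp add: algebra_simps)
    show "f J * g J - f' J * g' J \<in> J"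
      unfolding eq using * J
      by (intro tsideal_add[OF J tsidealD(4)[OF J] tsidealD(3)[OF J]]) (auto simp: cong_all_def)
  qed
qed

instance
proof
  fix a b c :: "'a quots"
  have triv: "cong_all f f" for f :: "'a set \<Rightarrow> 'a" by (simp add: cong_all_def tsidealD)
  show "a + b + c = a + (b + c)" by transfer (simp add: add.assoc triv)
  show "a + b = b + a" by transfer (simp add: add.commute triv)
  show "0 + a = a" by transfer (simp add: triv)
  show "- a + a = 0" by transfer (simp add: triv)
  show "a - b = a + - b" by transfer (simp add: triv)
  show "a * b * c = a * (b * c)" by transfer (simp add: mult.assoc triv)
  show "1 * a = a" "a * 1 = a" by (transfer, simp add: triv)+
  show "(a + b) * c = a * c + b * c" by transfer (simp add: distrib_right triv)
  show "a * (b + c) = a * b + a * c" by transfer (simp add: distrib_left triv)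
  show "(0 :: 'a quots) \<noteq> 1"
  proof transfer
    have "tsideal {0 :: 'a}" by (simp add: tsideal_def)
    then show "\<not> cong_all (\<lambda>_. 0 :: 'a) (\<lambda>_. 1)" by (auto simp: cong_all_def)
  qed
qed

end

lift_definition quot_at :: "'a::ring_1 set \<Rightarrow> 'a \<Rightarrow> 'a quots" is "\<lambda>J x J'. if J' = J then x else 0" .

lemma quot_at_add: "quot_at J (x + y) = quot_at J x + quot_at J y"
  by transfer (auto simp: cong_all_def tsidealD)

lemma quot_at_mult: "quot_at J (x * y) = quot_at J x * quot_at J y"
  by transfer (auto simp: cong_all_def tsidealD)

lemma quot_at_eq_0_iff: "tsideal J \<Longrightarrow> quot_at J x = 0 \<longleftrightarrow> x \<in> J"
  by transfer (auto simp: cong_all_def tsidealD)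

lemma quot_at_central:
  assumes "\<And>y. x * y - y * x \<in> J"
  shows "quot_at J x * z = z * quot_at J x"
  using assms by transfer (auto simp: cong_all_def tsidealD)

section \<open>Power series in two variables\<close>

definition fpsY :: "'a::zero fps \<Rightarrow> 'a fps fps" where
  "fpsY f = Abs_fps (\<lambda>j. fps_const (f $ j))"

definition fpsXY :: "'a::zero fps \<Rightarrow> 'a fps fps" where
  "fpsXY f = Abs_fps (\<lambda>j. Abs_fps (\<lambda>i. if i = j then f $ j else 0))"

lemma fpsY_nth: "fpsY f $ j $ i = (if i = 0 then f $ j else 0)"
  by (simp add: fpsY_def)

lemma fpsXY_nth: "fpsXY f $ j $ i = (if i = j then f $ j else 0)"
  by (simp add: fpsXY_def)

lemma fps_fps_eqI: "(\<And>j i. F $ j $ i = G $ j $ i) \<Longrightarrow> F = (G :: 'a::zero fps fps)"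
  by (intro fps_ext) auto

lemma fps_mult_nth_le: "(f * g :: 'a::semiring_0 fps) $ i = (\<Sum>k\<le>i. f $ k * g $ (i - k))"
  by (simp add: fps_mult_nth atLeast0AtMost)

lemma fps_mult_nth_rev: "(f * g :: 'a::semiring_0 fps) $ i = (\<Sum>k\<le>i. f $ (i - k) * g $ k)"
  unfolding fps_mult_nth_le
  by (rule sum.reindex_bij_witness[where i = "\<lambda>k. i - k" and j = "\<lambda>k. i - k"]) auto

lemma fps_central:
  fixes r :: "'a::semiring_0 fps"
  assumes "\<And>k x. r $ k * x = x * r $ k"
  shows "r * f = f * r"
  by (rule fps_ext) (simp add: fps_mult_nth_le[of r] fps_mult_nth_rev[of f] assms)

lemma fpsX_left: "(fps_const r * G :: 'a::semiring_0 fps fps) $ j $ i = (\<Sum>k\<le>i. r $ k * G $ j $ (i - k))"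
  by (subst fps_mult_left_const_nth) (rule fps_mult_nth_le)

lemma fpsX_right: "(G * fps_const r :: 'a::semiring_0 fps fps) $ j $ i = (\<Sum>k\<le>i. G $ j $ (i - k) * r $ k)"
  by (subst fps_mult_right_const_nth) (rule fps_mult_nth_rev)

lemma fpsXY_coeff_mult: "(fpsXY r $ p * h) $ i = (if p \<le> i then r $ p * h $ (i - p) else 0)"
  for h :: "'a::semiring_0 fps"
proof -
  have "(fpsXY r $ p * h) $ i = (\<Sum>k\<le>i. if k = p then r $ p * h $ (i - p) else 0)"
    unfolding fps_mult_nth_le by (intro sum.cong) (auto simp: fpsXY_nth)
  then show ?thesis by simp
qed

lemma mult_fpsXY_coeff: "(h * fpsXY r $ p) $ i = (if p \<le> i then h $ (i - p) * r $ p else 0)"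
  for h :: "'a::semiring_0 fps"
proof -
  have "(h * fpsXY r $ p) $ i = (\<Sum>k\<le>i. if k = p then h $ (i - p) * r $ p else 0)"
    unfolding fps_mult_nth_rev by (intro sum.cong) (auto simp: fpsXY_nth)
  then show ?thesis by simp
qed

lemma fpsXY_left:
  "(fpsXY r * G :: 'a::semiring_0 fps fps) $ j $ i = (\<Sum>k\<le>i. if k \<le> j then r $ k * G $ (j - k) $ (i - k) else 0)"
proof -
  have "(fpsXY r * G) $ j $ i = (\<Sum>p\<le>j. if p \<le> i then r $ p * G $ (j - p) $ (i - p) else 0)"
    by (simp add: fps_mult_nth_le[of "fpsXY r"] fps_sum_nth fpsXY_coeff_mult)
  also have "\<dots> = (\<Sum>p\<in>{..j} \<inter> {..i}. r $ p * G $ (j - p) $ (i - p))"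
    by (subst sum.inter_restrict) auto
  also have "\<dots> = (\<Sum>k\<in>{..i} \<inter> {..j}. r $ k * G $ (j - k) $ (i - k))"
    by (simp add: Int_commute)
  also have "\<dots> = (\<Sum>k\<le>i. if k \<le> j then r $ k * G $ (j - k) $ (i - k) else 0)"
    by (subst sum.inter_restrict) auto
  finally show ?thesis .
qed

lemma fpsXY_right:
  "(G * fpsXY r :: 'a::semiring_0 fps fps) $ j $ i = (\<Sum>k\<le>i. if k \<le> j then G $ (j - k) $ (i - k) * r $ k else 0)"
proof -
  have "(G * fpsXY r) $ j $ i = (\<Sum>p\<le>j. if p \<le> i then G $ (j - p) $ (i - p) * r $ p else 0)"
    by (simp add: fps_mult_nth_rev[of _ "fpsXY r"] fps_sum_nth mult_fpsXY_coeff)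
  also have "\<dots> = (\<Sum>p\<in>{..j} \<inter> {..i}. G $ (j - p) $ (i - p) * r $ p)"
    by (subst sum.inter_restrict) auto
  also have "\<dots> = (\<Sum>k\<in>{..i} \<inter> {..j}. G $ (j - k) $ (i - k) * r $ k)"
    by (simp add: Int_commute)
  also have "\<dots> = (\<Sum>k\<le>i. if k \<le> j then G $ (j - k) $ (i - k) * r $ k else 0)"
    by (subst sum.inter_restrict) auto
  finally show ?thesis .
qed

lemma fpsXY_fpsY_nth: "(fpsXY f * fpsY g) $ j $ i = (if i \<le> j then f $ i * g $ (j - i) else 0)"
  and fpsY_fpsXY_nth: "(fpsY g * fpsXY f) $ j $ i = (if i \<le> j then g $ (j - i) * f $ i else 0)"
  for f g :: "'a::semiring_0 fps"
proof -
  have "(fpsXY f * fpsY g) $ j $ i = (\<Sum>k\<le>i. if k = i then (if i \<le> j then f $ i * g $ (j - i) else 0) else 0)"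
    unfolding fpsXY_left by (intro sum.cong) (auto simp: fpsY_nth)
  then show "(fpsXY f * fpsY g) $ j $ i = (if i \<le> j then f $ i * g $ (j - i) else 0)" by simp
  have "(fpsY g * fpsXY f) $ j $ i = (\<Sum>k\<le>i. if k = i then (if i \<le> j then g $ (j - i) * f $ i else 0) else 0)"
    unfolding fpsXY_right by (intro sum.cong) (auto simp: fpsY_nth)
  then show "(fpsY g * fpsXY f) $ j $ i = (if i \<le> j then g $ (j - i) * f $ i else 0)" by simp
qed

lemma fpsX_fpsY_nth: "(fps_const f * fpsY g) $ j $ i = f $ i * g $ j"
  and fpsY_fpsX_nth: "(fpsY g * fps_const f) $ j $ i = g $ j * f $ i"
  for f g :: "'a::semiring_0 fps"
  by (simp_all add: fpsY_def)

lemma fpsY_add: "fpsY (f + g) = fpsY f + fpsY g"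
  and fpsXY_add: "fpsXY (f + g) = fpsXY f + fpsXY g"
  for f g :: "'a::monoid_add fps"
  by (simp_all add: fps_fps_eqI fpsY_nth fpsXY_nth)

lemma fpsY_mult: "fpsY (f * g) = fpsY f * fpsY g" for f g :: "'a::semiring_0 fps"
proof (rule fps_fps_eqI)
  fix j i
  have "(fpsY f * fpsY g) $ j $ i = (\<Sum>p\<le>j. (fpsY f $ p * fpsY g $ (j - p)) $ i)"
    unfolding fps_mult_nth_le[of "fpsY f"] fps_sum_nth ..
  also have "\<dots> = fpsY (f * g) $ j $ i"
    by (simp add: fpsY_def fps_mult_nth_le[of f])
  finally show "fpsY (f * g) $ j $ i = (fpsY f * fpsY g) $ j $ i" ..
qed

lemma fpsXY_mult: "fpsXY (f * g) = fpsXY f * fpsXY g" for f g :: "'a::semiring_0 fps"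
proof (rule fps_fps_eqI)
  fix j i
  have "(fpsXY f * fpsXY g) $ j $ i = (\<Sum>k\<le>i. if j = i then f $ k * g $ (i - k) else 0)"
    unfolding fpsXY_left by (intro sum.cong) (auto simp: fpsXY_nth)
  then show "fpsXY (f * g) $ j $ i = (fpsXY f * fpsXY g) $ j $ i"
    by (simp add: fpsXY_nth fps_mult_nth_le)
qed

lemma fpsY_const: "fpsY (fps_const c) = fps_const (fps_const c)"
  and fpsXY_const: "fpsXY (fps_const c) = fps_const (fps_const c)"
  by (auto intro!: fps_fps_eqI simp: fpsY_nth fpsXY_nth)

section \<open>Fusion\<close>

declare One_nat_def [simp del]

lemma sum_eq_single:
  assumes "finite A" "a \<in> A" "\<And>i. i \<in> A \<Longrightarrow> i \<noteq> a \<Longrightarrow> f i = (0::'a::comm_monoid_add)"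
  shows "sum f A = f a"
  using assms sum.mono_neutral_right[of A "{a}" f] by auto

lemma sum_eq_pair:
  assumes "finite A" "a \<in> A" "b \<in> A" "a \<noteq> b"
    "\<And>i. i \<in> A \<Longrightarrow> i \<noteq> a \<Longrightarrow> i \<noteq> b \<Longrightarrow> f i = (0::'a::comm_monoid_add)"
  shows "sum f A = f a + f b"
  using assms sum.mono_neutral_right[of A "{a, b}" f] by auto

lemma idx_0_mem: "1 \<le> n \<Longrightarrow> 1 \<in> idx n 0" "1 \<le> n \<Longrightarrow> 2 * n \<in> idx n 0"
  by (auto simp: idx_def)

lemma idx_1_facts:
  assumes "i \<in> idx n 1"
  shows "i \<in> idx n 0" "i \<noteq> 1" "i \<noteq> 2 * n" "1 < i" "i < 2 * n"
    "prm n i \<in> idx n 1" "prm n i \<noteq> 1" "prm n i \<noteq> 2 * n" "prm n (prm n i) = i"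
    "prm n i \<in> idx n 0" "prm n i \<noteq> i"
  using assms prm_neq[OF assms] by (auto simp: idx_def prm_def)

lemma idx_0_cases:
  assumes "i \<in> idx n 0"
  obtains "i = 1" | "i = 2 * n" | "i \<in> idx n 1"
  using assms by (fastforce simp: idx_def)

lemma prm_1 [simp]: "prm n 1 = 2 * n" "prm n (2 * n) = 1"
  by (auto simp: prm_def)

definition fused_entry :: "nat \<Rightarrow> nat \<Rightarrow> nat \<Rightarrow> nat \<Rightarrow> nat \<Rightarrow> nat \<Rightarrow> K fps" where
  "fused_entry n i j k c d = (\<Sum>l\<in>idx n 0. Rb n 0 X1 (i, k) (1, l) * Rb n 0 X2 (j, l) (c, d)
     - fps_const (inverse q) * (Rb n 0 X1 (i, k) (c, l) * Rb n 0 X2 (j, l) (1, d)))"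

context
  fixes n :: nat
  assumes n: "1 \<le> n"
begin

lemma fused_entry_first:
  assumes "i \<in> idx n 0" "j \<in> idx n 0" "k \<in> idx n 0" "k \<noteq> 1" "{c, d} \<subseteq> idx n 0"
  shows "(\<Sum>l\<in>idx n 0. Rb n 0 X1 (i, k) (1, l) * Rb n 0 X2 (j, l) (c, d)) =
     (if i = 1 then Rb n 0 X1 (1, k) (1, k) * Rb n 0 X2 (j, k) (c, d)
      else Rb n 0 X1 (i, k) (1, 2 * n) * Rb n 0 X2 (j, 2 * n) (c, d))"
proof (cases "i = 1")
  case True
  have "Rb n 0 X1 (1, k) (1, l) = 0" if "l \<in> idx n 0" "l \<noteq> k" for l
    using assms that n by (auto simp: Rb_entry idx_0_mem prm_eq_iff prm_def idx_def)
  with True assms show ?thesis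
    by (simp add: sum_eq_single[of _ k])
next
  case False
  have "Rb n 0 X1 (i, k) (1, l) = 0" if "l \<in> idx n 0" "l \<noteq> 2 * n" for l
    using assms that n False by (auto simp: Rb_entry idx_0_mem prm_def idx_def)
  with False assms show ?thesis
    using idx_0_mem[OF n] by (simp add: sum_eq_single[of _ "2 * n"])
qed

lemma fused_entry_second:
  assumes "i \<in> idx n 0" "j \<in> idx n 0" "k \<in> idx n 0" "c \<in> idx n 0" "d \<in> idx n 1"
  shows "(\<Sum>l\<in>idx n 0. Rb n 0 X1 (i, k) (c, l) * Rb n 0 X2 (j, l) (1, d)) =
     (if j = 1 then Rb n 0 X1 (i, k) (c, d) * Rb n 0 X2 (1, d) (1, d)
      else if j = d then Rb n 0 X1 (i, k) (c, 1) * Rb n 0 X2 (d, 1) (1, d) else 0)"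
proof -
  note d = idx_1_facts[OF assms(5)]
  have 1: "Rb n 0 X2 (1, l) (1, d) = 0" if "l \<in> idx n 0" "l \<noteq> d" for l
    using assms that d n by (simp add: Rb_entry idx_0_mem)
  have 2: "Rb n 0 X2 (j, l) (1, d) = 0" if "l \<in> idx n 0" "l \<noteq> 1 \<or> j \<noteq> d" "j \<noteq> 1" for l
    using assms that d n by (simp add: Rb_entry idx_0_mem) auto
  show ?thesis
  proof (cases "j = 1")
    case True
    then show ?thesis using 1 d by (simp add: sum_eq_single[of _ d])
  next
    case False
    then show ?thesis using 2 d idx_0_mem[OF n]
      by (cases "j = d") (simp_all add: sum_eq_single[of _ 1])
  qed
qed

lemma fused_entry_second_vac:
  assumes "i \<in> idx n 0" "j \<in> idx n 0" "k \<in> idx n 0" "c \<in> idx n 0"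
  shows "(\<Sum>l\<in>idx n 0. Rb n 0 X1 (i, k) (c, l) * Rb n 0 X2 (j, l) (1, 1)) =
     (if j = 1 then Rb n 0 X1 (i, k) (c, 1) else 0)"
proof -
  have 1: "Rb n 0 X2 (j, l) (1, 1) = 0" if "l \<in> idx n 0" "l \<noteq> 1 \<or> j \<noteq> 1" for l
    using assms that n by (auto simp: Rb_entry idx_0_mem)
  have 2: "Rb n 0 X2 (1, 1) (1, 1) = 1"
    using n rr_pp[of X2] by (simp add: Rb_entry idx_0_mem)
  show ?thesis
    using 1 2 idx_0_mem[OF n] by (cases "j = 1") (simp_all add: sum_eq_single[of _ 1])
qed

lemma fused_entry_eq:
  assumes "i \<in> idx n 0" "j \<in> idx n 0" "k \<in> idx n 0" "k \<noteq> 1" "c \<in> idx n 1" "d \<in> idx n 1"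
  shows "fused_entry n i j k c d = rr X2 *
    ((if i = 1 \<and> j \<in> idx n 1 \<and> k \<in> idx n 1 then Rb n 1 X1 (j, k) (c, d) else 0)
     - fps_const (inverse q) * (if j = 1 \<and> i \<in> idx n 1 \<and> k \<in> idx n 1 then Rb n 1 X1 (i, k) (c, d) else 0))"
proof -
  note c = idx_1_facts[OF assms(5)] and d = idx_1_facts[OF assms(6)]
  note mem = idx_0_mem[OF n]
  let ?q' = "fps_const (inverse q) :: K fps"
  have cd: "{c, d} \<subseteq> idx n 0" using c d by simp
  have cd_iff: "c = prm n d \<longleftrightarrow> d = prm n c" using c(9) d(9) by metis
  have M: "fused_entry n i j k c d =
     (if i = 1 then Rb n 0 X1 (1, k) (1, k) * Rb n 0 X2 (j, k) (c, d)
      else Rb n 0 X1 (i, k) (1, 2 * n) * Rb n 0 X2 (j, 2 * n) (c, d))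
     - ?q' * (if j = 1 then Rb n 0 X1 (i, k) (c, d) * Rb n 0 X2 (1, d) (1, d)
      else if j = d then Rb n 0 X1 (i, k) (c, 1) * Rb n 0 X2 (d, 1) (1, d) else 0)"
    unfolding fused_entry_def sum_subtractf sum_distrib_left[symmetric]
      fused_entry_first[OF assms(1-4) cd] fused_entry_second[OF assms(1-3) c(1) assms(6)] ..
  have diag: "Rb n 0 X2 (1, d) (1, d) = rr X2"
    using d mem by (simp add: Rb_entry)
  have Z: "Rb n 0 X2 (j, 2 * n) (c, d) = (if j = 1 \<and> d = prm n c then
      - hh * rr X2 * (1 + ss (xi n 0) X2) * fps_const (Qc n (2 * n) d) else 0)"
    if "j \<in> idx n 0" for j
    using that by (auto simp: Rb_entry c d mem cd_iff idx_1_facts(5)[OF c(6)])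
  have Z2: "Rb n 0 X1 (i, k) (1, 2 * n) = (if i = prm n k then
      - hh * rr X1 * ss (xi n 0) X1 * fps_const (Qc n k (2 * n)) else 0)" if "i \<noteq> 1"
    using that assms mem by (auto simp: Rb_entry prm_eq_iff prm_def idx_def)
  consider "i = 1" "k = 2 * n" | "i = 1" "k \<in> idx n 1" | "i \<noteq> 1"
    using assms(3,4) idx_0_cases by metis
  then show ?thesis
  proof cases
    case 1
    have 11: "Rb n 0 X1 (1, 2 * n) (1, 2 * n) = rr X1 * ?q' - hh * rr X1 * ss (xi n 0) X1"
      using mem n by (simp add: Rb_entry)
    have 12: "Rb n 0 X1 (1, 2 * n) (c, d) = (if d = prm n c then
      - hh * rr X1 * (1 + ss (xi n 0) X1) * fps_const (Qc n (2 * n) d) else 0)"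
      by (auto simp: Rb_entry c d mem cd_iff idx_1_facts(5)[OF c(6)])
    have 13: "Rb n 0 X1 (1, 2 * n) (c, 1) = 0"
      using c mem by (simp add: Rb_entry)
    have 14: "(r1 * b - h * r1 * s1) * (- h * r2 * (1 + s2) * Q) - b * (- h * r1 * (1 + s1) * Q * r2) = 0"
      if "(b - h * s1) * (1 + s2) = b * (1 + s1)" for r1 r2 s1 s2 b h Q :: "K fps"
    proof -
      have "(r1 * b - h * r1 * s1) * (- h * r2 * (1 + s2) * Q) = - h * r1 * r2 * Q * ((b - h * s1) * (1 + s2))"
        by (simp add: algebra_simps)
      then show ?thesis unfolding that by (simp add: algebra_simps)
    qed
    have "2 * n \<notin> idx n 1" using idx_1_facts(3) by blast
    moreover have "fused_entry n i j k c d = (if j = 1 \<and> d = prm n c then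
       (rr X1 * ?q' - hh * rr X1 * ss (xi n 0) X1) *
         (- hh * rr X2 * (1 + ss (xi n 0) X2) * fps_const (Qc n (2 * n) d))
       - ?q' * (- hh * rr X1 * (1 + ss (xi n 0) X1) * fps_const (Qc n (2 * n) d) * rr X2) else 0)"
      unfolding M unfolding 1 diag Z[OF assms(2)] 11 12 13 by simp
    ultimately show ?thesis
      unfolding 14[OF ss_outer[OF xi_neq_0]] using 1 by simp
  next
    case 2
    note k = idx_1_facts[OF 2(2)]
    have 21: "Rb n 0 X1 (1, k) (1, k) = rr X1"
      using k mem by (simp add: Rb_entry)
    have 22: "Rb n 0 X1 (1, k) (c, d) = 0"
      using k c d mem by (auto simp: Rb_entry)
    have 23: "Rb n 0 X1 (1, k) (c, 1) = (if k = c then X1 * pp X1 else 0)"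
      using k c d mem by (auto simp: Rb_entry)
    have 24: "Rb n 0 X2 (d, 1) (1, d) = pp X2"
      using d mem by (simp add: Rb_entry)
    show ?thesis
    proof (cases "j \<in> idx n 1")
      case True
      note j = idx_1_facts[OF True]
      have *: "rr X1 * Rb n 0 X2 (j, k) (c, d) - ?q' * (if j = d \<and> k = c then X1 * pp X1 * pp X2 else 0)
         = rr X2 * Rb n 1 X1 (j, k) (c, d)"
      proof -
        have gen: "r1 * ((if P then r2 * w else 0) + (if P' then E2 else 0) - (if T then hh * r2 * S * C else 0))
            - ?q' * (if P' then G else 0)
          = r2 * ((if P then r1 * w else 0) + (if P' then E1 else 0) - (if T then hh * r1 * S * C else 0))"
          if "r1 * E2 - ?q' * G = r2 * E1" for r1 r2 w E1 E2 S C G P P' T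
        proof -
          from that have "?q' * G = r1 * E2 - r2 * E1" by (simp add: algebra_simps)
          then show ?thesis by (cases P'; simp add: algebra_simps)
        qed
        have "rr X1 * (if j < k then X2 * pp X2 else pp X2) - ?q' * (X1 * pp X1 * pp X2)
           = rr X2 * (if j < k then X1 * pp X1 else pp X1)"
          using swap_less swap_ge by simp
        moreover have X1_0: "fps_nth X1 0 = 0" by simp
        moreover have "{j, k, c, d} \<subseteq> idx n 0" "{j, k, c, d} \<subseteq> idx n 1" "j = d \<and> k = c \<longleftrightarrow> c = k \<and> d = j"
          using assms(5,6) True c(1) d(1) j(1) k(1) 2(2) by auto
        ultimately show ?thesis
          by (simp only: Rb_entry X2_0 X1_0 ss_shift gen)
      qed
      show ?thesis
        using True j unfolding M unfolding 2(1) 21 23 24 by (simp add: 2(2) *[symmetric] mult.assoc)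
    next
      case False
      then have "j = 1 \<or> j = 2 * n" using assms(2) idx_0_cases by metis
      then have "Rb n 0 X2 (j, k) (c, d) = 0"
        using k c d mem by (auto simp: Rb_entry)
      with False 2 d(2) assms(6) show ?thesis unfolding M unfolding 2(1) 21 22 by auto
    qed
  next
    case 3
    have 31: "Rb n 0 X1 (i, k) (c, 1) = 0"
      using 3 assms c mem by (auto simp: Rb_entry)
    have "Rb n 0 X1 (i, k) (1, 2 * n) * Rb n 0 X2 (1, 2 * n) (c, d) - ?q' * (Rb n 0 X1 (i, k) (c, d) * rr X2)
      = rr X2 * - (?q' * (if i \<in> idx n 1 \<and> k \<in> idx n 1 then Rb n 1 X1 (i, k) (c, d) else 0))"
    proof (cases "i \<in> idx n 1 \<and> k \<in> idx n 1")
      case True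
      note i = idx_1_facts[OF True[THEN conjunct1]] and k = idx_1_facts[OF True[THEN conjunct2]]
      have D: "Rb n 0 X1 (i, k) (c, d) - Rb n 1 X1 (i, k) (c, d) = (if i = prm n k \<and> d = prm n c then
         hh * rr X1 * (ss (xi n 0) X2 - ss (xi n 0) X1) * fps_const (Qc n k d) else 0)"
        using c d by (simp add: Rb_entry assms(5,6) True c(1) d(1) i(1) k(1) ss_shift cd_iff
            algebra_simps)
      have Q: "fps_const (Qc n k (2 * n)) * fps_const (Qc n (2 * n) d) = fps_const (Qc n k d)"
        by (simp add: Qc_trans)
      have *: "(- h * r1 * s1 * Qa) * (- h * r2 * (1 + s2) * Qb) = b * r2 * (h * r1 * (s2 - s1) * Q)"
        if "h * (s1 * (1 + s2)) = b * (s2 - s1)" "Qa * Qb = Q" for r1 r2 s1 s2 b h Qa Qb Q :: "K fps"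
      proof -
        have "(- h * r1 * s1 * Qa) * (- h * r2 * (1 + s2) * Qb) = (h * (s1 * (1 + s2))) * (h * r1 * r2 * (Qa * Qb))"
          by (simp only: mult_minus_left mult_minus_right minus_minus mult_ac)
        then show ?thesis unfolding that by (simp add: mult_ac)
      qed
      have "Rb n 0 X1 (i, k) (1, 2 * n) * Rb n 0 X2 (1, 2 * n) (c, d)
         = ?q' * rr X2 * (Rb n 0 X1 (i, k) (c, d) - Rb n 1 X1 (i, k) (c, d))"
      proof (cases "i = prm n k \<and> d = prm n c")
        case True
        have vac: "1 = (1::nat) \<and> d = prm n c" using True by simp
        show ?thesis
          unfolding D Z2[OF 3] Z[OF mem(1)] if_P[OF True] if_P[OF True[THEN conjunct1]]
            if_P[OF vac]
          by (rule *[OF ss_inner[OF xi_neq_0] Q])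
      next
        case False
        then show ?thesis unfolding D Z2[OF 3] Z[OF mem(1)] by auto
      qed
      moreover have "b * r * (A - A') - b * (A * r) = r * - (b * A')" for b r A A' :: "K fps"
        by (simp add: algebra_simps)
      ultimately show ?thesis unfolding if_P[OF True] by simp
    next
      case False
      then have *: "i = 2 * n \<or> k = 2 * n"
        using assms(1,3,4) 3 idx_0_cases by metis
      have ik: "i \<noteq> prm n k"
      proof
        assume "i = prm n k"
        then have "prm n i = k" using prm_prm[OF assms(3)] by simp
        with * \<open>i = prm n k\<close> show False using 3 assms(4) by auto
      qed
      have "\<not> (c = i \<and> d = k)" "\<not> (c = k \<and> d = i)" "\<not> (i = prm n k \<and> c = prm n d)"
        using * c(3) d(3) ik by auto
      note off = this[THEN if_not_P]
      have "{i, k, c, d} \<subseteq> idx n 0" using assms(1,3) c(1) d(1) by simp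
      then have "Rb n 0 X1 (i, k) (c, d) = 0"
        by (subst Rb_entry, assumption, simp) (unfold off, simp)
      then show ?thesis unfolding Z2[OF 3] if_not_P[OF False] if_not_P[OF ik] by simp
    qed
    moreover have "Rb n 0 X2 (j, 2 * n) (c, d) = 0" if "j \<noteq> 1"
      using that Z[OF assms(2)] by simp
    ultimately show ?thesis using 3 31 unfolding M diag by simp
  qed
qed

lemma fused_entry_vac:
  assumes "i \<in> idx n 0" "j \<in> idx n 0" "k \<in> idx n 0" "k \<noteq> 1" "c \<in> idx n 1"
  shows "fused_entry n i j k c 1 = 0"
proof -
  note c = idx_1_facts[OF assms(5)]
  note mem = idx_0_mem[OF n]
  let ?q' = "fps_const (inverse q) :: K fps"
  have cd: "{c, 1} \<subseteq> idx n 0" using c mem by simp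
  have M: "fused_entry n i j k c 1 =
     (if i = 1 then Rb n 0 X1 (1, k) (1, k) * Rb n 0 X2 (j, k) (c, 1)
      else Rb n 0 X1 (i, k) (1, 2 * n) * Rb n 0 X2 (j, 2 * n) (c, 1))
     - ?q' * (if j = 1 then Rb n 0 X1 (i, k) (c, 1) else 0)"
    unfolding fused_entry_def sum_subtractf sum_distrib_left[symmetric]
      fused_entry_first[OF assms(1-4) cd] fused_entry_second_vac[OF assms(1-3) c(1)] ..
  show ?thesis
  proof (cases "i = 1")
    case True
    have "Rb n 0 X2 (j, k) (c, 1) = (if j = 1 \<and> k = c then X2 * pp X2 else 0)"
      using assms c mem by (auto simp: Rb_entry)
    moreover have "Rb n 0 X1 (1, c) (1, c) = rr X1"
      using assms c mem by (simp add: Rb_entry)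
    moreover have "Rb n 0 X1 (1, k) (c, 1) = (if k = c then X1 * pp X1 else 0)"
      using assms c mem by (auto simp: Rb_entry)
    ultimately show ?thesis using True swap_vac unfolding M by simp
  next
    case False
    have "Rb n 0 X2 (j, 2 * n) (c, 1) = 0"
      using assms c mem n by (auto simp: Rb_entry)
    moreover have "Rb n 0 X1 (i, k) (c, 1) = 0"
      using assms c mem False by (auto simp: Rb_entry)
    ultimately show ?thesis using False unfolding M by simp
  qed
qed

end

lemma sum_idx_0:
  assumes "1 \<le> n"
  shows "sum f (idx n 0) = f 1 + f (2 * n) + sum f (idx n 1)"
proof -
  have "idx n 0 = insert 1 (insert (2 * n) (idx n 1))"
    using assms by (auto simp: idx_def)
  moreover have "(1::nat) \<noteq> 2 * n" by presburger
  moreover have "1 \<notin> idx n 1" "2 * n \<notin> idx n 1"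
    using idx_1_facts(2,3) by blast+
  ultimately show ?thesis by (simp add: add.assoc)
qed

lemma sum_rotate:
  "(\<Sum>i\<in>A. \<Sum>k\<in>B. \<Sum>j\<in>C. g i k j) = (\<Sum>j\<in>C. \<Sum>i\<in>A. \<Sum>k\<in>B. g i k j)"
  by (subst sum.swap[of _ C B], subst sum.swap[of _ C A], rule refl)

lemma sum_swap_pairs:
  "(\<Sum>i\<in>A. \<Sum>k\<in>B. \<Sum>j\<in>C. \<Sum>l\<in>E. f i k j l) = (\<Sum>j\<in>C. \<Sum>l\<in>E. \<Sum>i\<in>A. \<Sum>k\<in>B. f i k j l)"
  by (subst sum_rotate, intro sum.cong refl, rule sum_rotate)

lemma sum_sum_eq_single:
  assumes "finite A" "finite B" "a \<in> A" "b \<in> B"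
    "\<And>i j. i \<in> A \<Longrightarrow> j \<in> B \<Longrightarrow> \<not> (i = a \<and> j = b) \<Longrightarrow> f i j = (0::'a::comm_monoid_add)"
  shows "(\<Sum>i\<in>A. \<Sum>j\<in>B. f i j) = f a b"
proof -
  have "(\<Sum>i\<in>A. \<Sum>j\<in>B. f i j) = (\<Sum>j\<in>B. f a j)"
    using assms by (intro sum_eq_single) auto
  also have "\<dots> = f a b"
    using assms by (intro sum_eq_single) auto
  finally show ?thesis .
qed

lemma sum_sum_eq_pair:
  assumes "finite A" "finite B" "a \<in> A" "b \<in> B" "c \<in> A" "d \<in> B" "a \<noteq> c"
    "\<And>i j. i \<in> A \<Longrightarrow> j \<in> B \<Longrightarrow> \<not> (i = a \<and> j = b) \<Longrightarrow> \<not> (i = c \<and> j = d) \<Longrightarrow>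
      f i j = (0::'a::comm_monoid_add)"
  shows "(\<Sum>i\<in>A. \<Sum>j\<in>B. f i j) = f a b + f c d"
proof -
  have "(\<Sum>i\<in>A. \<Sum>j\<in>B. f i j) = (\<Sum>j\<in>B. f a j) + (\<Sum>j\<in>B. f c j)"
    using assms by (intro sum_eq_pair) auto
  also have "(\<Sum>j\<in>B. f a j) = f a b"
    using assms by (intro sum_eq_single) auto
  also have "(\<Sum>j\<in>B. f c j) = f c d"
    using assms by (intro sum_eq_single) auto
  finally show ?thesis .
qed

lemma Rb_eq_0:
  assumes "{a, b, c, d} \<subseteq> idx n m" "fps_nth u 0 = 0"
    "\<not> (c = a \<and> d = b)" "\<not> (c = b \<and> d = a)" "\<not> (a = prm n b \<and> c = prm n d)"
  shows "Rb n m u (a, b) (c, d) = 0"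
  unfolding Rb_entry[OF assms(1,2)] assms(3-5)[THEN if_not_P] by simp

lemma Rb_fuse:
  assumes "1 \<le> n" "{a, b, c, d} \<subseteq> idx n 1"
  shows "rr X2 * Rb n 0 X1 (a, b) (c, d) - fps_const q * (Rb n 0 X1 (a, b) (1, 2 * n) * Rb n 0 X2 (1, 2 * n) (c, d))
    = rr X2 * Rb n 1 X1 (a, b) (c, d)"
proof -
  have abcd: "a \<in> idx n 1" "b \<in> idx n 1" "c \<in> idx n 1" "d \<in> idx n 1" using assms by auto
  note a = idx_1_facts[OF abcd(1)] and b = idx_1_facts[OF abcd(2)]
    and c = idx_1_facts[OF abcd(3)] and d = idx_1_facts[OF abcd(4)]
  let ?q' = "fps_const (inverse q) :: K fps"
  have diag: "Rb n 0 X2 (1, d) (1, d) = rr X2"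
    using d idx_0_mem[OF assms(1)] by (simp add: Rb_entry)
  have "Rb n 0 X1 (a, b) (1, 2 * n) * Rb n 0 X2 (1, 2 * n) (c, d) - ?q' * (Rb n 0 X1 (a, b) (c, d) * rr X2)
     = fused_entry n a 1 b c d"
    unfolding fused_entry_def sum_subtractf sum_distrib_left[symmetric]
    using fused_entry_first[OF assms(1) a(1) idx_0_mem(1)[OF assms(1)] b(1) b(2), of c d]
      fused_entry_second[OF assms(1) a(1) idx_0_mem(1)[OF assms(1)] b(1) c(1) abcd(4)] a(2) c(1) d(1) diag by simp
  also have "\<dots> = rr X2 * - (?q' * Rb n 1 X1 (a, b) (c, d))"
    using fused_entry_eq[OF assms(1) a(1) idx_0_mem(1)[OF assms(1)] b(1) b(2) abcd(3,4)] abcd a(2) by simp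
  finally have *: "Rb n 0 X1 (a, b) (1, 2 * n) * Rb n 0 X2 (1, 2 * n) (c, d) =
     ?q' * (Rb n 0 X1 (a, b) (c, d) * rr X2) - ?q' * (rr X2 * Rb n 1 X1 (a, b) (c, d))"
    by (simp add: algebra_simps)
  have "r * A - fps_const q * (?q' * (A * r) - ?q' * (r * B)) = r * B" for A B r :: "K fps"
  proof -
    have "fps_const q * (?q' * (A * r) - ?q' * (r * B)) = (fps_const q * ?q') * (A * r - r * B)"
      by (simp only: right_diff_distrib mult_ac)
    then show ?thesis unfolding cq_inv by (simp add: mult.commute)
  qed
  then show ?thesis unfolding * .
qed

lemma Rb_row_vac:
  fixes h :: "K fps \<Rightarrow> 'b::semiring_0"
  assumes n: "1 \<le> n" and u: "u $ 0 = 0" and h: "h 0 = 0"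
  shows "(\<Sum>j\<in>idx n 0. \<Sum>l\<in>idx n 0. h (Rb n 0 u (1, 1) (j, l)) * Y j l) = h 1 * Y 1 1"
proof -
  have "Rb n 0 u (1, 1) (1, 1) = 1"
    using n rr_pp[OF u] idx_0_mem[OF n] u by (simp add: Rb_entry)
  moreover have "Rb n 0 u (1, 1) (j, l) = 0" if "j \<in> idx n 0" "l \<in> idx n 0" "\<not> (j = 1 \<and> l = 1)" for j l
    using that n u idx_0_mem[OF n] by (intro Rb_eq_0) auto
  ultimately show ?thesis
    using idx_0_mem[OF n] h by (subst sum_sum_eq_single[of "idx n 0" "idx n 0" 1 1]) simp_all
qed

lemma Rb_row_1:
  fixes h :: "K fps \<Rightarrow> 'b::semiring_0"
  assumes n: "1 \<le> n" and u: "u $ 0 = 0" and h: "h 0 = 0" and k: "k \<in> idx n 1"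
  shows "(\<Sum>j\<in>idx n 0. \<Sum>l\<in>idx n 0. h (Rb n 0 u (1, k) (j, l)) * Y j l) = h (rr u) * Y 1 k + h (u * pp u) * Y k 1"
proof -
  note k = idx_1_facts[OF k]
  have "Rb n 0 u (1, k) (1, k) = rr u" "Rb n 0 u (1, k) (k, 1) = u * pp u"
    using idx_0_mem[OF n] k u by (simp_all add: Rb_entry)
  moreover have "Rb n 0 u (1, k) (j, l) = 0"
    if "j \<in> idx n 0" "l \<in> idx n 0" "\<not> (j = 1 \<and> l = k)" "\<not> (j = k \<and> l = 1)" for j l
    using that idx_0_mem[OF n] k(1,7) u by (intro Rb_eq_0) auto
  ultimately show ?thesis using k idx_0_mem[OF n] h
    by (subst sum_sum_eq_pair[of "idx n 0" "idx n 0" 1 k k 1]) simp_all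
qed

lemma Rb_col_vac:
  fixes h :: "K fps \<Rightarrow> 'b::semiring_0"
  assumes n: "1 \<le> n" and u: "u $ 0 = 0" and h: "h 0 = 0"
  shows "(\<Sum>j\<in>idx n 0. \<Sum>l\<in>idx n 0. Y j l * h (Rb n 0 u (j, l) (1, 1))) = Y 1 1 * h 1"
proof -
  have "Rb n 0 u (1, 1) (1, 1) = 1"
    using n rr_pp[OF u] idx_0_mem[OF n] u by (simp add: Rb_entry)
  moreover have "Rb n 0 u (j, l) (1, 1) = 0" if "j \<in> idx n 0" "l \<in> idx n 0" "\<not> (j = 1 \<and> l = 1)" for j l
    using that n u idx_0_mem[OF n] by (intro Rb_eq_0) auto
  ultimately show ?thesis
    using idx_0_mem[OF n] h by (subst sum_sum_eq_single[of "idx n 0" "idx n 0" 1 1]) simp_all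
qed

lemma Rb_col_1:
  fixes h :: "K fps \<Rightarrow> 'b::semiring_0"
  assumes n: "1 \<le> n" and u: "u $ 0 = 0" and h: "h 0 = 0" and d: "d \<in> idx n 1"
  shows "(\<Sum>j\<in>idx n 0. \<Sum>l\<in>idx n 0. Y j l * h (Rb n 0 u (j, l) (1, d))) = Y 1 d * h (rr u) + Y d 1 * h (pp u)"
    and "(\<Sum>j\<in>idx n 0. \<Sum>l\<in>idx n 0. Y j l * h (Rb n 0 u (j, l) (d, 1))) = Y 1 d * h (u * pp u) + Y d 1 * h (rr u)"
proof -
  note d = idx_1_facts[OF d]
  have v: "Rb n 0 u (1, d) (1, d) = rr u" "Rb n 0 u (d, 1) (1, d) = pp u"
    "Rb n 0 u (d, 1) (d, 1) = rr u" "Rb n 0 u (1, d) (d, 1) = u * pp u"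
    using idx_0_mem[OF n] d u by (simp_all add: Rb_entry)
  have "Rb n 0 u (j, l) (1, d) = 0"
    if "j \<in> idx n 0" "l \<in> idx n 0" "\<not> (j = 1 \<and> l = d)" "\<not> (j = d \<and> l = 1)" for j l
    using that idx_0_mem[OF n] d(1,7) u by (intro Rb_eq_0) auto
  then show "(\<Sum>j\<in>idx n 0. \<Sum>l\<in>idx n 0. Y j l * h (Rb n 0 u (j, l) (1, d))) = Y 1 d * h (rr u) + Y d 1 * h (pp u)"
    using d idx_0_mem[OF n] h v
    by (subst sum_sum_eq_pair[of "idx n 0" "idx n 0" 1 d d 1]) simp_all
  have "Rb n 0 u (j, l) (d, 1) = 0"
    if "j \<in> idx n 0" "l \<in> idx n 0" "\<not> (j = 1 \<and> l = d)" "\<not> (j = d \<and> l = 1)" for j l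
    using that idx_0_mem[OF n] d(1,3) u by (intro Rb_eq_0) auto
  then show "(\<Sum>j\<in>idx n 0. \<Sum>l\<in>idx n 0. Y j l * h (Rb n 0 u (j, l) (d, 1))) = Y 1 d * h (u * pp u) + Y d 1 * h (rr u)"
    using d idx_0_mem[OF n] h v
    by (subst sum_sum_eq_pair[of "idx n 0" "idx n 0" 1 d d 1]) simp_all
qed

locale rll_triple =
  fixes n :: nat and \<iota> \<iota>' :: "K fps \<Rightarrow> 'b::ring_1"
    and L1 L2 L3 :: "nat \<Rightarrow> nat \<Rightarrow> 'b" and h1 h2 h3 :: 'b
  assumes n: "1 \<le> n"
    and \<iota>_add: "\<iota> (f + g) = \<iota> f + \<iota> g" and \<iota>_mult: "\<iota> (f * g) = \<iota> f * \<iota> g"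
    and \<iota>_central: "\<iota> f * x = x * \<iota> f"
    and \<iota>'_add: "\<iota>' (f + g) = \<iota>' f + \<iota>' g" and \<iota>'_mult: "\<iota>' (f * g) = \<iota>' f * \<iota>' g"
    and \<iota>'_central: "\<iota>' f * x = x * \<iota>' f"
    and \<iota>_const: "\<iota>' (fps_const k) = \<iota> (fps_const k)"
    and unit: "\<iota> 1 * L1 i j = L1 i j" "\<iota> 1 * L2 i j = L2 i j" "\<iota> 1 * L3 i j = L3 i j"
    and h1: "h1 * L1 1 1 = \<iota> 1" "L1 1 1 * h1 = \<iota> 1"
    and h2: "L2 1 1 * h2 = \<iota> 1"
    and h3: "h3 * L3 1 1 = \<iota> 1" "L3 1 1 * h3 = \<iota> 1"
    and H13: "\<lbrakk>a \<in> idx n 0; b \<in> idx n 0; c \<in> idx n 0; d \<in> idx n 0\<rbrakk> \<Longrightarrow>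
      (\<Sum>i\<in>idx n 0. \<Sum>k\<in>idx n 0. \<iota> (Rb n 0 X1 (a, b) (i, k)) * (L1 i c * L3 k d))
      = (\<Sum>i\<in>idx n 0. \<Sum>k\<in>idx n 0. L3 b k * L1 a i * \<iota>' (Rb n 0 X1 (i, k) (c, d)))"
    and H23: "\<lbrakk>a \<in> idx n 0; b \<in> idx n 0; c \<in> idx n 0; d \<in> idx n 0\<rbrakk> \<Longrightarrow>
      (\<Sum>i\<in>idx n 0. \<Sum>k\<in>idx n 0. \<iota> (Rb n 0 X2 (a, b) (i, k)) * (L2 i c * L3 k d))
      = (\<Sum>i\<in>idx n 0. \<Sum>k\<in>idx n 0. L3 b k * L2 a i * \<iota>' (Rb n 0 X2 (i, k) (c, d)))"
    and D11: "c \<in> idx n 1 \<Longrightarrow>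
      L1 1 1 * L2 1 c - \<iota> (fps_const (inverse q)) * (L1 1 c * L2 1 1) = 0"
    and D1j: "\<lbrakk>c \<in> idx n 1; j \<in> idx n 1\<rbrakk> \<Longrightarrow>
      L1 1 1 * L2 j c - \<iota> (fps_const (inverse q)) * (L1 1 c * L2 j 1) =
      - \<iota> (fps_const q) * (L1 j 1 * L2 1 c - \<iota> (fps_const (inverse q)) * (L1 j c * L2 1 1))"
begin

abbreviation "I \<equiv> idx n 0"
abbreviation "V \<equiv> idx n 1"
abbreviation "R1 \<equiv> Rb n 0 X1"
abbreviation "R2 \<equiv> Rb n 0 X2"
abbreviation "R' \<equiv> Rb n 1 X1"
abbreviation "q' \<equiv> fps_const (inverse q) :: K fps"

definition D :: "nat \<Rightarrow> nat \<Rightarrow> nat \<Rightarrow> 'b" where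
  "D i j c = L1 i 1 * L2 j c - \<iota> q' * (L1 i c * L2 j 1)"

definition S1 :: "nat \<Rightarrow> nat \<Rightarrow> 'b" where
  "S1 i j = L1 i j - L1 i 1 * h1 * L1 1 j"

definition S3 :: "nat \<Rightarrow> nat \<Rightarrow> 'b" where
  "S3 i j = L3 i j - L3 i 1 * h3 * L3 1 j"

lemma \<iota>_0 [simp]: "\<iota> 0 = 0"
  using \<iota>_add[of 0 0] by simp

lemma \<iota>'_0 [simp]: "\<iota>' 0 = 0"
  using \<iota>'_add[of 0 0] by simp

lemma \<iota>_minus: "\<iota> (- f) = - \<iota> f"
  using \<iota>_add[of f "- f"] by (simp add: eq_neg_iff_add_eq_0 add.commute)

lemma \<iota>'_minus: "\<iota>' (- f) = - \<iota>' f"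
  using \<iota>'_add[of f "- f"] by (simp add: eq_neg_iff_add_eq_0 add.commute)

lemma \<iota>_diff: "\<iota> (f - g) = \<iota> f - \<iota> g"
  using \<iota>_add[of f "- g"] by (simp add: \<iota>_minus)

lemma \<iota>'_diff: "\<iota>' (f - g) = \<iota>' f - \<iota>' g"
  using \<iota>'_add[of f "- g"] by (simp add: \<iota>'_minus)

lemma \<iota>'_sum: "\<iota>' (sum f A) = (\<Sum>i\<in>A. \<iota>' (f i))"
  by (induction A rule: infinite_finite_induct) (simp_all add: \<iota>'_add)

lemma \<iota>_1: "\<iota>' 1 = \<iota> 1"
  using \<iota>_const[of 1] by simp

lemma left_commute: "x * (\<iota> f * y) = \<iota> f * (x * y)" "x * (\<iota>' f * y) = \<iota>' f * (x * y)"
  by (simp_all only: mult.assoc[symmetric] \<iota>_central[of f x, symmetric] \<iota>'_central[of f x, symmetric])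

lemmas pull = left_commute[of "L1 i j" for i j] left_commute[of "L2 i j" for i j] left_commute[of "L3 i j" for i j]
  \<iota>_central[symmetric, of "L1 i j" for i j] \<iota>_central[symmetric, of "L2 i j" for i j]
  \<iota>_central[symmetric, of "L3 i j" for i j]
  \<iota>'_central[symmetric, of "L1 i j" for i j] \<iota>'_central[symmetric, of "L2 i j" for i j]
  \<iota>'_central[symmetric, of "L3 i j" for i j]

lemma unit_right: "L1 i j * \<iota> 1 = L1 i j" "L2 i j * \<iota> 1 = L2 i j" "L3 i j * \<iota> 1 = L3 i j"
  by (simp_all only: \<iota>_central[symmetric] unit)

lemma mem: "1 \<in> I" "2 * n \<in> I"
  using idx_0_mem[OF n] by auto

lemma triple:
  assumes "a \<in> I" "e \<in> I" "b \<in> I" "c \<in> I" "f \<in> I" "d \<in> I"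
  shows "(\<Sum>i\<in>I. \<Sum>k\<in>I. \<Sum>j\<in>I. \<Sum>l\<in>I. \<iota> (R1 (a, b) (i, k)) * (\<iota> (R2 (e, k) (j, l)) * (L1 i c * L2 j f * L3 l d)))
    = (\<Sum>k\<in>I. \<Sum>i\<in>I. \<Sum>j\<in>I. \<Sum>l\<in>I. L3 b k * (L1 a i * L2 e j * \<iota>' (R1 (i, k) (c, l) * R2 (j, l) (f, d))))"
proof -
  have inner: "(\<Sum>j\<in>I. \<Sum>l\<in>I. \<iota> (R1 (a, b) (i, k)) * (\<iota> (R2 (e, k) (j, l)) * (L1 i c * L2 j f * L3 l d)))
     = (\<Sum>j\<in>I. \<Sum>l\<in>I. \<iota> (R1 (a, b) (i, k)) * (L1 i c * L3 k l) * (L2 e j * \<iota>' (R2 (j, l) (f, d))))"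
    (is "?lhs = ?rhs") if "k \<in> I" for i k
  proof -
    have "?lhs = \<iota> (R1 (a, b) (i, k)) * L1 i c * (\<Sum>j\<in>I. \<Sum>l\<in>I. \<iota> (R2 (e, k) (j, l)) * (L2 j f * L3 l d))"
      unfolding sum_distrib_left
      by (intro sum.cong refl) (simp only: mult.assoc pull)
    also have "\<dots> = ?rhs"
      unfolding H23[OF assms(2) that assms(5,6)] by (simp add: sum_distrib_left mult.assoc)
    finally show ?thesis .
  qed
  have "(\<Sum>i\<in>I. \<Sum>k\<in>I. \<Sum>j\<in>I. \<Sum>l\<in>I. \<iota> (R1 (a, b) (i, k)) * (\<iota> (R2 (e, k) (j, l)) * (L1 i c * L2 j f * L3 l d)))
    = (\<Sum>i\<in>I. \<Sum>k\<in>I. \<Sum>j\<in>I. \<Sum>l\<in>I. \<iota> (R1 (a, b) (i, k)) * (L1 i c * L3 k l) * (L2 e j * \<iota>' (R2 (j, l) (f, d))))"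
    by (rule sum.cong[OF refl], rule sum.cong[OF refl], rule inner)
  also have "\<dots> = (\<Sum>j\<in>I. \<Sum>l\<in>I. \<Sum>i\<in>I. \<Sum>k\<in>I. \<iota> (R1 (a, b) (i, k)) * (L1 i c * L3 k l) * (L2 e j * \<iota>' (R2 (j, l) (f, d))))"
    by (rule sum_swap_pairs)
  also have "\<dots> = (\<Sum>j\<in>I. \<Sum>l\<in>I. (\<Sum>i\<in>I. \<Sum>k\<in>I. L3 b k * L1 a i * \<iota>' (R1 (i, k) (c, l))) * (L2 e j * \<iota>' (R2 (j, l) (f, d))))"
  proof (rule sum.cong[OF refl], rule sum.cong[OF refl])
    fix j l assume "l \<in> I"
    then show "(\<Sum>i\<in>I. \<Sum>k\<in>I. \<iota> (R1 (a, b) (i, k)) * (L1 i c * L3 k l) * (L2 e j * \<iota>' (R2 (j, l) (f, d))))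
      = (\<Sum>i\<in>I. \<Sum>k\<in>I. L3 b k * L1 a i * \<iota>' (R1 (i, k) (c, l))) * (L2 e j * \<iota>' (R2 (j, l) (f, d)))"
      unfolding H13[OF assms(1,3,4) \<open>l \<in> I\<close>, symmetric] sum_distrib_right by (intro refl)
  qed
  also have "\<dots> = (\<Sum>j\<in>I. \<Sum>l\<in>I. \<Sum>i\<in>I. \<Sum>k\<in>I. L3 b k * (L1 a i * L2 e j * \<iota>' (R1 (i, k) (c, l) * R2 (j, l) (f, d))))"
    unfolding sum_distrib_right
    by (intro sum.cong refl) (simp only: \<iota>'_mult mult.assoc pull)
  also have "\<dots> = (\<Sum>k\<in>I. \<Sum>i\<in>I. \<Sum>j\<in>I. \<Sum>l\<in>I. L3 b k * (L1 a i * L2 e j * \<iota>' (R1 (i, k) (c, l) * R2 (j, l) (f, d))))"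
    by (subst sum_swap_pairs, rule sum.swap)
  finally show ?thesis .
qed

lemma fused_triple:
  assumes "a \<in> I" "b \<in> I" "c \<in> I" "d \<in> I"
  shows "(\<Sum>i\<in>I. \<Sum>k\<in>I. \<iota> (R1 (a, b) (i, k)) * (\<Sum>j\<in>I. \<Sum>l\<in>I. \<iota> (R2 (1, k) (j, l)) * (D i j c * L3 l d)))
    = (\<Sum>k\<in>I. L3 b k * (\<Sum>i\<in>I. \<Sum>j\<in>I. L1 a i * L2 1 j * \<iota>' (fused_entry n i j k c d)))"
proof -
  have term_left: "x * (y * ((u - \<iota> q' * v) * w)) = x * (y * (u * w)) - \<iota> q' * (x * (y * (v * w)))" for x y u v w
    by (simp add: right_diff_distrib left_diff_distrib mult.assoc left_commute[of x] left_commute[of y])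
  have term_right: "\<iota>' (fused_entry n i j k c d) = (\<Sum>l\<in>I. \<iota>' (R1 (i, k) (1, l) * R2 (j, l) (c, d))
      - \<iota> q' * \<iota>' (R1 (i, k) (c, l) * R2 (j, l) (1, d)))" for i j k
    unfolding fused_entry_def \<iota>'_sum \<iota>'_diff \<iota>'_mult \<iota>_const ..
  have "(\<Sum>i\<in>I. \<Sum>k\<in>I. \<iota> (R1 (a, b) (i, k)) * (\<Sum>j\<in>I. \<Sum>l\<in>I. \<iota> (R2 (1, k) (j, l)) * (D i j c * L3 l d)))
    = (\<Sum>i\<in>I. \<Sum>k\<in>I. \<Sum>j\<in>I. \<Sum>l\<in>I. \<iota> (R1 (a, b) (i, k)) * (\<iota> (R2 (1, k) (j, l)) * (L1 i 1 * L2 j c * L3 l d)))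
     - \<iota> q' * (\<Sum>i\<in>I. \<Sum>k\<in>I. \<Sum>j\<in>I. \<Sum>l\<in>I. \<iota> (R1 (a, b) (i, k)) * (\<iota> (R2 (1, k) (j, l)) * (L1 i c * L2 j 1 * L3 l d)))"
    unfolding D_def sum_distrib_left term_left sum_subtractf ..
  also have "\<dots> = (\<Sum>k\<in>I. \<Sum>i\<in>I. \<Sum>j\<in>I. \<Sum>l\<in>I. L3 b k * (L1 a i * L2 1 j * \<iota>' (R1 (i, k) (1, l) * R2 (j, l) (c, d))))
     - \<iota> q' * (\<Sum>k\<in>I. \<Sum>i\<in>I. \<Sum>j\<in>I. \<Sum>l\<in>I. L3 b k * (L1 a i * L2 1 j * \<iota>' (R1 (i, k) (c, l) * R2 (j, l) (1, d))))"
    unfolding triple[OF assms(1) mem(1) assms(2) mem(1) assms(3,4)]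
      triple[OF assms(1) mem(1) assms(2,3) mem(1) assms(4)] ..
  also have "\<dots> = (\<Sum>k\<in>I. L3 b k * (\<Sum>i\<in>I. \<Sum>j\<in>I. L1 a i * L2 1 j * \<iota>' (fused_entry n i j k c d)))"
    by (simp only: term_right sum_distrib_left right_diff_distrib sum_subtractf mult.assoc pull)
  finally show ?thesis .
qed

lemma row_vac: "(\<Sum>j\<in>I. \<Sum>l\<in>I. \<iota> (R2 (1, 1) (j, l)) * Y j l) = \<iota> 1 * Y 1 1"
  by (rule Rb_row_vac[where h = \<iota>, OF n X2_0 \<iota>_0])

lemma row_1:
  assumes "k \<in> V"
  shows "(\<Sum>j\<in>I. \<Sum>l\<in>I. \<iota> (R2 (1, k) (j, l)) * Y j l) = \<iota> (rr X2) * Y 1 k + \<iota> (X2 * pp X2) * Y k 1"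
  by (rule Rb_row_1[where h = \<iota>, OF n X2_0 \<iota>_0 assms])

lemma col_vac: "(\<Sum>i\<in>I. \<Sum>k\<in>I. Y i k * \<iota>' (R2 (i, k) (1, 1))) = Y 1 1 * \<iota> 1"
  unfolding \<iota>_1[symmetric] by (rule Rb_col_vac[where h = \<iota>', OF n X2_0 \<iota>'_0])

lemma col_1:
  assumes "d \<in> V"
  shows "(\<Sum>i\<in>I. \<Sum>k\<in>I. Y i k * \<iota>' (R2 (i, k) (1, d))) = Y 1 d * \<iota>' (rr X2) + Y d 1 * \<iota>' (pp X2)"
  by (rule Rb_col_1(1)[where h = \<iota>', OF n X2_0 \<iota>'_0 assms])

lemma D_eq:
  assumes "c \<in> V"
  shows "D i 1 c = - \<iota> q' * (S1 i c * L2 1 1)"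
proof -
  have "L1 1 1 * L2 1 c = \<iota> q' * (L1 1 c * L2 1 1)"
    using D11[OF assms] by simp
  then have "h1 * L1 1 1 * L2 1 c = \<iota> q' * (h1 * L1 1 c * L2 1 1)"
    by (simp only: mult.assoc left_commute[of h1])
  then have "L2 1 c = \<iota> q' * (h1 * L1 1 c * L2 1 1)"
    by (simp add: h1 unit)
  then have "L1 i 1 * L2 1 c = \<iota> q' * (L1 i 1 * h1 * L1 1 c * L2 1 1)"
    by (simp only: mult.assoc pull)
  then show ?thesis
    by (simp add: D_def S1_def algebra_simps)
qed

lemma S3_1: "S3 1 d = 0"
  by (simp add: S3_def h3 unit)

lemma eliminate:
  assumes "L3 1 1 * y + z = 0" "\<iota> 1 * y = y"
  shows "y = - (h3 * z)"
proof -
  have "(h3 * L3 1 1) * y + h3 * z = h3 * (L3 1 1 * y + z)"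
    by (simp only: distrib_left mult.assoc)
  then have "y + h3 * z = 0"
    by (simp only: assms h3 mult_zero_right)
  then show ?thesis by (simp add: eq_neg_iff_add_eq_0)
qed

lemma unit_S3: "\<iota> 1 * S3 i j = S3 i j"
  by (simp add: S3_def right_diff_distrib mult.assoc[symmetric] unit)

end

context rll_triple begin

lemma vac: "1 \<notin> V" "2 * n \<notin> V" "2 * n \<noteq> 1"
proof -
  show "1 \<notin> V" using idx_1_facts(2) by blast
  show "2 * n \<notin> V" using idx_1_facts(3) by blast
  show "2 * n \<noteq> 1" by presburger
qed

lemma L2_S3_commute:
  assumes "b \<in> V" "d \<in> V"
  shows "\<iota> (rr X2) * (L2 1 1 * S3 b d) = S3 b d * L2 1 1 * \<iota>' (rr X2)"
proof -
  note b = idx_1_facts[OF assms(1)] and d = idx_1_facts[OF assms(2)]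
  define y where "y = h3 * L3 1 d"
  define A where "A = L2 1 1 * \<iota>' (rr X2)"
  define B where "B = L2 1 d * \<iota>' (pp X2) - L2 1 1 * y"
  have S3: "S3 l d = L3 l d - L3 l 1 * y" for l
    by (simp add: S3_def y_def mult.assoc)
  have main: "(\<Sum>i\<in>I. \<Sum>k\<in>I. \<iota> (R2 (1, r) (i, k)) * (L2 i 1 * S3 k d)) = L3 r d * A + L3 r 1 * B"
    if r: "r \<in> I" for r
  proof -
    have "(\<Sum>i\<in>I. \<Sum>k\<in>I. \<iota> (R2 (1, r) (i, k)) * (L2 i 1 * S3 k d))
      = (\<Sum>i\<in>I. \<Sum>k\<in>I. \<iota> (R2 (1, r) (i, k)) * (L2 i 1 * L3 k d))
        - (\<Sum>i\<in>I. \<Sum>k\<in>I. \<iota> (R2 (1, r) (i, k)) * (L2 i 1 * L3 k 1)) * y"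
      by (simp add: S3 right_diff_distrib sum_subtractf sum_distrib_right mult.assoc)
    also have "\<dots> = L3 r d * L2 1 1 * \<iota>' (rr X2) + L3 r 1 * L2 1 d * \<iota>' (pp X2) - L3 r 1 * L2 1 1 * \<iota> 1 * y"
      unfolding H23[OF mem(1) r mem(1) d(1)] H23[OF mem(1) r mem(1) mem(1)] col_1[OF assms(2)] col_vac ..
    also have "\<dots> = L3 r d * A + L3 r 1 * B"
      using mult.assoc[of "L3 r 1" "L2 1 1" "\<iota> 1"] unit_right(2) by (simp add: A_def B_def right_diff_distrib mult.assoc[symmetric])
    finally show ?thesis .
  qed
  have "L3 1 d * A + L3 1 1 * B = 0"
    using main[OF mem(1)] by (simp add: row_vac S3_1)
  moreover have "\<iota> 1 * B = B"
    by (simp add: B_def right_diff_distrib mult.assoc[symmetric] unit)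
  ultimately have B: "B = - (h3 * (L3 1 d * A))"
    by (intro eliminate) (simp_all add: add.commute)
  have "\<iota> (rr X2) * (L2 1 1 * S3 b d) = L3 b d * A + L3 b 1 * B"
    using main[OF b(1)] by (simp add: row_1[OF assms(1)] S3_1)
  also have "\<dots> = S3 b d * A"
    by (simp add: B S3_def left_diff_distrib mult.assoc)
  finally show ?thesis by (simp add: A_def mult.assoc)
qed

lemma fused_left:
  assumes "a \<in> V" "b \<in> V" "c \<in> V" "d \<in> V"
  shows "(\<Sum>i\<in>I. \<Sum>k\<in>I. \<iota> (R1 (a, b) (i, k)) * (\<Sum>j\<in>I. \<Sum>l\<in>I. \<iota> (R2 (1, k) (j, l)) * (D i j c * S3 l d)))
    = (\<Sum>i\<in>V. \<Sum>k\<in>V. \<iota> (rr X2 * R' (a, b) (i, k)) * (D i 1 c * S3 k d))"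
proof -
  note a = idx_1_facts[OF assms(1)] and b = idx_1_facts[OF assms(2)]
  define W where "W i k = (\<Sum>j\<in>I. \<Sum>l\<in>I. \<iota> (R2 (1, k) (j, l)) * (D i j c * S3 l d))" for i k
  have W_vac: "W i 1 = 0" for i
    unfolding W_def row_vac by (simp add: S3_1)
  have W_V: "W i k = \<iota> (rr X2) * (D i 1 c * S3 k d)" if "k \<in> V" for i k
    unfolding W_def row_1[OF that] by (simp add: S3_1)
  have W_top: "W 1 (2 * n) = (\<Sum>j\<in>V. \<Sum>l\<in>V. - \<iota> (fps_const q * R2 (1, 2 * n) (j, l)) * (D j 1 c * S3 l d))"
  proof -
    have 1: "R2 (1, 2 * n) (2 * n, l) = 0" if "l \<in> V" for l
      using that idx_1_facts[OF that] mem by (simp add: Rb_entry)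
    have 2: "R2 (1, 2 * n) (j, 2 * n) = 0" if "j \<in> V" for j
      using that idx_1_facts[OF that] mem by (simp add: Rb_entry)
    have 3: "R2 (1, 2 * n) (2 * n, 2 * n) = 0"
      using n mem by (simp add: Rb_entry)
    have D1: "D 1 1 c = 0"
      using D11[OF assms(3)] by (simp add: D_def)
    have "D 1 j c = - \<iota> (fps_const q) * D j 1 c" if "j \<in> V" for j
      using D1j[OF assms(3) that] by (simp add: D_def)
    then have 4: "\<iota> f * (D 1 j c * S3 l d) = - \<iota> (fps_const q * f) * (D j 1 c * S3 l d)" if "j \<in> V" for j l f
      using that by (simp add: \<iota>_mult mult.assoc left_commute(1)[of "\<iota> f"])
    show ?thesis
      by (simp add: W_def sum_idx_0[OF n] S3_1 D1 1 2 3 4 sum.distrib cong: sum.cong)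
  qed
  have R1_V: "R1 (a, b) (i, k) = 0" if "i \<in> I" "i \<notin> V" "k \<in> V" for i k
  proof (rule Rb_eq_0)
    show "{a, b, i, k} \<subseteq> I" using a(1) b(1) that(1) idx_1_facts(1)[OF that(3)] by simp
    show "\<not> (i = a \<and> k = b)" "\<not> (i = b \<and> k = a)" "\<not> (a = prm n b \<and> i = prm n k)"
      using that(2) assms idx_1_facts(6)[OF that(3)] by auto
  qed simp
  have R1_top: "R1 (a, b) (i, 2 * n) = 0" if "i \<in> I" "i \<noteq> 1" for i
  proof (rule Rb_eq_0)
    show "{a, b, i, 2 * n} \<subseteq> I" using a(1) b(1) that(1) mem(2) by simp
    show "\<not> (i = a \<and> 2 * n = b)" "\<not> (i = b \<and> 2 * n = a)" "\<not> (a = prm n b \<and> i = prm n (2 * n))"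
      using that(2) a(3) b(3) by auto
  qed simp
  have row: "(\<Sum>k\<in>I. \<iota> (R1 (a, b) (i, k)) * W i k) =
     (if i = 1 then \<iota> (R1 (a, b) (1, 2 * n)) * W 1 (2 * n) else 0) +
     (if i \<in> V then \<Sum>k\<in>V. \<iota> (R1 (a, b) (i, k)) * (\<iota> (rr X2) * (D i 1 c * S3 k d)) else 0)" if "i \<in> I" for i
    using that R1_V R1_top by (simp add: sum_idx_0[OF n] W_vac W_V)
  have "(\<Sum>i\<in>I. \<Sum>k\<in>I. \<iota> (R1 (a, b) (i, k)) * W i k) = \<iota> (R1 (a, b) (1, 2 * n)) * W 1 (2 * n) +
     (\<Sum>i\<in>V. \<Sum>k\<in>V. \<iota> (R1 (a, b) (i, k)) * (\<iota> (rr X2) * (D i 1 c * S3 k d)))"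
  proof -
    have "(\<Sum>i\<in>I. \<Sum>k\<in>I. \<iota> (R1 (a, b) (i, k)) * W i k) = (\<Sum>i\<in>I.
       (if i = 1 then \<iota> (R1 (a, b) (1, 2 * n)) * W 1 (2 * n) else 0) +
       (if i \<in> V then \<Sum>k\<in>V. \<iota> (R1 (a, b) (i, k)) * (\<iota> (rr X2) * (D i 1 c * S3 k d)) else 0))"
      by (intro sum.cong refl row)
    also have "\<dots> = \<iota> (R1 (a, b) (1, 2 * n)) * W 1 (2 * n) +
       (\<Sum>i\<in>V. \<Sum>k\<in>V. \<iota> (R1 (a, b) (i, k)) * (\<iota> (rr X2) * (D i 1 c * S3 k d)))"
      by (simp add: vac sum_idx_0[OF n] idx_1_facts(2) cong: sum.cong)
    finally show ?thesis .
  qed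
  also have "\<dots> = (\<Sum>i\<in>V. \<Sum>k\<in>V. \<iota> (rr X2 * R1 (a, b) (i, k)
       - fps_const q * (R1 (a, b) (1, 2 * n) * R2 (1, 2 * n) (i, k))) * (D i 1 c * S3 k d))"
    unfolding W_top sum_distrib_left sum.distrib[symmetric]
  proof (intro sum.cong refl)
    fix i k
    have "\<iota> x * (- \<iota> (fps_const q * y) * z) + \<iota> w * (\<iota> v * z) = \<iota> (v * w - fps_const q * (x * y)) * z" for x y z v w
      by (simp add: \<iota>_diff \<iota>_mult left_diff_distrib mult.assoc left_commute(1)[of "\<iota> x"] left_commute(1)[of "\<iota> w"])
    then show "\<iota> (R1 (a, b) (1, 2 * n)) * (- \<iota> (fps_const q * R2 (1, 2 * n) (i, k)) * (D i 1 c * S3 k d))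
       + \<iota> (R1 (a, b) (i, k)) * (\<iota> (rr X2) * (D i 1 c * S3 k d))
      = \<iota> (rr X2 * R1 (a, b) (i, k) - fps_const q * (R1 (a, b) (1, 2 * n) * R2 (1, 2 * n) (i, k))) * (D i 1 c * S3 k d)" .
  qed
  also have "\<dots> = (\<Sum>i\<in>V. \<Sum>k\<in>V. \<iota> (rr X2 * R' (a, b) (i, k)) * (D i 1 c * S3 k d))"
    using assms by (intro sum.cong refl) (simp add: Rb_fuse[OF n])
  finally show ?thesis unfolding W_def .
qed

lemma fused_left_vac:
  assumes "a \<in> V" "c \<in> V" "d \<in> V"
  shows "(\<Sum>i\<in>I. \<Sum>k\<in>I. \<iota> (R1 (a, 1) (i, k)) * (\<Sum>j\<in>I. \<Sum>l\<in>I. \<iota> (R2 (1, k) (j, l)) * (D i j c * S3 l d))) = 0"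
proof (intro sum.neutral ballI)
  fix i k assume ik: "i \<in> I" "k \<in> I"
  note a = idx_1_facts[OF assms(1)]
  have D1: "D 1 1 c = 0"
    using D11[OF assms(2)] by (simp add: D_def)
  consider "k = 1" | "k = a" "i = 1" | "k \<noteq> 1" "\<not> (k = a \<and> i = 1)" by blast
  then show "\<iota> (R1 (a, 1) (i, k)) * (\<Sum>j\<in>I. \<Sum>l\<in>I. \<iota> (R2 (1, k) (j, l)) * (D i j c * S3 l d)) = 0"
  proof cases
    case 1
    show ?thesis unfolding 1 row_vac by (simp add: S3_1)
  next
    case 2
    show ?thesis unfolding 2 row_1[OF assms(1)] by (simp add: S3_1 D1)
  next
    case 3
    then have "R1 (a, 1) (i, k) = 0"
    proof (intro Rb_eq_0)
      show "{a, 1, i, k} \<subseteq> I" using ik a(1) mem(1) by simp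
      show "\<not> (i = a \<and> k = 1)" "\<not> (i = 1 \<and> k = a)" "\<not> (a = prm n 1 \<and> i = prm n k)"
        using 3 a(3) by auto
    qed simp
    then show ?thesis by simp
  qed
qed

lemma fused_right:
  assumes "a \<in> V" "c \<in> V" "d \<in> V" "k \<in> I" "k \<noteq> 1"
  shows "(\<Sum>i\<in>I. \<Sum>j\<in>I. L1 a i * L2 1 j * \<iota>' (fused_entry n i j k c d)) =
    (if k \<in> V then \<Sum>i\<in>V. D a 1 i * \<iota>' (rr X2 * R' (i, k) (c, d)) else 0)"
proof (cases "k \<in> V")
  case True
  have "(\<Sum>i\<in>I. \<Sum>j\<in>I. L1 a i * L2 1 j * \<iota>' (fused_entry n i j k c d)) =
    (\<Sum>j\<in>V. L1 a 1 * L2 1 j * \<iota>' (rr X2 * R' (j, k) (c, d)))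
    + (\<Sum>i\<in>V. - (L1 a i * L2 1 1 * \<iota>' (q' * (rr X2 * R' (i, k) (c, d)))))"
    using idx_1_facts(1,2) mem
    by (simp add: vac sum_idx_0[OF n] fused_entry_eq[OF n] assms True \<iota>'_minus mult.left_commute[of "rr X2"] cong: sum.cong)
  also have "\<dots> = (\<Sum>i\<in>V. D a 1 i * \<iota>' (rr X2 * R' (i, k) (c, d)))"
    unfolding sum.distrib[symmetric]
  proof (intro sum.cong refl)
    fix i
    show "L1 a 1 * L2 1 i * \<iota>' (rr X2 * R' (i, k) (c, d)) + - (L1 a i * L2 1 1 * \<iota>' (q' * (rr X2 * R' (i, k) (c, d))))
      = D a 1 i * \<iota>' (rr X2 * R' (i, k) (c, d))"
      by (simp add: D_def left_diff_distrib \<iota>'_mult[of q'] \<iota>_const mult.assoc pull)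
  qed
  finally show ?thesis using True by simp
next
  case False
  have "fused_entry n i j k c d = 0" if "i \<in> I" "j \<in> I" for i j
    using fused_entry_eq[OF n that assms(4,5,2,3)] False by simp
  then show ?thesis using False by simp
qed

theorem rll_S:
  assumes "a \<in> V" "b \<in> V" "c \<in> V" "d \<in> V"
  shows "(\<Sum>i\<in>V. \<Sum>k\<in>V. \<iota> (R' (a, b) (i, k)) * (S1 i c * S3 k d))
    = (\<Sum>i\<in>V. \<Sum>k\<in>V. S3 b k * S1 a i * \<iota>' (R' (i, k) (c, d)))"
proof -
  note a = idx_1_facts[OF assms(1)] and b = idx_1_facts[OF assms(2)]
    and c = idx_1_facts[OF assms(3)] and d = idx_1_facts[OF assms(4)]
  define y where "y = h3 * L3 1 d"
  define N where "N k = (\<Sum>i\<in>I. \<Sum>j\<in>I. L1 a i * L2 1 j * \<iota>' (fused_entry n i j k c d))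
    - (\<Sum>i\<in>I. \<Sum>j\<in>I. L1 a i * L2 1 j * \<iota>' (fused_entry n i j k c 1)) * y" for k
  define Lft where "Lft r = (\<Sum>i\<in>I. \<Sum>k\<in>I. \<iota> (R1 (a, r) (i, k)) *
    (\<Sum>j\<in>I. \<Sum>l\<in>I. \<iota> (R2 (1, k) (j, l)) * (D i j c * S3 l d)))" for r
  have S3: "S3 l d = L3 l d - L3 l 1 * y" for l
    by (simp add: S3_def y_def mult.assoc)
  have main: "Lft r = (\<Sum>k\<in>I. L3 r k * N k)" if "r \<in> I" for r
  proof -
    have "Lft r = (\<Sum>i\<in>I. \<Sum>k\<in>I. \<iota> (R1 (a, r) (i, k)) * (\<Sum>j\<in>I. \<Sum>l\<in>I. \<iota> (R2 (1, k) (j, l)) * (D i j c * L3 l d)))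
      - (\<Sum>i\<in>I. \<Sum>k\<in>I. \<iota> (R1 (a, r) (i, k)) * (\<Sum>j\<in>I. \<Sum>l\<in>I. \<iota> (R2 (1, k) (j, l)) * (D i j c * L3 l 1))) * y"
      by (simp only: Lft_def S3 right_diff_distrib sum_subtractf sum_distrib_right sum_distrib_left mult.assoc)
    also have "\<dots> = (\<Sum>k\<in>I. L3 r k * N k)"
      unfolding fused_triple[OF a(1) that c(1) d(1)] fused_triple[OF a(1) that c(1) mem(1)]
      by (simp only: N_def right_diff_distrib sum_subtractf sum_distrib_right mult.assoc)
    finally show ?thesis .
  qed
  have N: "N k = (if k \<in> V then \<Sum>i\<in>V. D a 1 i * \<iota>' (rr X2 * R' (i, k) (c, d)) else 0)"
    if "k \<in> I" "k \<noteq> 1" for k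
    using that by (simp add: N_def fused_right[OF assms(1,3,4)] fused_entry_vac[OF n] assms(3))
  have split: "(\<Sum>k\<in>I. L3 r k * N k) = L3 r 1 * N 1 + (\<Sum>k\<in>V. L3 r k * N k)" for r
    using N[OF mem(2)] by (simp add: sum_idx_0[OF n] vac)
  have "L3 1 1 * N 1 + (\<Sum>k\<in>V. L3 1 k * N k) = 0"
    using main[OF mem(1)] fused_left_vac[OF assms(1,3,4)] by (simp add: split Lft_def)
  moreover have "\<iota> 1 * N 1 = N 1"
    by (simp add: N_def right_diff_distrib sum_distrib_left mult.assoc[symmetric] unit)
  ultimately have N1: "N 1 = - (h3 * (\<Sum>k\<in>V. L3 1 k * N k))"
    by (rule eliminate)
  have "Lft b = (\<Sum>k\<in>V. S3 b k * N k)"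
    unfolding main[OF b(1)] split N1
    by (simp add: S3_def left_diff_distrib sum_subtractf sum_distrib_left mult.assoc)
  then have eq: "(\<Sum>i\<in>V. \<Sum>k\<in>V. \<iota> (rr X2 * R' (a, b) (i, k)) * (D i 1 c * S3 k d))
     = (\<Sum>k\<in>V. S3 b k * (\<Sum>i\<in>V. D a 1 i * \<iota>' (rr X2 * R' (i, k) (c, d))))"
    unfolding Lft_def fused_left[OF assms] by (simp add: N idx_1_facts(1,2) vac cong: sum.cong)
  define z where "z = L2 1 1 * \<iota>' (rr X2)"
  have "(\<Sum>i\<in>V. \<Sum>k\<in>V. \<iota> (rr X2 * R' (a, b) (i, k)) * (D i 1 c * S3 k d))
     = - \<iota> q' * ((\<Sum>i\<in>V. \<Sum>k\<in>V. \<iota> (R' (a, b) (i, k)) * (S1 i c * S3 k d)) * z)"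
    unfolding sum_distrib_left sum_distrib_right
  proof (intro sum.cong refl)
    fix i k assume k: "k \<in> V"
    have "\<iota> (rr X2) * (L2 1 1 * S3 k d) = S3 k d * z"
      using L2_S3_commute[OF k assms(4)] by (simp add: z_def mult.assoc)
    moreover have "\<iota> (rr X2 * R' (a, b) (i, k)) * (D i 1 c * S3 k d)
      = - \<iota> q' * (\<iota> (R' (a, b) (i, k)) * (S1 i c * (\<iota> (rr X2) * (L2 1 1 * S3 k d))))"
      by (simp add: D_eq[OF assms(3)] \<iota>_mult mult.assoc left_commute[of "S1 i c"]
        left_commute(1)[of "\<iota> (rr X2)" q'] left_commute(1)[of "\<iota> (R' (a, b) (i, k))" q']
        left_commute(1)[of "\<iota> (R' (a, b) (i, k))" "rr X2"])
    ultimately show "\<iota> (rr X2 * R' (a, b) (i, k)) * (D i 1 c * S3 k d)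
      = - \<iota> q' * (\<iota> (R' (a, b) (i, k)) * (S1 i c * S3 k d) * z)"
      by (simp add: mult.assoc)
  qed
  moreover have "(\<Sum>k\<in>V. S3 b k * (\<Sum>i\<in>V. D a 1 i * \<iota>' (rr X2 * R' (i, k) (c, d))))
     = - \<iota> q' * ((\<Sum>i\<in>V. \<Sum>k\<in>V. S3 b k * S1 a i * \<iota>' (R' (i, k) (c, d))) * z)"
    unfolding sum_distrib_left sum_distrib_right
  proof (subst sum.swap, intro sum.cong refl)
    fix i k assume i: "i \<in> V"
    show "S3 b k * (D a 1 i * \<iota>' (rr X2 * R' (i, k) (c, d))) = - \<iota> q' * (S3 b k * S1 a i * \<iota>' (R' (i, k) (c, d)) * z)"
      by (simp add: D_eq[OF i] z_def \<iota>'_mult mult.assoc left_commute[of "S3 b k"] left_commute(2)[of "S1 a i"]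
          left_commute(2)[of "L2 1 1"] \<iota>'_central[symmetric, of "L2 1 1"] left_commute(2)[of "\<iota>' (rr X2)" "R' (i, k) (c, d)"])
  qed
  ultimately have eq: "\<iota> q' * ((\<Sum>i\<in>V. \<Sum>k\<in>V. \<iota> (R' (a, b) (i, k)) * (S1 i c * S3 k d)) * z)
    = \<iota> q' * ((\<Sum>i\<in>V. \<Sum>k\<in>V. S3 b k * S1 a i * \<iota>' (R' (i, k) (c, d))) * z)"
    using eq by simp
  have cancel: "x = w" if "\<iota> q' * (x * z) = \<iota> q' * (w * z)" "x * \<iota> 1 = x" "w * \<iota> 1 = w" for x w
  proof -
    have r: "rr X2 * inverse (rr X2) = 1"
    proof (rule inverse_mult_eq_1')
      have "dn X2 $ 0 * rr X2 $ 0 = - 1"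
        using dn_rr[of X2] by (metis (no_types) X2_0 fps_mult_nth_0 fps_sub_nth fps_one_nth diff_0)
      then show "rr X2 $ 0 \<noteq> 0" by auto
    qed
    have inv: "\<iota> (fps_const q) * (\<iota> q' * u) = \<iota> 1 * u" for u
      using \<iota>_mult[of "fps_const q" q'] cq_inv by (simp add: mult.assoc[symmetric])
    have "\<iota> 1 * (x * z) = \<iota> 1 * (w * z)"
      unfolding inv[symmetric] that(1) ..
    moreover have "\<iota> 1 * (v * z) = v * \<iota> 1 * z" for v
      by (simp only: mult.assoc[symmetric] \<iota>_central[of 1 v])
    ultimately have xz: "x * z = w * z"
      by (simp only: that)
    have z: "z * (\<iota>' (inverse (rr X2)) * h2) = \<iota> 1"
    proof -
      have "z * (\<iota>' (inverse (rr X2)) * h2) = L2 1 1 * (\<iota>' (rr X2 * inverse (rr X2)) * h2)"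
        by (simp add: z_def \<iota>'_mult mult.assoc)
      also have "\<dots> = L2 1 1 * \<iota> 1 * h2"
        unfolding r \<iota>_1 by (simp add: mult.assoc)
      finally show ?thesis by (simp add: unit_right h2)
    qed
    have "x * (z * (\<iota>' (inverse (rr X2)) * h2)) = w * (z * (\<iota>' (inverse (rr X2)) * h2))"
      unfolding mult.assoc[symmetric] xz ..
    then show "x = w" unfolding z that(2,3) .
  qed
  show ?thesis
  proof (rule cancel[OF eq])
    have idem: "\<iota> 1 * (\<iota> f * y) = \<iota> f * y" for f y
      by (simp add: mult.assoc[symmetric] flip: \<iota>_mult)
    show "(\<Sum>i\<in>V. \<Sum>k\<in>V. \<iota> (R' (a, b) (i, k)) * (S1 i c * S3 k d)) * \<iota> 1
       = (\<Sum>i\<in>V. \<Sum>k\<in>V. \<iota> (R' (a, b) (i, k)) * (S1 i c * S3 k d))"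
      unfolding sum_distrib_right
      by (intro sum.cong refl) (simp only: \<iota>_central[symmetric, of _ 1] idem)
    show "(\<Sum>i\<in>V. \<Sum>k\<in>V. S3 b k * S1 a i * \<iota>' (R' (i, k) (c, d))) * \<iota> 1
       = (\<Sum>i\<in>V. \<Sum>k\<in>V. S3 b k * S1 a i * \<iota>' (R' (i, k) (c, d)))"
      unfolding sum_distrib_right
      by (intro sum.cong refl) (simp only: \<iota>_central[symmetric, of _ 1] mult.assoc[symmetric] unit_S3)
  qed
qed

end

section \<open>Relations as identities of power series\<close>

lemma Sum_any_single:
  assumes "\<And>x. x \<noteq> a \<Longrightarrow> f x = (0::'a::comm_monoid_add)"
  shows "Sum_any f = f a"
  using assms by (subst Sum_any.expand_superset[of "{a}"]) auto

lemma ser2_mult_single: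
  assumes "\<And>c d. (c, d) \<noteq> (a, 0) \<Longrightarrow> f c d = 0 \<or> g (a - c) (b - d) = (0::'a::semiring_0)"
  shows "ser2_mult f g a b = f a 0 * g 0 b"
proof -
  have "ser2_mult f g a b = (\<lambda>(c, d). f c d * g (a - c) (b - d)) (a, 0)"
    unfolding ser2_mult_def
  proof (rule Sum_any_single)
    fix cd :: "int \<times> int"
    assume "cd \<noteq> (a, 0)"
    then show "(\<lambda>(c, d). f c d * g (a - c) (b - d)) cd = 0"
      using assms[of "fst cd" "snd cd"] by (cases cd) auto
  qed
  then show ?thesis by simp
qed

lemma ser2_mult_L1_L2: "ser2_mult (L1 s x z) (L2 t z y) a b =
   (if snd x = snd z \<and> fst z = fst y then ell_coeff s (fst x) (fst z) a * ell_coeff t (snd z) (snd y) b else 0)"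
  by (subst ser2_mult_single) (auto simp: L1_def L2_def)

lemma ser2_mult_L2_L1: "ser2_mult (L2 t x z) (L1 s z y) a b =
   (if fst x = fst z \<and> snd z = snd y then ell_coeff t (snd x) (snd z) b * ell_coeff s (fst z) (fst y) a else 0)"
proof -
  have "ser2_mult (L2 t x z) (L1 s z y) a b =
    (\<lambda>(c, d). L2 t x z c d * L1 s z y (a - c) (b - d)) (0, b)"
    unfolding ser2_mult_def
    by (rule Sum_any_single) (auto simp: L1_def L2_def split: if_splits)
  then show ?thesis by (auto simp: L1_def L2_def)
qed

lemma op_mult_L1_L2:
  assumes "x \<in> idx n m \<times> idx n m" "y \<in> idx n m \<times> idx n m"
  shows "op_mult (idx n m) (L1 s) (L2 t) x y a b = ell_coeff s (fst x) (fst y) a * ell_coeff t (snd x) (snd y) b"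
    and "op_mult (idx n m) (L2 t) (L1 s) x y a b = ell_coeff t (snd x) (snd y) b * ell_coeff s (fst x) (fst y) a"
proof -
  show "op_mult (idx n m) (L1 s) (L2 t) x y a b = ell_coeff s (fst x) (fst y) a * ell_coeff t (snd x) (snd y) b"
    unfolding op_mult_def ser2_mult_L1_L2 using assms
    by (subst sum_eq_single[of _ "(fst y, snd x)"]) auto
  show "op_mult (idx n m) (L2 t) (L1 s) x y a b = ell_coeff t (snd x) (snd y) b * ell_coeff s (fst x) (fst y) a"
    unfolding op_mult_def ser2_mult_L2_L1 using assms
    by (subst sum_eq_single[of _ "(fst x, snd y)"]) auto
qed

lemma ser2_mult_R:
  assumes "\<And>k. k > M \<Longrightarrow> G (a - int k) (b + int k) = 0"
  shows "ser2_mult (R_ser n m z x p) G a b =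
      (\<Sum>k\<le>M. scal (R_bar n m x p $ k) * z ^ k * G (a - int k) (b + int k))"
    and "ser2_mult G (R_ser n m z x p) a b =
      (\<Sum>k\<le>M. G (a - int k) (b + int k) * (scal (R_bar n m x p $ k) * z ^ k))"
proof -
  have "ser2_mult (R_ser n m z x p) G a b =
    (\<Sum>(c, d)\<in>(\<lambda>k. (int k, - int k)) ` {..M}. R_ser n m z x p c d * G (a - c) (b - d))"
    unfolding ser2_mult_def
  proof (rule Sum_any.expand_superset)
    show "{cd. (case cd of (c, d) \<Rightarrow> R_ser n m z x p c d * G (a - c) (b - d)) \<noteq> 0} \<subseteq> (\<lambda>k. (int k, - int k)) ` {..M}"
    proof clarify
      fix c d assume *: "R_ser n m z x p c d * G (a - c) (b - d) \<noteq> 0"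
      then have cd: "0 \<le> c" "d = - c" by (auto simp: R_ser_def split: if_splits)
      with * have "\<not> nat c > M" using assms[of "nat c"] by auto
      then show "(c, d) \<in> (\<lambda>k. (int k, - int k)) ` {..M}"
        using cd by (intro image_eqI[of _ _ "nat c"]) auto
    qed
  qed simp
  also have "\<dots> = (\<Sum>k\<le>M. scal (R_bar n m x p $ k) * z ^ k * G (a - int k) (b + int k))"
    by (subst sum.reindex) (auto simp: inj_on_def R_ser_def)
  finally show "ser2_mult (R_ser n m z x p) G a b =
      (\<Sum>k\<le>M. scal (R_bar n m x p $ k) * z ^ k * G (a - int k) (b + int k))" .
  have "ser2_mult G (R_ser n m z x p) a b =
    (\<Sum>(c, d)\<in>(\<lambda>k. (a - int k, b + int k)) ` {..M}. G c d * R_ser n m z x p (a - c) (b - d))"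
    unfolding ser2_mult_def
  proof (rule Sum_any.expand_superset)
    show "{cd. (case cd of (c, d) \<Rightarrow> G c d * R_ser n m z x p (a - c) (b - d)) \<noteq> 0} \<subseteq> (\<lambda>k. (a - int k, b + int k)) ` {..M}"
    proof clarify
      fix c d assume *: "G c d * R_ser n m z x p (a - c) (b - d) \<noteq> 0"
      then have cd: "0 \<le> a - c" "b - d = - (a - c)" by (auto simp: R_ser_def split: if_splits)
      have "G c d \<noteq> 0" using * by auto
      moreover have "a - int (nat (a - c)) = c" "b + int (nat (a - c)) = d" using cd by auto
      ultimately have "G (a - int (nat (a - c))) (b + int (nat (a - c))) \<noteq> 0" by simp
      then have "\<not> nat (a - c) > M" using assms[of "nat (a - c)"] by blast
      then show "(c, d) \<in> (\<lambda>k. (a - int k, b + int k)) ` {..M}"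
        using cd by (intro image_eqI[of _ _ "nat (a - c)"]) auto
    qed
  qed simp
  also have "\<dots> = (\<Sum>k\<le>M. G (a - int k) (b + int k) * (scal (R_bar n m x p $ k) * z ^ k))"
    by (subst sum.reindex) (auto simp: inj_on_def R_ser_def)
  finally show "ser2_mult G (R_ser n m z x p) a b =
      (\<Sum>k\<le>M. G (a - int k) (b + int k) * (scal (R_bar n m x p $ k) * z ^ k))" .
qed

definition rll_elem :: "nat \<Rightarrow> nat \<Rightarrow> gens free \<Rightarrow> gens free \<Rightarrow> pm \<Rightarrow> pm \<Rightarrow>
    nat \<times> nat \<Rightarrow> nat \<times> nat \<Rightarrow> int \<Rightarrow> int \<Rightarrow> gens free" where
  "rll_elem n m z w s t x y a b =
     op_mult (idx n m) (R_ser n m z) (op_mult (idx n m) (L1 s) (L2 t)) x y a b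
      - op_mult (idx n m) (op_mult (idx n m) (L2 t) (L1 s)) (R_ser n m w) x y a b"

definition cutoff :: "pm \<Rightarrow> int \<Rightarrow> int \<Rightarrow> nat" where
  "cutoff s a b = (case s of Pl \<Rightarrow> nat a | Mi \<Rightarrow> nat (- b))"

lemma ell_coeff_cutoff:
  assumes "s = Pl \<or> t = Mi" "k > cutoff s a b"
  shows "ell_coeff s i j (a - int k) * ell_coeff t i' j' (b + int k) = 0"
    and "ell_coeff t i' j' (b + int k) * ell_coeff s i j (a - int k) = 0"
  using assms by (cases s; cases t; auto simp: cutoff_def ell_coeff_def)+

lemma rll_elem_eq:
  assumes xy: "{a, b, c, d} \<subseteq> idx n m" and st: "s = Pl \<or> t = Mi"
  shows "rll_elem n m z w s t (a, b) (c, d) u v =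
    (\<Sum>i\<in>idx n m. \<Sum>j\<in>idx n m. \<Sum>k\<le>cutoff s u v. scal (R_bar n m (a, b) (i, j) $ k) * z ^ k *
       (ell_coeff s i c (u - int k) * ell_coeff t j d (v + int k)))
    - (\<Sum>i\<in>idx n m. \<Sum>j\<in>idx n m. \<Sum>k\<le>cutoff s u v. ell_coeff t b j (v + int k) * ell_coeff s a i (u - int k) *
       (scal (R_bar n m (i, j) (c, d) $ k) * w ^ k))"
proof -
  let ?I = "idx n m"
  have x: "(a, b) \<in> ?I \<times> ?I" and y: "(c, d) \<in> ?I \<times> ?I" using xy by auto
  have 1: "ser2_mult (R_ser n m z (a, b) p) (op_mult ?I (L1 s) (L2 t) p (c, d)) u v
    = (\<Sum>k\<le>cutoff s u v. scal (R_bar n m (a, b) p $ k) * z ^ k *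
       (ell_coeff s (fst p) c (u - int k) * ell_coeff t (snd p) d (v + int k)))" if "p \<in> ?I \<times> ?I" for p
    by (subst ser2_mult_R(1)[where M = "cutoff s u v"])
      (simp_all add: op_mult_L1_L2(1)[OF that y] ell_coeff_cutoff(1)[OF st])
  have 2: "ser2_mult (op_mult ?I (L2 t) (L1 s) (a, b) p) (R_ser n m w p (c, d)) u v
    = (\<Sum>k\<le>cutoff s u v. ell_coeff t b (snd p) (v + int k) * ell_coeff s a (fst p) (u - int k) *
       (scal (R_bar n m p (c, d) $ k) * w ^ k))" if "p \<in> ?I \<times> ?I" for p
    by (subst ser2_mult_R(2)[where M = "cutoff s u v"])
      (simp_all add: op_mult_L1_L2(2)[OF x that] ell_coeff_cutoff(2)[OF st])
  have "op_mult ?I (R_ser n m z) (op_mult ?I (L1 s) (L2 t)) (a, b) (c, d) u v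
     = (\<Sum>p\<in>?I \<times> ?I. \<Sum>k\<le>cutoff s u v. scal (R_bar n m (a, b) p $ k) * z ^ k *
       (ell_coeff s (fst p) c (u - int k) * ell_coeff t (snd p) d (v + int k)))"
    unfolding op_mult_def[of ?I "R_ser n m z"] by (intro sum.cong refl 1)
  moreover have "op_mult ?I (op_mult ?I (L2 t) (L1 s)) (R_ser n m w) (a, b) (c, d) u v
     = (\<Sum>p\<in>?I \<times> ?I. \<Sum>k\<le>cutoff s u v. ell_coeff t b (snd p) (v + int k) * ell_coeff s a (fst p) (u - int k) *
       (scal (R_bar n m p (c, d) $ k) * w ^ k))"
    unfolding op_mult_def[of ?I "op_mult ?I (L2 t) (L1 s)"] by (intro sum.cong refl 2)
  moreover have "sum h (?I \<times> ?I) = (\<Sum>i\<in>?I. \<Sum>j\<in>?I. h (i, j))" for h :: "nat \<times> nat \<Rightarrow> gens free"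
    by (simp add: sum.cartesian_product)
  ultimately show ?thesis
    unfolding rll_elem_def by simp
qed

definition sgn_pm :: "pm \<Rightarrow> int" where
  "sgn_pm s = (case s of Pl \<Rightarrow> 1 | Mi \<Rightarrow> - 1)"

definition one_sided :: "pm \<Rightarrow> (int \<Rightarrow> 'z::zero) \<Rightarrow> bool" where
  "one_sided s f \<longleftrightarrow> (\<forall>a. sgn_pm s * a < 0 \<longrightarrow> f a = 0)"

definition half_ser :: "pm \<Rightarrow> (int \<Rightarrow> 'z::zero) \<Rightarrow> 'z fps" where
  "half_ser s f = Abs_fps (\<lambda>r. f (sgn_pm s * int r))"

definition emb_u :: "pm \<Rightarrow> pm \<Rightarrow> 'z::zero fps \<Rightarrow> 'z fps fps" where
  "emb_u s t = (case s of Pl \<Rightarrow> (case t of Pl \<Rightarrow> fpsXY | Mi \<Rightarrow> fps_const) | Mi \<Rightarrow> fpsY)"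

definition emb_v :: "pm \<Rightarrow> pm \<Rightarrow> 'z::zero fps \<Rightarrow> 'z fps fps" where
  "emb_v s t = (case s of Pl \<Rightarrow> fpsY | Mi \<Rightarrow> fpsXY)"

definition emb_uv :: "pm \<Rightarrow> pm \<Rightarrow> 'z::zero fps \<Rightarrow> 'z fps fps" where
  "emb_uv s t = (case s of Pl \<Rightarrow> (case t of Pl \<Rightarrow> fps_const | Mi \<Rightarrow> fpsXY) | Mi \<Rightarrow> fps_const)"

definition expo_u :: "pm \<Rightarrow> pm \<Rightarrow> nat \<Rightarrow> nat \<Rightarrow> int" where
  "expo_u s t j i = (case s of Pl \<Rightarrow> int i | Mi \<Rightarrow> int i - int j)"

definition expo_v :: "pm \<Rightarrow> pm \<Rightarrow> nat \<Rightarrow> nat \<Rightarrow> int" where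
  "expo_v s t j i = (case s of Pl \<Rightarrow> (case t of Pl \<Rightarrow> int j - int i | Mi \<Rightarrow> - int j) | Mi \<Rightarrow> - int i)"

lemma emb_coeff:
  fixes r :: "'z::semiring_0 fps"
  assumes "s = Pl \<or> t = Mi" "one_sided s f" "one_sided t g"
  shows "(emb_uv s t r * (emb_u s t (half_ser s f) * emb_v s t (half_ser t g))) $ j $ i =
      (\<Sum>k\<le>i. r $ k * (f (expo_u s t j i - int k) * g (expo_v s t j i + int k)))"
    and "(emb_v s t (half_ser t g) * emb_u s t (half_ser s f) * emb_uv s t r) $ j $ i =
      (\<Sum>k\<le>i. g (expo_v s t j i + int k) * f (expo_u s t j i - int k) * r $ k)"
proof -
  consider "s = Pl" "t = Pl" | "s = Mi" "t = Mi" | "s = Pl" "t = Mi"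
    using assms(1) pm.exhaust by metis
  then have "(emb_uv s t r * (emb_u s t (half_ser s f) * emb_v s t (half_ser t g))) $ j $ i =
      (\<Sum>k\<le>i. r $ k * (f (expo_u s t j i - int k) * g (expo_v s t j i + int k))) \<and>
    (emb_v s t (half_ser t g) * emb_u s t (half_ser s f) * emb_uv s t r) $ j $ i =
      (\<Sum>k\<le>i. g (expo_v s t j i + int k) * f (expo_u s t j i - int k) * r $ k)"
  proof cases
    case 1
    have "g (int j - int i + int k) = 0" if "k \<le> i" "\<not> i - k \<le> j" for k
      using assms(3) that 1 by (auto simp: one_sided_def sgn_pm_def)
    then show ?thesis
      unfolding 1 emb_uv_def emb_u_def emb_v_def pm.case fpsX_left fpsX_right fpsXY_fpsY_nth fpsY_fpsXY_nth
      by (auto simp: half_ser_def sgn_pm_def expo_u_def expo_v_def algebra_simps intro!: sum.cong)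
  next
    case 2
    have "f (int i - int j - int k) = 0" if "k \<le> i" "\<not> i - k \<le> j" for k
      using assms(2) that 2 by (auto simp: one_sided_def sgn_pm_def)
    then show ?thesis
      unfolding 2 emb_uv_def emb_u_def emb_v_def pm.case fpsX_left fpsX_right fpsXY_fpsY_nth fpsY_fpsXY_nth
      by (auto simp: half_ser_def sgn_pm_def expo_u_def expo_v_def algebra_simps intro!: sum.cong)
  next
    case 3
    have "g (- int j + int k) = 0" if "\<not> k \<le> j" for k
      using assms(3) that 3 by (auto simp: one_sided_def sgn_pm_def)
    then show ?thesis
      unfolding 3 emb_uv_def emb_u_def emb_v_def pm.case fpsXY_left fpsXY_right fpsX_fpsY_nth fpsY_fpsX_nth
      by (auto simp: half_ser_def sgn_pm_def expo_u_def expo_v_def algebra_simps intro!: sum.cong)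
  qed
  then show "(emb_uv s t r * (emb_u s t (half_ser s f) * emb_v s t (half_ser t g))) $ j $ i =
      (\<Sum>k\<le>i. r $ k * (f (expo_u s t j i - int k) * g (expo_v s t j i + int k)))"
    "(emb_v s t (half_ser t g) * emb_u s t (half_ser s f) * emb_uv s t r) $ j $ i =
      (\<Sum>k\<le>i. g (expo_v s t j i + int k) * f (expo_u s t j i - int k) * r $ k)"
    by auto
qed

lemma cutoff_expo: "s = Pl \<or> t = Mi \<Longrightarrow> cutoff s (expo_u s t j i) (expo_v s t j i) = i"
  by (cases s; cases t) (auto simp: cutoff_def expo_u_def expo_v_def)

lemma expo_outside:
  assumes st: "s = Pl \<or> t = Mi" and out: "\<nexists>j i. a = expo_u s t j i \<and> b = expo_v s t j i"
    and fg: "one_sided s f" "one_sided t g"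
  shows "f (a - int k) = 0 \<or> g (b + int k) = 0"
proof (rule ccontr)
  assume "\<not> ?thesis"
  then have sg: "sgn_pm s * (a - int k) \<ge> 0" "sgn_pm t * (b + int k) \<ge> 0"
    using fg by (auto simp: one_sided_def not_less[symmetric])
  consider "s = Pl" "t = Pl" | "s = Mi" "t = Mi" | "s = Pl" "t = Mi"
    using st pm.exhaust by metis
  then show False
  proof cases
    case 1
    then have "a = expo_u s t (nat (a + b)) (nat a) \<and> b = expo_v s t (nat (a + b)) (nat a)"
      using sg by (auto simp: expo_u_def expo_v_def sgn_pm_def)
    then show ?thesis using out by blast
  next
    case 2
    then have "a = expo_u s t (nat (- b - a)) (nat (- b)) \<and> b = expo_v s t (nat (- b - a)) (nat (- b))"
      using sg by (auto simp: expo_u_def expo_v_def sgn_pm_def)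
    then show ?thesis using out by blast
  next
    case 3
    then have "a = expo_u s t (nat (- b)) (nat a) \<and> b = expo_v s t (nat (- b)) (nat a)"
      using sg by (auto simp: expo_u_def expo_v_def sgn_pm_def)
    then show ?thesis using out by blast
  qed
qed

lemma Rb_X2_nth: "Rb n m X2 x y $ k = (inverse q ^ 2) ^ k * Rb n m X1 x y $ k"
proof -
  let ?c = "inverse q ^ 2"
  have X2_eq: "X2 = fps_const ?c * fps_X" by (simp add: X2_def)
  have X2_0': "X2 $ 0 = 0" by simp
  have inv: "inverse g oo X2 = inverse (g oo X2)" if "g $ 0 \<noteq> 0" for g :: "K fps"
    by (rule fps_inverse_compose) (use that in simp_all)
  have dn: "dn X1 oo X2 = dn X2"
    by (simp add: dn_def fps_compose_sub_distrib fps_compose_mult_distrib[OF X2_0'] fps_X_fps_compose_startby0[OF X2_0'])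
  have dn0: "dn X1 $ 0 \<noteq> 0" by (simp add: dn_def)
  have rr: "rr X1 oo X2 = rr X2"
    by (simp add: rr_def fps_compose_sub_distrib fps_compose_mult_distrib[OF X2_0'] fps_X_fps_compose_startby0[OF X2_0']
        inv[OF dn0] dn)
  have pp: "pp X1 oo X2 = pp X2"
    by (simp add: pp_def hh_def fps_compose_mult_distrib[OF X2_0'] inv[OF dn0] dn)
  have ss: "ss (xi n m) X1 oo X2 = ss (xi n m) X2"
    by (simp add: ss_def fps_compose_sub_distrib fps_compose_mult_distrib[OF X2_0'] fps_X_fps_compose_startby0[OF X2_0'] inv)
  have "Rb n m X1 x y oo X2 = Rb n m X2 x y"
    by (simp add: Rb_def fps_compose_sub_distrib fps_compose_add_distrib fps_compose_mult_distrib[OF X2_0'] rr pp ss hh_def)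
  moreover have "Rb n m X1 x y oo X2 = Abs_fps (\<lambda>k. ?c ^ k * Rb n m X1 x y $ k)"
    unfolding X2_eq by (rule fps_compose_linear)
  ultimately have "Rb n m X2 x y = Abs_fps (\<lambda>k. ?c ^ k * Rb n m X1 x y $ k)"
    by (rule trans[OF sym])
  then show ?thesis by simp
qed

lemma emb_u_add: "emb_u s t (f + g) = emb_u s t f + emb_u s t g"
  and emb_v_add: "emb_v s t (f + g) = emb_v s t f + emb_v s t g"
  and emb_uv_add: "emb_uv s t (f + g) = emb_uv s t f + emb_uv s t g"
  for f g :: "'z::ring_1 fps"
  by (simp_all add: emb_u_def emb_v_def emb_uv_def fpsY_add fpsXY_add split: pm.split flip: fps_const_add)

lemma emb_u_mult: "emb_u s t (f * g) = emb_u s t f * emb_u s t g"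
  and emb_v_mult: "emb_v s t (f * g) = emb_v s t f * emb_v s t g"
  and emb_uv_mult: "emb_uv s t (f * g) = emb_uv s t f * emb_uv s t g"
  for f g :: "'z::ring_1 fps"
  by (simp_all add: emb_u_def emb_v_def emb_uv_def fpsY_mult fpsXY_mult split: pm.split flip: fps_const_mult)

lemma emb_u_const: "emb_u s t (fps_const c) = fps_const (fps_const c)"
  and emb_v_const: "emb_v s t (fps_const c) = fps_const (fps_const c)"
  and emb_uv_const: "emb_uv s t (fps_const c) = fps_const (fps_const c)"
  by (simp_all add: emb_u_def emb_v_def emb_uv_def fpsY_const fpsXY_const split: pm.split)

lemma emb_u_diff: "emb_u s t (f - g) = emb_u s t f - emb_u s t g"
  and emb_v_diff: "emb_v s t (f - g) = emb_v s t f - emb_v s t g"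
  for f g :: "'z::ring_1 fps"
  using emb_u_add[of s t "f - g" g] emb_v_add[of s t "f - g" g] by (simp_all add: eq_diff_eq)

lemma emb_uv_central:
  fixes f :: "'z::ring_1 fps"
  assumes "\<And>k x. f $ k * x = x * f $ k"
  shows "emb_uv s t f * G = G * emb_uv s t f"
proof (rule fps_central)
  fix k x
  have "fps_const f $ k * x = x * fps_const f $ k"
    using fps_central[of f x] assms by simp
  moreover have "fpsXY f $ k * x = x * fpsXY f $ k"
    using assms by (intro fps_central) (simp add: fpsXY_nth)
  ultimately show "emb_uv s t f $ k * x = x * emb_uv s t f $ k"
    by (cases s; cases t) (simp_all only: emb_uv_def pm.case)
qed

locale coeff_hom =
  fixes \<Phi> :: "gens free \<Rightarrow> 'z::ring_1"
  assumes \<Phi>_add: "\<Phi> (f + g) = \<Phi> f + \<Phi> g" and \<Phi>_mult: "\<Phi> (f * g) = \<Phi> f * \<Phi> g"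
    and \<Phi>_scal_central: "\<Phi> (scal c) * x = x * \<Phi> (scal c)"
begin

definition \<kappa> :: "K \<Rightarrow> 'z" where
  "\<kappa> c = \<Phi> (scal c)"

definition lc :: "pm \<Rightarrow> nat \<Rightarrow> nat \<Rightarrow> int \<Rightarrow> 'z" where
  "lc s i j a = \<Phi> (ell_coeff s i j a)"

lemma \<Phi>_0 [simp]: "\<Phi> 0 = 0"
  using \<Phi>_add[of 0 0] by simp

lemma \<Phi>_minus: "\<Phi> (- f) = - \<Phi> f"
  using \<Phi>_add[of f "- f"] by (simp add: eq_neg_iff_add_eq_0 add.commute)

lemma \<Phi>_diff: "\<Phi> (f - g) = \<Phi> f - \<Phi> g"
  using \<Phi>_add[of f "- g"] by (simp add: \<Phi>_minus)

lemma \<Phi>_sum: "\<Phi> (sum f A) = (\<Sum>i\<in>A. \<Phi> (f i))"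
  by (induction A rule: infinite_finite_induct) (simp_all add: \<Phi>_add)

lemma \<kappa>_0 [simp]: "\<kappa> 0 = 0"
  by (simp add: \<kappa>_def)

lemma \<kappa>_add: "\<kappa> (a + b) = \<kappa> a + \<kappa> b"
  by (simp add: \<kappa>_def scal_add \<Phi>_add)

lemma \<kappa>_mult: "\<kappa> (a * b) = \<kappa> a * \<kappa> b"
  by (simp add: \<kappa>_def scal_mult \<Phi>_mult)

lemma \<kappa>_central: "\<kappa> c * x = x * \<kappa> c"
  by (simp add: \<kappa>_def \<Phi>_scal_central)

lemma \<kappa>_left_commute: "x * (\<kappa> c * y) = \<kappa> c * (x * y)"
  by (simp only: mult.assoc[symmetric] \<kappa>_central[of c x])

lemma \<kappa>_1: "\<kappa> 1 = \<Phi> 1"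
  by (simp add: \<kappa>_def)

lemma \<kappa>_sum: "\<kappa> (sum f A) = (\<Sum>i\<in>A. \<kappa> (f i))"
  by (induction A rule: infinite_finite_induct) (simp_all add: \<kappa>_add)

lemma \<kappa>_unit: "\<kappa> 1 * \<Phi> f = \<Phi> f" "\<Phi> f * \<kappa> 1 = \<Phi> f"
  by (simp_all add: \<kappa>_def flip: \<Phi>_mult)

lemma \<Phi>_scal_power: "\<Phi> (scal c * z ^ k) = \<kappa> c * \<Phi> z ^ k"
proof (induction k)
  case 0
  show ?case by (simp add: \<kappa>_def)
next
  case (Suc k)
  have "\<Phi> (scal c * z ^ Suc k) = \<Phi> (scal c * z ^ k) * \<Phi> z"
    by (simp add: power_commutes mult.assoc flip: \<Phi>_mult)
  with Suc show ?case by (simp add: power_commutes mult.assoc)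
qed

lemma one_sided_lc: "one_sided s (lc s i j)"
  by (cases s) (auto simp: one_sided_def lc_def ell_coeff_def sgn_pm_def)

definition tw :: "'z \<Rightarrow> K fps \<Rightarrow> 'z fps" where
  "tw \<alpha> f = Abs_fps (\<lambda>k. \<kappa> (f $ k) * \<alpha> ^ k)"

lemma tw_add: "tw \<alpha> (f + g) = tw \<alpha> f + tw \<alpha> g"
  by (rule fps_ext) (simp add: tw_def \<kappa>_add distrib_right)

lemma tw_mult: "tw \<alpha> (f * g) = tw \<alpha> f * tw \<alpha> g"
proof (rule fps_ext)
  fix k
  have "\<kappa> (f $ i) * \<kappa> (g $ (k - i)) * \<alpha> ^ k = \<kappa> (f $ i) * \<alpha> ^ i * (\<kappa> (g $ (k - i)) * \<alpha> ^ (k - i))"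
    if "i \<le> k" for i
    using that by (simp add: mult.assoc \<kappa>_left_commute[of "\<alpha> ^ i"] flip: power_add)
  then show "tw \<alpha> (f * g) $ k = (tw \<alpha> f * tw \<alpha> g) $ k"
    by (simp add: tw_def fps_mult_nth_le \<kappa>_sum \<kappa>_mult sum_distrib_right)
qed

lemma tw_const: "tw \<alpha> (fps_const c) = fps_const (\<kappa> c)"
  by (rule fps_ext) (simp add: tw_def)

definition \<iota> :: "pm \<Rightarrow> pm \<Rightarrow> 'z \<Rightarrow> K fps \<Rightarrow> 'z fps fps" where
  "\<iota> s t \<alpha> f = emb_uv s t (tw \<alpha> f)"

lemma \<iota>_add: "\<iota> s t \<alpha> (f + g) = \<iota> s t \<alpha> f + \<iota> s t \<alpha> g"
  by (simp add: \<iota>_def tw_add emb_uv_add)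

lemma \<iota>_mult: "\<iota> s t \<alpha> (f * g) = \<iota> s t \<alpha> f * \<iota> s t \<alpha> g"
  by (simp add: \<iota>_def tw_mult emb_uv_mult)

lemma \<iota>_const: "\<iota> s t \<alpha> (fps_const c) = fps_const (fps_const (\<kappa> c))"
  by (simp add: \<iota>_def tw_const emb_uv_const)

lemma \<iota>_central:
  assumes "\<And>x. \<alpha> * x = x * \<alpha>"
  shows "\<iota> s t \<alpha> f * G = G * \<iota> s t \<alpha> f"
  unfolding \<iota>_def
proof (rule emb_uv_central)
  fix k x
  have "\<alpha> ^ k * x = x * \<alpha> ^ k"
    by (rule power_commuting_commutes) (rule assms)
  then have "\<kappa> (f $ k) * \<alpha> ^ k * x = \<kappa> (f $ k) * x * \<alpha> ^ k"
    by (simp only: mult.assoc)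
  also have "\<dots> = x * (\<kappa> (f $ k) * \<alpha> ^ k)"
    by (simp only: \<kappa>_central[of _ x] mult.assoc)
  finally show "tw \<alpha> f $ k * x = x * tw \<alpha> f $ k"
    by (simp add: tw_def)
qed

definition shift :: "K \<Rightarrow> (int \<Rightarrow> 'z) \<Rightarrow> int \<Rightarrow> 'z" where
  "shift \<mu> f a = \<kappa> (\<mu> powi a) * f a"

lemma one_sided_shift: "one_sided s f \<Longrightarrow> one_sided s (shift \<mu> f)"
  by (simp add: one_sided_def shift_def)

lemma rll_coeff:
  assumes "{a, b, c, d} \<subseteq> idx n m" "s = Pl \<or> t = Mi"
  shows "\<Phi> (rll_elem n m z w s t (a, b) (c, d) u v) =
    (\<Sum>i\<in>idx n m. \<Sum>j\<in>idx n m. \<Sum>k\<le>cutoff s u v. \<kappa> (R_bar n m (a, b) (i, j) $ k) * \<Phi> z ^ k *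
       (lc s i c (u - int k) * lc t j d (v + int k)))
    - (\<Sum>i\<in>idx n m. \<Sum>j\<in>idx n m. \<Sum>k\<le>cutoff s u v. lc t b j (v + int k) * lc s a i (u - int k) *
       (\<kappa> (R_bar n m (i, j) (c, d) $ k) * \<Phi> w ^ k))"
  unfolding rll_elem_eq[OF assms] \<Phi>_diff \<Phi>_sum \<Phi>_mult[of "scal _ * _"] \<Phi>_mult[of _ "scal _ * _"]
    \<Phi>_scal_power lc_def
  by (simp only: \<Phi>_mult[of "ell_coeff _ _ _ _"])

end

lemma q_power_neq_1:
  assumes "0 < k"
  shows "q ^ k \<noteq> 1"
proof
  assume "q ^ k = 1"
  moreover have "q ^ k = to_fract ([:0, 1:] ^ k)"
    by (induction k) (simp_all add: q_def to_fract_def One_fract_def)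
  ultimately have "to_fract ([:0, 1:] ^ k) = (to_fract 1 :: K)"
    by simp
  then have "[:0, 1 :: complex:] ^ k = 1" by (simp only: to_fract_eq_iff)
  then have "degree ([:0, 1 :: complex:] ^ k) = 0" by simp
  then show False using assms degree_linear_power[of "0 :: complex" k] by simp
qed

context coeff_hom
begin

definition coeff_eq :: "nat \<Rightarrow> nat \<Rightarrow> pm \<Rightarrow> pm \<Rightarrow> 'z \<Rightarrow> 'z \<Rightarrow> (nat \<Rightarrow> nat \<Rightarrow> int \<Rightarrow> 'z) \<Rightarrow> (nat \<Rightarrow> nat \<Rightarrow> int \<Rightarrow> 'z)
    \<Rightarrow> nat \<Rightarrow> nat \<Rightarrow> nat \<Rightarrow> nat \<Rightarrow> int \<Rightarrow> int \<Rightarrow> bool" where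
  "coeff_eq n m s t \<alpha> \<beta> f g a b c d u v \<longleftrightarrow>
    (\<Sum>i\<in>idx n m. \<Sum>j\<in>idx n m. \<Sum>k\<le>cutoff s u v. \<kappa> (Rb n m X1 (a, b) (i, j) $ k) * \<alpha> ^ k *
       (f i c (u - int k) * g j d (v + int k)))
    = (\<Sum>i\<in>idx n m. \<Sum>j\<in>idx n m. \<Sum>k\<le>cutoff s u v. g b j (v + int k) * f a i (u - int k) *
       (\<kappa> (Rb n m X1 (i, j) (c, d) $ k) * \<beta> ^ k))"

lemma rll_eq_0_iff:
  assumes "{a, b, c, d} \<subseteq> idx n m" "s = Pl \<or> t = Mi"
  shows "\<Phi> (rll_elem n m z w s t (a, b) (c, d) u v) = 0 \<longleftrightarrow>
    coeff_eq n m s t (\<Phi> z) (\<Phi> w) (lc s) (lc t) a b c d u v"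
  unfolding rll_coeff[OF assms] coeff_eq_def R_bar_eq_Rb by simp

lemma emb_sum_coeff:
  assumes "s = Pl \<or> t = Mi" "\<And>i j. one_sided s (f i j)" "\<And>i j. one_sided t (g i j)"
  shows "(\<Sum>i\<in>I. \<Sum>j\<in>I. \<iota> s t \<alpha> (R (a, b) (i, j)) * (emb_u s t (half_ser s (f i c)) * emb_v s t (half_ser t (g j d)))) $ y $ x
     = (\<Sum>i\<in>I. \<Sum>j\<in>I. \<Sum>k\<le>x. \<kappa> (R (a, b) (i, j) $ k) * \<alpha> ^ k *
       (f i c (expo_u s t y x - int k) * g j d (expo_v s t y x + int k)))"
    and "(\<Sum>i\<in>I. \<Sum>j\<in>I. emb_v s t (half_ser t (g b j)) * emb_u s t (half_ser s (f a i)) * \<iota> s t \<beta> (R (i, j) (c, d))) $ y $ x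
     = (\<Sum>i\<in>I. \<Sum>j\<in>I. \<Sum>k\<le>x. g b j (expo_v s t y x + int k) * f a i (expo_u s t y x - int k) *
       (\<kappa> (R (i, j) (c, d) $ k) * \<beta> ^ k))"
  unfolding \<iota>_def fps_sum_nth emb_coeff[OF assms] by (simp_all add: tw_def)

lemma series_of_coeffs:
  assumes st: "s = Pl \<or> t = Mi" "\<And>i j. one_sided s (f i j)" "\<And>i j. one_sided t (g i j)"
    and eq: "\<And>u v. coeff_eq n m s t \<alpha> \<beta> f g a b c d u v"
    and R: "\<And>x y k. R x y $ k = \<mu> ^ k * Rb n m X1 x y $ k" and \<mu>: "\<mu> \<noteq> 0"
  shows "(\<Sum>i\<in>idx n m. \<Sum>j\<in>idx n m. \<iota> s t \<alpha> (R (a, b) (i, j)) *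
       (emb_u s t (half_ser s (shift \<mu> (f i c))) * emb_v s t (half_ser t (g j d))))
     = (\<Sum>i\<in>idx n m. \<Sum>j\<in>idx n m. emb_v s t (half_ser t (g b j)) * emb_u s t (half_ser s (shift \<mu> (f a i))) *
       \<iota> s t \<beta> (R (i, j) (c, d)))"
proof (rule fps_fps_eqI)
  fix y x
  let ?u = "expo_u s t y x" and ?v = "expo_v s t y x"
  have pow: "\<mu> powi ?u = \<mu> ^ k * \<mu> powi (?u - int k)" for k
    using power_int_add[of \<mu> "int k" "?u - int k"] \<mu> by simp
  have l: "\<kappa> (R p p' $ k) * A * (shift \<mu> F (?u - int k) * G) = \<kappa> (\<mu> powi ?u) * (\<kappa> (Rb n m X1 p p' $ k) * A * (F (?u - int k) * G))"
    for p p' k A F G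
    unfolding R pow[of k] shift_def \<kappa>_mult
    by (simp only: mult.assoc \<kappa>_left_commute[of A] \<kappa>_left_commute[of "\<kappa> (Rb n m X1 p p' $ k)"])
  have r: "G * shift \<mu> F (?u - int k) * (\<kappa> (R p p' $ k) * A) = \<kappa> (\<mu> powi ?u) * (G * F (?u - int k) * (\<kappa> (Rb n m X1 p p' $ k) * A))"
    for p p' k A F G
    unfolding R pow[of k] shift_def \<kappa>_mult
    by (simp only: mult.assoc \<kappa>_left_commute[of G] \<kappa>_left_commute[of "F (?u - int k)"]
        \<kappa>_left_commute[of "\<kappa> (\<mu> powi (?u - int k))" "\<mu> ^ k"])
  show "(\<Sum>i\<in>idx n m. \<Sum>j\<in>idx n m. \<iota> s t \<alpha> (R (a, b) (i, j)) *
       (emb_u s t (half_ser s (shift \<mu> (f i c))) * emb_v s t (half_ser t (g j d)))) $ y $ x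
     = (\<Sum>i\<in>idx n m. \<Sum>j\<in>idx n m. emb_v s t (half_ser t (g b j)) * emb_u s t (half_ser s (shift \<mu> (f a i))) *
       \<iota> s t \<beta> (R (i, j) (c, d))) $ y $ x"
    unfolding emb_sum_coeff[where f = "\<lambda>i j. shift \<mu> (f i j)" and g = g and R = R,
        OF st(1) one_sided_shift[OF st(2)] st(3)] l r
    using eq[of ?u ?v] unfolding coeff_eq_def cutoff_expo[OF st(1)]
    by (simp only: sum_distrib_left[symmetric])
qed

lemma coeffs_of_series:
  assumes st: "s = Pl \<or> t = Mi" "\<And>i j. one_sided s (f i j)" "\<And>i j. one_sided t (g i j)"
    and eq: "(\<Sum>i\<in>idx n m. \<Sum>j\<in>idx n m. \<iota> s t \<alpha> (Rb n m X1 (a, b) (i, j)) *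
       (emb_u s t (half_ser s (f i c)) * emb_v s t (half_ser t (g j d))))
     = (\<Sum>i\<in>idx n m. \<Sum>j\<in>idx n m. emb_v s t (half_ser t (g b j)) * emb_u s t (half_ser s (f a i)) *
       \<iota> s t \<beta> (Rb n m X1 (i, j) (c, d)))"
  shows "coeff_eq n m s t \<alpha> \<beta> f g a b c d u v"
proof (cases "\<exists>j i. u = expo_u s t j i \<and> v = expo_v s t j i")
  case True
  then obtain y x where *: "u = expo_u s t y x" "v = expo_v s t y x" by blast
  show ?thesis
    using arg_cong[OF eq, of "\<lambda>G. G $ y $ x"]
    unfolding emb_sum_coeff[where f = f and g = g and R = "Rb n m X1", OF st]
    unfolding coeff_eq_def * cutoff_expo[OF st(1)] .
next
  case False
  then have "f i c (u - int k) = 0 \<or> g j d (v + int k) = 0" "f a i (u - int k) = 0 \<or> g b j (v + int k) = 0" for i j k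
    using expo_outside[OF st(1) False st(2,3)] by blast+
  then have "f i c (u - int k) * g j d (v + int k) = 0" "g b j (v + int k) * f a i (u - int k) = 0" for i j k
    by (metis mult_zero_left mult_zero_right)+
  then show ?thesis by (simp add: coeff_eq_def)
qed

definition ser :: "pm \<Rightarrow> nat \<Rightarrow> nat \<Rightarrow> 'z fps" where
  "ser s i j = half_ser s (lc s i j)"

definition ser2 :: "pm \<Rightarrow> nat \<Rightarrow> nat \<Rightarrow> 'z fps" where
  "ser2 s i j = half_ser s (shift (inverse q ^ 2) (lc s i j))"

lemma shift_1_lc: "shift 1 (lc s i j) = lc s i j"
  by (rule ext) (simp add: shift_def lc_def \<kappa>_unit)

lemma rll_series:
  assumes abcd: "{a, b, c, d} \<subseteq> idx n m" and st: "s = Pl \<or> t = Mi"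
    and rll: "\<And>u v. \<Phi> (rll_elem n m z w s t (a, b) (c, d) u v) = 0"
  shows "(\<Sum>i\<in>idx n m. \<Sum>j\<in>idx n m. \<iota> s t (\<Phi> z) (Rb n m X1 (a, b) (i, j)) * (emb_u s t (ser s i c) * emb_v s t (ser t j d)))
     = (\<Sum>i\<in>idx n m. \<Sum>j\<in>idx n m. emb_v s t (ser t b j) * emb_u s t (ser s a i) * \<iota> s t (\<Phi> w) (Rb n m X1 (i, j) (c, d)))"
    and "(\<Sum>i\<in>idx n m. \<Sum>j\<in>idx n m. \<iota> s t (\<Phi> z) (Rb n m X2 (a, b) (i, j)) * (emb_u s t (ser2 s i c) * emb_v s t (ser t j d)))
     = (\<Sum>i\<in>idx n m. \<Sum>j\<in>idx n m. emb_v s t (ser t b j) * emb_u s t (ser2 s a i) * \<iota> s t (\<Phi> w) (Rb n m X2 (i, j) (c, d)))"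
  using series_of_coeffs[OF st one_sided_lc one_sided_lc rll[unfolded rll_eq_0_iff[OF abcd st]], of "Rb n m X1" 1]
    series_of_coeffs[OF st one_sided_lc one_sided_lc rll[unfolded rll_eq_0_iff[OF abcd st]], of "Rb n m X2" "inverse q ^ 2"]
  by (simp_all add: shift_1_lc Rb_X2_nth flip: ser_def ser2_def)

definition weight :: "pm \<Rightarrow> nat \<Rightarrow> nat \<Rightarrow> K" where
  "weight s N i = (case s of Pl \<Rightarrow> q powi (2 * (int i - int N)) | Mi \<Rightarrow> q powi (2 * int i))"

lemma weight_Suc: "weight s N (Suc i) = q ^ 2 * weight s N i"
proof -
  have "q powi (2 * (int (Suc i) - int N)) = q ^ 2 * q powi (2 * (int i - int N))"
    "q powi (2 * int (Suc i)) = q ^ 2 * q powi (2 * int i)"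
    using power_int_add[of q 2 "2 * (int i - int N)"] power_int_add[of q 2 "2 * int i"]
    by (simp_all add: algebra_simps)
  then show ?thesis by (simp add: weight_def split: pm.split)
qed

text \<open>Evaluation at \<open>u / v = q\<^sup>2\<close>, where the coefficient of \<open>Y\<^sup>N\<close> is assumed to be a polynomial in
  \<open>X\<close> of degree at most \<open>N + 1\<close>.\<close>

definition eval_at :: "pm \<Rightarrow> nat \<Rightarrow> 'z fps fps \<Rightarrow> 'z" where
  "eval_at s N G = (\<Sum>i\<le>Suc N. \<kappa> (weight s N i) * G $ N $ i)"

lemma eval_at_add: "eval_at s N (F + G) = eval_at s N F + eval_at s N G"
  by (simp add: eval_at_def distrib_left sum.distrib del: sum.atMost_Suc)

lemma eval_at_diff: "eval_at s N (F - G) = eval_at s N F - eval_at s N G"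
  by (simp add: eval_at_def right_diff_distrib sum_subtractf del: sum.atMost_Suc)

lemma eval_at_linear:
  assumes "G $ N $ Suc N = 0"
  shows "eval_at s N (\<iota> s s (\<Phi> 1) (fps_const a + fps_const b * fps_X) * G) = \<kappa> (a + b * q ^ 2) * eval_at s N G"
proof -
  let ?f = "tw (\<Phi> 1) (fps_const a + fps_const b * fps_X)"
  have f: "?f $ k = (if k = 0 then \<kappa> a else if k = 1 then \<kappa> b else 0)" for k
    by (simp add: tw_def \<kappa>_def flip: \<Phi>_mult)
  have \<iota>: "\<iota> s s (\<Phi> 1) (fps_const a + fps_const b * fps_X) = fps_const ?f"
    by (cases s) (simp_all add: \<iota>_def emb_uv_def)
  have c0: "(fps_const ?f * G) $ N $ 0 = \<kappa> a * G $ N $ 0"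
    unfolding fpsX_left by (simp add: f)
  have cS: "(fps_const ?f * G) $ N $ Suc i = \<kappa> a * G $ N $ Suc i + \<kappa> b * G $ N $ i" for i
  proof -
    have "(fps_const ?f * G) $ N $ Suc i = (\<Sum>k\<in>{0, 1}. ?f $ k * G $ N $ (Suc i - k))"
      unfolding fpsX_left by (intro sum.mono_neutral_right) (auto simp: f)
    then show ?thesis by (simp add: f)
  qed
  have "eval_at s N (fps_const ?f * G)
     = \<kappa> (weight s N 0) * (\<kappa> a * G $ N $ 0) + (\<Sum>i\<le>N. \<kappa> (weight s N (Suc i)) * (\<kappa> a * G $ N $ Suc i + \<kappa> b * G $ N $ i))"
    unfolding eval_at_def sum.atMost_Suc_shift c0 cS ..
  also have "\<dots> = \<kappa> a * (\<kappa> (weight s N 0) * G $ N $ 0 + (\<Sum>i\<le>N. \<kappa> (weight s N (Suc i)) * G $ N $ Suc i))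
      + \<kappa> (b * q ^ 2) * (\<Sum>i\<le>N. \<kappa> (weight s N i) * G $ N $ i)"
    by (simp add: distrib_left sum.distrib sum_distrib_left weight_Suc \<kappa>_mult mult.assoc
        \<kappa>_left_commute[of "\<kappa> _" a] \<kappa>_left_commute[of "\<kappa> _" b])
  also have "\<kappa> (weight s N 0) * G $ N $ 0 + (\<Sum>i\<le>N. \<kappa> (weight s N (Suc i)) * G $ N $ Suc i) = eval_at s N G"
    unfolding eval_at_def sum.atMost_Suc_shift ..
  also have "(\<Sum>i\<le>N. \<kappa> (weight s N i) * G $ N $ i) = eval_at s N G"
    unfolding eval_at_def using assms by simp
  finally show ?thesis unfolding \<iota> by (simp add: \<kappa>_add distrib_right)
qed

lemma emb_same_top: "(emb_u s s F * emb_v s s G) $ N $ Suc N = (0 :: 'z)"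
  "(emb_v s s G * emb_u s s F) $ N $ Suc N = (0 :: 'z)"
  by (cases s; simp add: emb_u_def emb_v_def fpsXY_fpsY_nth fpsY_fpsXY_nth)+

lemma eval_at_product:
  "eval_at s N (emb_u s s F * emb_v s s (half_ser s g)) = (F * half_ser s (shift (inverse q ^ 2) g)) $ N"
proof (cases s)
  case Pl
  have w: "weight Pl N i = (inverse q ^ 2) powi (int N - int i)" for i
  proof -
    have "inverse q ^ 2 = q powi (- 2)" by (simp add: power_int_minus power_inverse)
    then have "(inverse q ^ 2) powi (int N - int i) = q powi (- 2 * (int N - int i))"
      by (simp only: power_int_mult)
    then show ?thesis by (simp add: weight_def algebra_simps)
  qed
  have v: "(inverse q ^ 2) ^ (N - i) = (inverse q ^ 2) powi (int N - int i)" if "i \<le> N" for i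
    using power_int_of_nat[of "inverse q ^ 2" "N - i"] of_nat_diff[OF that, where 'a = int] by simp
  have "eval_at s N (emb_u s s F * emb_v s s (half_ser s g)) = (\<Sum>i\<le>N. F $ i * (\<kappa> (weight Pl N i) * g (int (N - i))))"
    unfolding Pl eval_at_def
    by (simp add: emb_u_def emb_v_def fpsXY_fpsY_nth half_ser_def sgn_pm_def \<kappa>_left_commute)
  also have "\<dots> = (F * half_ser s (shift (inverse q ^ 2) g)) $ N"
    unfolding fps_mult_nth_le by (intro sum.cong) (simp_all add: Pl half_ser_def sgn_pm_def shift_def w v)
  finally show ?thesis .
next
  case Mi
  have w: "weight Mi N i = (inverse q ^ 2) powi - int i" for i
  proof -
    have "inverse q ^ 2 = q powi (- 2)" by (simp add: power_int_minus power_inverse)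
    then have "(inverse q ^ 2) powi - int i = q powi (- 2 * - int i)"
      by (simp only: power_int_mult)
    then show ?thesis by (simp add: weight_def)
  qed
  have "eval_at s N (emb_u s s F * emb_v s s (half_ser s g)) = (\<Sum>i\<le>N. F $ (N - i) * (\<kappa> (weight Mi N i) * g (- int i)))"
    unfolding Mi eval_at_def
    by (simp add: emb_u_def emb_v_def fpsY_fpsXY_nth half_ser_def sgn_pm_def \<kappa>_left_commute)
  also have "\<dots> = (F * half_ser s (shift (inverse q ^ 2) g)) $ N"
    unfolding fps_mult_nth_rev by (intro sum.cong) (simp_all add: Mi half_ser_def sgn_pm_def shift_def w)
  finally show ?thesis .
qed

lemma \<kappa>_cancel:
  assumes "\<kappa> a * x = 0" "a \<noteq> 0" "\<kappa> 1 * x = x"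
  shows "x = 0"
proof -
  have "\<kappa> (inverse a) * (\<kappa> a * x) = \<kappa> 1 * x"
    using assms(2) by (simp add: mult.assoc[symmetric] flip: \<kappa>_mult)
  then show ?thesis using assms by simp
qed

end

context coeff_hom
begin

lemma \<Phi>_1_central: "\<Phi> 1 * x = x * \<Phi> 1"
  using \<kappa>_central[of 1] by (simp add: \<kappa>_1)

lemma \<iota>_0 [simp]: "\<iota> s t \<alpha> 0 = 0"
  using \<iota>_add[of s t \<alpha> 0 0] by simp

lemma \<iota>_minus: "\<iota> s t \<alpha> (- f) = - \<iota> s t \<alpha> f"
  using \<iota>_add[of s t \<alpha> f "- f"] by (simp add: eq_neg_iff_add_eq_0 add.commute)

lemma \<iota>_diff: "\<iota> s t \<alpha> (f - g) = \<iota> s t \<alpha> f - \<iota> s t \<alpha> g"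
  using \<iota>_add[of s t \<alpha> f "- g"] by (simp add: \<iota>_minus)

definition minor :: "pm \<Rightarrow> nat \<Rightarrow> nat \<Rightarrow> nat \<Rightarrow> 'z fps" where
  "minor s i j c = ser s i 1 * ser2 s j c - fps_const (\<kappa> (inverse q)) * (ser s i c * ser2 s j 1)"

lemma ser_unit: "fps_const (\<kappa> 1) * ser s i j = ser s i j" "ser s i j * fps_const (\<kappa> 1) = ser s i j"
  "fps_const (\<kappa> 1) * ser2 s i j = ser2 s i j"
proof -
  have unit: "\<kappa> 1 * (\<kappa> c * x) = \<kappa> c * x" for c x
    by (simp add: mult.assoc[symmetric] flip: \<kappa>_mult)
  show "fps_const (\<kappa> 1) * ser s i j = ser s i j" "ser s i j * fps_const (\<kappa> 1) = ser s i j"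
    "fps_const (\<kappa> 1) * ser2 s i j = ser2 s i j"
    by (rule fps_ext, simp add: ser_def ser2_def half_ser_def shift_def lc_def \<kappa>_unit unit)+
qed

lemma const_central: "fps_const (\<kappa> c) * F = F * fps_const (\<kappa> c)"
  by (rule fps_ext) (simp add: \<kappa>_central)

lemma const_left_commute: "F * (fps_const (\<kappa> c) * G) = fps_const (\<kappa> c) * (F * G)"
  by (simp only: mult.assoc[symmetric] const_central[of c F])

lemma minor_unit: "\<kappa> 1 * minor s i j c $ N = minor s i j c $ N"
proof -
  have "fps_const (\<kappa> 1) * minor s i j c = (fps_const (\<kappa> 1) * ser s i 1) * ser2 s j c
      - fps_const (\<kappa> (inverse q)) * ((fps_const (\<kappa> 1) * ser s i c) * ser2 s j 1)"
    by (simp only: minor_def right_diff_distrib mult.assoc const_left_commute[of "fps_const (\<kappa> 1)" "inverse q"])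
  also have "\<dots> = minor s i j c"
    by (simp only: ser_unit minor_def)
  finally have "(fps_const (\<kappa> 1) * minor s i j c) $ N = minor s i j c $ N"
    by (rule arg_cong)
  then show ?thesis by simp
qed

lemma minor_relations:
  assumes n: "1 \<le> n" and c: "c \<in> idx n 1"
    and rll: "\<And>a b c d u v. {a, b, c, d} \<subseteq> idx n 0 \<Longrightarrow> \<Phi> (rll_elem n 0 1 1 s s (a, b) (c, d) u v) = 0"
  shows "minor s 1 1 c = 0"
    and "r \<in> idx n 1 \<Longrightarrow> minor s 1 r c = - fps_const (\<kappa> q) * minor s r 1 c"
proof -
  let ?q' = "fps_const (inverse q) :: K fps"
  note mem = idx_0_mem[OF n] and c' = idx_1_facts[OF c]
  define h where "h = \<iota> s s (\<Phi> 1)"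
  define L where "L i j = emb_u s s (ser s i j)" for i j
  define M where "M i j = emb_v s s (ser s i j)" for i j
  define Dh where "Dh i k = L i 1 * M k c - h ?q' * (L i c * M k 1)" for i k
  define Y where "Y r i k = M r k * L 1 i" for r i k
  define H where "H r = Y r 1 c - h (fps_const q) * Y r c 1" for r
  define f where "f = rr X1 - ?q' * (X1 * pp X1)"
  have h0: "h 0 = 0" and h_add: "h (x + y) = h x + h y" and h_diff: "h (x - y) = h x - h y"
    and h_mult: "h (x * y) = h x * h y" and h_minus: "h (- x) = - h x"
    for x y
    unfolding h_def by (simp_all add: \<iota>_add \<iota>_diff \<iota>_mult \<iota>_minus)
  have h_central: "h x * G = G * h x" for x G
    unfolding h_def by (rule \<iota>_central[OF \<Phi>_1_central])
  have h_left_commute: "F * (h x * G) = h x * (F * G)" for x F G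
    by (simp only: mult.assoc[symmetric] h_central[of x F])
  have X0: "X1 $ 0 = 0" by simp
  have qX2: "fps_const q * X2 = ?q' * X1"
    using cq_inv by (subst X1_X2) (simp add: mult.assoc[symmetric])
  have dn_f: "dn X1 * f = X2 - 1"
  proof -
    have "dn X1 * f = dn X1 * rr X1 - ?q' * (X1 * (dn X1 * pp X1))"
      by (simp add: f_def algebra_simps)
    also have "\<dots> = X1 - 1 - ?q' * X1 * (fps_const q - ?q')"
      by (simp add: dn_rr dn_pp hh_eq mult.assoc)
    also have "\<dots> = X1 - 1 - (fps_const q * ?q') * X1 + ?q' * (fps_const q * X2)"
      unfolding qX2 by (simp add: algebra_simps)
    also have "\<dots> = X2 - 1"
      using cq_inv by (simp add: mult.assoc[symmetric] mult.commute[of ?q'])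
    finally show ?thesis .
  qed
  have pp_rr: "pp X1 - ?q' * rr X1 = - fps_const q * f"
  proof -
    have "dn X1 * (pp X1 - ?q' * rr X1) = dn X1 * pp X1 - ?q' * (dn X1 * rr X1)"
      by (simp add: algebra_simps)
    also have "\<dots> = fps_const q - ?q' * X1"
      by (simp add: dn_rr dn_pp hh_eq algebra_simps)
    also have "\<dots> = dn X1 * (- fps_const q * f)"
    proof -
      have eq: "dn X1 * (- fps_const q * f) = - (fps_const q * (dn X1 * f))"
        by (simp only: mult_minus_left mult_minus_right mult.left_commute[of "dn X1"])
      show ?thesis unfolding eq dn_f right_diff_distrib qX2 by simp
    qed
    finally show ?thesis using dn_neq_0[OF X0] by simp
  qed
  have main: "(\<Sum>i\<in>idx n 0. \<Sum>k\<in>idx n 0. h (Rb n 0 X1 (1, r) (i, k)) * Dh i k) = H r * h f"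
    if r: "r \<in> idx n 0" for r
  proof -
    have col: "(\<Sum>i\<in>idx n 0. \<Sum>k\<in>idx n 0. h (Rb n 0 X1 (1, r) (i, k)) * (L i a * M k b))
       = (\<Sum>i\<in>idx n 0. \<Sum>k\<in>idx n 0. Y r i k * h (Rb n 0 X1 (i, k) (a, b)))"
      if "a \<in> idx n 0" "b \<in> idx n 0" for a b
      unfolding h_def L_def M_def Y_def
      using that r mem pm.exhaust[of s] by (intro rll_series(1) rll) auto
    have "(\<Sum>i\<in>idx n 0. \<Sum>k\<in>idx n 0. h (Rb n 0 X1 (1, r) (i, k)) * Dh i k)
      = (\<Sum>i\<in>idx n 0. \<Sum>k\<in>idx n 0. h (Rb n 0 X1 (1, r) (i, k)) * (L i 1 * M k c))
        - h ?q' * (\<Sum>i\<in>idx n 0. \<Sum>k\<in>idx n 0. h (Rb n 0 X1 (1, r) (i, k)) * (L i c * M k 1))"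
      by (simp only: Dh_def right_diff_distrib sum_subtractf sum_distrib_left h_left_commute[of "h (Rb n 0 X1 _ _)"])
    also have "\<dots> = Y r 1 c * h (rr X1) + Y r c 1 * h (pp X1) - h ?q' * (Y r 1 c * h (X1 * pp X1) + Y r c 1 * h (rr X1))"
      unfolding col[OF mem(1) c'(1)] col[OF c'(1) mem(1)]
        Rb_col_1(1)[of n X1 h, OF n X0 h0 c] Rb_col_1(2)[of n X1 h, OF n X0 h0 c] ..
    also have "\<dots> = Y r 1 c * h f + Y r c 1 * h (pp X1 - ?q' * rr X1)"
      by (simp add: f_def h_diff h_mult right_diff_distrib distrib_left h_left_commute[of "Y r 1 c"] h_left_commute[of "Y r c 1"])
    also have "\<dots> = H r * h f"
      unfolding pp_rr by (simp add: H_def left_diff_distrib h_mult h_minus mult.assoc h_left_commute[of "Y r c 1"] del: fps_const_neg)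
    finally show ?thesis .
  qed
  have lin: "X1 - 1 = fps_const (- 1) + fps_const 1 * fps_X" "X1 * hh = fps_const 0 + fps_const (q - inverse q) * fps_X"
    "dn X1 = fps_const (- inverse q) + fps_const q * fps_X" "X2 - 1 = fps_const (- 1) + fps_const (inverse q ^ 2) * fps_X"
    by (simp_all add: hh_def dn_def X2_def mult.commute flip: fps_const_neg)
  have h_const: "h (fps_const x) = fps_const (fps_const (\<kappa> x))" for x
    by (simp add: h_def \<iota>_const)
  have top: "Dh i k $ N $ Suc N = 0" "H r $ N $ Suc N = 0" for i k r N
    by (simp_all add: Dh_def H_def Y_def L_def M_def h_const emb_same_top)
  have ev_Dh: "eval_at s N (Dh i k) = minor s i k c $ N" for i k N
  proof -
    have "eval_at s N (h ?q' * (L i c * M k 1)) = \<kappa> (inverse q) * eval_at s N (L i c * M k 1)"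
      using eval_at_linear[of "L i c * M k 1" N s "inverse q" 0]
      by (simp add: h_def L_def M_def emb_same_top)
    then show ?thesis
      unfolding Dh_def eval_at_diff by (simp add: L_def M_def ser_def[of s k] eval_at_product minor_def ser2_def)
  qed
  have ev_H: "eval_at s N (h (X2 - 1) * H r) = 0" for N r
    unfolding h_def lin(4) eval_at_linear[OF top(2)]
    by (simp add: power2_eq_square field_simps)
  show "minor s 1 1 c = 0"
  proof (rule fps_ext)
    fix N
    have "h (dn X1) * Dh 1 1 = h (X2 - 1) * H 1"
    proof -
      have "h 1 * Dh 1 1 = H 1 * h f"
        using main[OF mem(1)] Rb_row_vac[of n X1 h, OF n X0 h0] by simp
      then have "h (dn X1) * (h 1 * Dh 1 1) = H 1 * h (dn X1 * f)"
        by (simp add: h_mult h_left_commute[of "H 1"])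
      then show ?thesis
        using h_mult[of "dn X1" 1] by (simp add: dn_f h_central[of "X2 - 1" "H 1"] mult.assoc[symmetric])
    qed
    then have "\<kappa> (- inverse q + q * q ^ 2) * minor s 1 1 c $ N = 0"
      using ev_H[of N 1] eval_at_linear[OF top(1)[of 1 1 N], of s "- inverse q" q]
      by (simp add: lin(3) ev_Dh flip: h_def)
    moreover have "- inverse q + q * q ^ 2 \<noteq> 0"
    proof
      assume "- inverse q + q * q ^ 2 = 0"
      then have "q * (- inverse q + q * q ^ 2) = 0" by simp
      then have "q ^ 4 = 1" by (simp add: distrib_left power_numeral_reduce)
      then show False using q_power_neq_1[of 4] by simp
    qed
    ultimately show "minor s 1 1 c $ N = 0 $ N"
      using \<kappa>_cancel minor_unit by simp
  qed
  assume r: "r \<in> idx n 1"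
  show "minor s 1 r c = - fps_const (\<kappa> q) * minor s r 1 c"
  proof (rule fps_ext)
    fix N
    have "h (X1 - 1) * Dh 1 r + h (X1 * hh) * Dh r 1 = h (X2 - 1) * H r"
    proof -
      have "h (rr X1) * Dh 1 r + h (X1 * pp X1) * Dh r 1 = H r * h f"
        using main[OF idx_1_facts(1)[OF r]] Rb_row_1[of n X1 h, OF n X0 h0 r] by simp
      then have "h (dn X1) * (h (rr X1) * Dh 1 r + h (X1 * pp X1) * Dh r 1) = H r * h (dn X1 * f)"
        by (simp add: h_mult h_left_commute[of "H r"])
      then have "h (dn X1 * rr X1) * Dh 1 r + h (X1 * (dn X1 * pp X1)) * Dh r 1 = H r * h (dn X1 * f)"
        by (simp only: distrib_left mult.assoc[symmetric] mult.commute[of X1 "dn X1"] h_mult[symmetric])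
      then show ?thesis
        by (simp add: dn_f dn_rr dn_pp h_central[of "X2 - 1" "H r"])
    qed
    then have "eval_at s N (h (X1 - 1) * Dh 1 r) + eval_at s N (h (X1 * hh) * Dh r 1) = 0"
      using ev_H[of N r] by (simp flip: eval_at_add)
    then have "\<kappa> (- 1 + 1 * q ^ 2) * minor s 1 r c $ N + \<kappa> (0 + (q - inverse q) * q ^ 2) * minor s r 1 c $ N = 0"
      unfolding h_def lin(1,2) eval_at_linear[OF top(1)] ev_Dh .
    moreover have "0 + (q - inverse q) * q ^ 2 = (- 1 + 1 * q ^ 2) * q"
      by (simp add: power2_eq_square algebra_simps)
    ultimately have "\<kappa> (- 1 + 1 * q ^ 2) * (minor s 1 r c $ N + \<kappa> q * minor s r 1 c $ N) = 0"
      by (simp only: \<kappa>_mult distrib_left mult.assoc)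
    moreover have "- 1 + 1 * q ^ 2 \<noteq> 0" using q_power_neq_1[of 2] by simp
    moreover have "\<kappa> 1 * (minor s 1 r c $ N + \<kappa> q * minor s r 1 c $ N) = minor s 1 r c $ N + \<kappa> q * minor s r 1 c $ N"
      by (simp add: distrib_left minor_unit \<kappa>_left_commute[of "\<kappa> 1" q])
    ultimately have "minor s 1 r c $ N + \<kappa> q * minor s r 1 c $ N = 0"
      by (rule \<kappa>_cancel)
    then show "minor s 1 r c $ N = (- fps_const (\<kappa> q) * minor s r 1 c) $ N"
      by (simp add: eq_neg_iff_add_eq_0)
  qed
qed

definition scl :: "K \<Rightarrow> 'z fps \<Rightarrow> 'z fps" where
  "scl \<mu> F = Abs_fps (\<lambda>r. \<kappa> (\<mu> ^ r) * F $ r)"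

lemma scl_mult: "scl \<mu> (F * G) = scl \<mu> F * scl \<mu> G"
proof (rule fps_ext)
  fix r
  have "\<kappa> (\<mu> ^ r) * (F $ k * G $ (r - k)) = \<kappa> (\<mu> ^ k) * F $ k * (\<kappa> (\<mu> ^ (r - k)) * G $ (r - k))" if "k \<le> r" for k
    using that by (simp add: mult.assoc \<kappa>_left_commute[of "F $ k"] flip: power_add)
      (simp add: mult.assoc[symmetric] flip: \<kappa>_mult power_add)
  then show "scl \<mu> (F * G) $ r = (scl \<mu> F * scl \<mu> G) $ r"
    by (simp add: scl_def fps_mult_nth_le sum_distrib_left)
qed

lemma scl_const: "scl \<mu> (fps_const (\<kappa> 1)) = fps_const (\<kappa> 1)"
  by (rule fps_ext) (simp add: scl_def flip: \<kappa>_mult)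

lemma ser2_scl: "ser2 s i j = scl ((inverse q ^ 2) powi sgn_pm s) (ser s i j)"
proof (rule fps_ext)
  fix r
  have "((inverse q ^ 2) powi sgn_pm s) ^ r = (inverse q ^ 2) powi (sgn_pm s * int r)"
    by (simp add: power_int_mult)
  then show "ser2 s i j $ r = scl ((inverse q ^ 2) powi sgn_pm s) (ser s i j) $ r"
    by (simp add: ser2_def scl_def ser_def half_ser_def shift_def)
qed

definition quas :: "pm \<Rightarrow> 'z fps \<Rightarrow> nat \<Rightarrow> nat \<Rightarrow> 'z fps" where
  "quas s h i j = ser s i j - ser s i 1 * h * ser s 1 j"

theorem rll_quas:
  assumes n: "1 \<le> n" and st: "s = Pl \<or> t = Mi"
    and same: "\<And>a b c d u v. {a, b, c, d} \<subseteq> idx n 0 \<Longrightarrow> \<Phi> (rll_elem n 0 1 1 s s (a, b) (c, d) u v) = 0"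
    and rll: "\<And>a b c d u v. {a, b, c, d} \<subseteq> idx n 0 \<Longrightarrow> \<Phi> (rll_elem n 0 z w s t (a, b) (c, d) u v) = 0"
    and z: "\<And>x. \<Phi> z * x = x * \<Phi> z" and w: "\<And>x. \<Phi> w * x = x * \<Phi> w"
    and hs: "hs * ser s 1 1 = fps_const (\<kappa> 1)" "ser s 1 1 * hs = fps_const (\<kappa> 1)"
    and ht: "ht * ser t 1 1 = fps_const (\<kappa> 1)" "ser t 1 1 * ht = fps_const (\<kappa> 1)"
    and abcd: "a \<in> idx n 1" "b \<in> idx n 1" "c \<in> idx n 1" "d \<in> idx n 1"
  shows "(\<Sum>i\<in>idx n 1. \<Sum>k\<in>idx n 1. \<iota> s t (\<Phi> z) (Rb n 1 X1 (a, b) (i, k)) *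
      (emb_u s t (quas s hs i c) * emb_v s t (quas t ht k d)))
    = (\<Sum>i\<in>idx n 1. \<Sum>k\<in>idx n 1. emb_v s t (quas t ht b k) * emb_u s t (quas s hs a i) *
      \<iota> s t (\<Phi> w) (Rb n 1 X1 (i, k) (c, d)))"
proof -
  interpret rll_triple n "\<iota> s t (\<Phi> z)" "\<iota> s t (\<Phi> w)"
    "\<lambda>i j. emb_u s t (ser s i j)" "\<lambda>i j. emb_u s t (ser2 s i j)" "\<lambda>i j. emb_v s t (ser t i j)"
    "emb_u s t hs" "emb_u s t (scl ((inverse q ^ 2) powi sgn_pm s) hs)" "emb_v s t ht"
  proof
    have one: "\<iota> s t \<alpha> 1 = emb_u s t (fps_const (\<kappa> 1))" "\<iota> s t \<alpha> 1 = emb_v s t (fps_const (\<kappa> 1))" for \<alpha>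
      using \<iota>_const[of s t \<alpha> 1] by (simp_all add: emb_u_const emb_v_const)
    show "1 \<le> n" by (rule n)
    show "\<iota> s t (\<Phi> z) (f + g) = \<iota> s t (\<Phi> z) f + \<iota> s t (\<Phi> z) g"
      "\<iota> s t (\<Phi> z) (f * g) = \<iota> s t (\<Phi> z) f * \<iota> s t (\<Phi> z) g"
      "\<iota> s t (\<Phi> w) (f + g) = \<iota> s t (\<Phi> w) f + \<iota> s t (\<Phi> w) g"
      "\<iota> s t (\<Phi> w) (f * g) = \<iota> s t (\<Phi> w) f * \<iota> s t (\<Phi> w) g" for f g
      by (simp_all add: \<iota>_add \<iota>_mult)
    show "\<iota> s t (\<Phi> z) f * x = x * \<iota> s t (\<Phi> z) f" "\<iota> s t (\<Phi> w) f * x = x * \<iota> s t (\<Phi> w) f" for f x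
      by (rule \<iota>_central[OF z] \<iota>_central[OF w])+
    show "\<iota> s t (\<Phi> w) (fps_const k) = \<iota> s t (\<Phi> z) (fps_const k)" for k
      by (simp add: \<iota>_const)
    show "\<iota> s t (\<Phi> z) 1 * emb_u s t (ser s i j) = emb_u s t (ser s i j)"
      "\<iota> s t (\<Phi> z) 1 * emb_u s t (ser2 s i j) = emb_u s t (ser2 s i j)"
      "\<iota> s t (\<Phi> z) 1 * emb_v s t (ser t i j) = emb_v s t (ser t i j)" for i j
      by (simp only: one(1) emb_u_mult[symmetric] ser_unit, simp only: one(1) emb_u_mult[symmetric] ser_unit,
          simp only: one(2) emb_v_mult[symmetric] ser_unit)
    show "emb_u s t hs * emb_u s t (ser s 1 1) = \<iota> s t (\<Phi> z) 1" "emb_u s t (ser s 1 1) * emb_u s t hs = \<iota> s t (\<Phi> z) 1"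
      by (simp_all only: one(1) emb_u_mult[symmetric] hs)
    show "emb_u s t (ser2 s 1 1) * emb_u s t (scl ((inverse q ^ 2) powi sgn_pm s) hs) = \<iota> s t (\<Phi> z) 1"
      by (simp only: one(1) emb_u_mult[symmetric] ser2_scl scl_mult[symmetric] hs scl_const)
    show "emb_v s t ht * emb_v s t (ser t 1 1) = \<iota> s t (\<Phi> z) 1" "emb_v s t (ser t 1 1) * emb_v s t ht = \<iota> s t (\<Phi> z) 1"
      by (simp_all only: one(2) emb_v_mult[symmetric] ht)
  next
    fix a b c d assume "a \<in> idx n 0" "b \<in> idx n 0" "c \<in> idx n 0" "d \<in> idx n 0"
    then have abcd: "{a, b, c, d} \<subseteq> idx n 0" by simp
    show "(\<Sum>i\<in>idx n 0. \<Sum>k\<in>idx n 0. \<iota> s t (\<Phi> z) (Rb n 0 X1 (a, b) (i, k)) * (emb_u s t (ser s i c) * emb_v s t (ser t k d)))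
      = (\<Sum>i\<in>idx n 0. \<Sum>k\<in>idx n 0. emb_v s t (ser t b k) * emb_u s t (ser s a i) * \<iota> s t (\<Phi> w) (Rb n 0 X1 (i, k) (c, d)))"
      by (rule rll_series(1)[OF abcd st rll[OF abcd]])
    show "(\<Sum>i\<in>idx n 0. \<Sum>k\<in>idx n 0. \<iota> s t (\<Phi> z) (Rb n 0 X2 (a, b) (i, k)) * (emb_u s t (ser2 s i c) * emb_v s t (ser t k d)))
      = (\<Sum>i\<in>idx n 0. \<Sum>k\<in>idx n 0. emb_v s t (ser t b k) * emb_u s t (ser2 s a i) * \<iota> s t (\<Phi> w) (Rb n 0 X2 (i, k) (c, d)))"
      by (rule rll_series(2)[OF abcd st rll[OF abcd]])
  next
    fix c assume c: "c \<in> idx n 1"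
    have m: "emb_u s t (minor s i j c) = emb_u s t (ser s i 1) * emb_u s t (ser2 s j c)
       - \<iota> s t (\<Phi> z) (fps_const (inverse q)) * (emb_u s t (ser s i c) * emb_u s t (ser2 s j 1))" for i j
      by (simp add: minor_def emb_u_diff emb_u_mult emb_u_const \<iota>_const)
    have emb_0: "emb_u s t 0 = (0 :: 'z fps fps)" using emb_u_add[of s t 0 0] by simp
    have "minor s 1 1 c = 0" by (rule minor_relations(1)[OF n c]) (rule same)
    then show "emb_u s t (ser s 1 1) * emb_u s t (ser2 s 1 c)
       - \<iota> s t (\<Phi> z) (fps_const (inverse q)) * (emb_u s t (ser s 1 c) * emb_u s t (ser2 s 1 1)) = 0"
      unfolding m[symmetric] by (simp only: emb_0)
    fix j assume j: "j \<in> idx n 1"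
    have "emb_u s t (- fps_const (\<kappa> q) * minor s j 1 c) = - \<iota> s t (\<Phi> z) (fps_const q) * emb_u s t (minor s j 1 c)"
      using emb_u_diff[of s t 0 "fps_const (\<kappa> q) * minor s j 1 c"] emb_0
      by (simp add: emb_u_mult emb_u_const \<iota>_const del: fps_const_neg)
    moreover have "minor s 1 j c = - fps_const (\<kappa> q) * minor s j 1 c"
      by (rule minor_relations(2)[OF n c _ j]) (rule same)
    ultimately show "emb_u s t (ser s 1 1) * emb_u s t (ser2 s j c)
       - \<iota> s t (\<Phi> z) (fps_const (inverse q)) * (emb_u s t (ser s 1 c) * emb_u s t (ser2 s j 1)) =
       - \<iota> s t (\<Phi> z) (fps_const q) * (emb_u s t (ser s j 1) * emb_u s t (ser2 s 1 c)
       - \<iota> s t (\<Phi> z) (fps_const (inverse q)) * (emb_u s t (ser s j c) * emb_u s t (ser2 s 1 1)))"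
      unfolding m[symmetric] by (simp only:)
  qed
  show ?thesis
    using rll_S[OF abcd] unfolding S1_def S3_def quas_def
    by (simp only: emb_u_diff emb_v_diff emb_u_mult emb_v_mult)
qed

end

section \<open>The homomorphism\<close>

lemma words_in_diff: "f \<in> words_in X \<Longrightarrow> h \<in> words_in X \<Longrightarrow> f - h \<in> words_in X"
  using words_in_closed(6)[of f X "- h"] words_in_closed(5)[of h X] by simp

lemma words_in_sum: "(\<And>i. i \<in> A \<Longrightarrow> f i \<in> words_in X) \<Longrightarrow> sum f A \<in> words_in X"
  by (induction A rule: infinite_finite_induct) (simp_all add: words_in_closed)

lemma words_in_power: "f \<in> words_in X \<Longrightarrow> f ^ k \<in> words_in X"
  by (induction k) (simp_all add: words_in_closed)

lemma gen_set_mem: "Cen \<in> gen_set n m" "CenInv \<in> gen_set n m"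
  "Ell s i j r \<in> gen_set n m \<longleftrightarrow> i \<in> idx n m \<and> j \<in> idx n m"
  by (auto simp: gen_set_def)

lemma ell_coeff_words: "i \<in> idx n m \<Longrightarrow> j \<in> idx n m \<Longrightarrow> ell_coeff s i j a \<in> words_in (gen_set n m)"
  by (simp add: ell_coeff_def words_in_closed gen_set_mem split: pm.split)

lemma rll_elem_words:
  assumes "{a, b, c, d} \<subseteq> idx n m" "s = Pl \<or> t = Mi" "z \<in> words_in (gen_set n m)" "w \<in> words_in (gen_set n m)"
  shows "rll_elem n m z w s t (a, b) (c, d) u v \<in> words_in (gen_set n m)"
  unfolding rll_elem_eq[OF assms(1,2)] using assms
  by (intro words_in_diff words_in_sum words_in_closed(7) words_in_power ell_coeff_words words_in_closed(3)) auto

lemma rll_rels_eq: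
  "rll_rels n m z w s t = {rll_elem n m z w s t (a, b) (c, d) u v | a b c d u v. {a, b, c, d} \<subseteq> idx n m}"
  unfolding rll_rels_def rll_elem_def by fastforce

lemma rels_words:
  assumes "n \<in> idx n m" "n + 1 \<in> idx n m"
  shows "rels n m \<subseteq> words_in (gen_set n m)"
proof -
  have g: "gen x \<in> words_in (gen_set n m)" if "x \<in> gen_set n m" for x
    using that by (rule words_in_closed(4))
  have z: "gen Cen ^ 2 \<in> words_in (gen_set n m)" "gen CenInv ^ 2 \<in> words_in (gen_set n m)"
    by (intro words_in_power g gen_set_mem)+
  have "rll_rels n m 1 1 Pl Pl \<subseteq> words_in (gen_set n m)" "rll_rels n m 1 1 Mi Mi \<subseteq> words_in (gen_set n m)"
    "rll_rels n m (gen Cen ^ 2) (gen CenInv ^ 2) Pl Mi \<subseteq> words_in (gen_set n m)"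
    unfolding rll_rels_eq using z by (auto intro!: rll_elem_words words_in_closed(2))
  then show ?thesis
    unfolding rels_def using assms
    by (auto intro!: words_in_diff words_in_closed(2,7) g simp: gen_set_mem)
qed

definition pm_op :: "pm \<Rightarrow> pm" where
  "pm_op s = (case s of Pl \<Rightarrow> Mi | Mi \<Rightarrow> Pl)"

definition gen_ser :: "pm \<Rightarrow> nat \<Rightarrow> nat \<Rightarrow> gens free fps" where
  "gen_ser s i j = Abs_fps (\<lambda>r. gen (Ell s i j r))"

definition inv_ser :: "pm \<Rightarrow> gens free fps" where
  "inv_ser s = fps_right_inverse (gen_ser s 1 1) (gen (Ell (pm_op s) 1 1 0))"

definition quas_ser :: "pm \<Rightarrow> nat \<Rightarrow> nat \<Rightarrow> gens free fps" where
  "quas_ser s i j = gen_ser s i j - gen_ser s i 1 * inv_ser s * gen_ser s 1 j"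

context coeff_hom
begin

definition map_ser :: "gens free fps \<Rightarrow> 'z fps" where
  "map_ser F = Abs_fps (\<lambda>r. \<Phi> (F $ r))"

lemma map_ser_mult: "map_ser (F * G) = map_ser F * map_ser G"
  by (rule fps_ext) (simp add: map_ser_def fps_mult_nth_le \<Phi>_sum \<Phi>_mult)

lemma map_ser_diff: "map_ser (F - G) = map_ser F - map_ser G"
  by (rule fps_ext) (simp add: map_ser_def \<Phi>_diff)

lemma map_ser_1: "map_ser 1 = fps_const (\<kappa> 1)"
  by (rule fps_ext) (simp add: map_ser_def \<kappa>_1)

lemma map_ser_gen: "map_ser (gen_ser s i j) = ser s i j"
  by (cases s; intro fps_ext) (simp_all add: map_ser_def gen_ser_def ser_def half_ser_def lc_def ell_coeff_def sgn_pm_def)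

lemma map_ser_right_inverse:
  assumes "\<Phi> (F $ 0 * y) = \<Phi> 1"
  shows "map_ser F * map_ser (fps_right_inverse F y) = map_ser 1"
proof (rule fps_ext)
  fix r
  let ?G = "fps_right_inverse F y"
  show "(map_ser F * map_ser ?G) $ r = map_ser 1 $ r"
  proof (cases r)
    case 0
    then show ?thesis using assms by (simp add: map_ser_def flip: \<Phi>_mult)
  next
    case (Suc k)
    define T where "T = (\<Sum>i=1..r. F $ i * fps_right_inverse_constructor F y (r - i))"
    have G: "?G $ r = - y * T" by (simp add: Suc T_def)
    have "(F * ?G) $ r = F $ 0 * ?G $ r + (\<Sum>i=1..r. F $ i * ?G $ (r - i))"
      unfolding fps_mult_nth by (subst sum.atLeast_Suc_atMost) (simp_all add: One_nat_def)
    also have "\<dots> = - (F $ 0 * y) * T + T"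
      unfolding G by (simp add: T_def mult.assoc)
    finally have "\<Phi> ((F * ?G) $ r) = - (\<Phi> (F $ 0 * y) * \<Phi> T) + \<Phi> T"
      by (simp add: \<Phi>_add \<Phi>_minus \<Phi>_diff \<Phi>_mult[of "F $ 0 * y"])
    also have "\<dots> = 0"
      unfolding assms by (simp flip: \<Phi>_mult)
    finally show ?thesis
      unfolding map_ser_mult[symmetric] using Suc by (simp add: map_ser_def)
  qed
qed

lemma map_ser_inverse:
  assumes "\<Phi> (F $ 0 * y) = \<Phi> 1" "\<Phi> (y * F $ 0) = \<Phi> 1"
  shows "map_ser F * map_ser (fps_right_inverse F y) = map_ser 1"
    and "map_ser (fps_right_inverse F y) * map_ser F = map_ser 1"
proof -
  let ?G = "fps_right_inverse F y" let ?H = "fps_right_inverse ?G (F $ 0)"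
  show 1: "map_ser F * map_ser ?G = map_ser 1"
    by (rule map_ser_right_inverse) (rule assms(1))
  have 2: "map_ser ?G * map_ser ?H = map_ser 1"
    by (rule map_ser_right_inverse) (simp add: assms(2))
  have "map_ser F = map_ser F * (map_ser ?G * map_ser ?H)"
    unfolding 2 by (simp flip: map_ser_mult)
  also have "\<dots> = map_ser ?H"
    unfolding mult.assoc[symmetric] 1 by (simp flip: map_ser_mult)
  finally show "map_ser ?G * map_ser F = map_ser 1" using 2 by simp
qed

end

context presentation
begin

definition proj :: "'g free \<Rightarrow> 'g free quots" where
  "proj = quot_at Jh"

lemma tsideal_Jh: "tsideal Jh"
  by (simp add: tsideal_def Jh_closed)

lemma proj_add: "proj (f + g) = proj f + proj g"
  and proj_mult: "proj (f * g) = proj f * proj g"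
  and proj_eq_0_iff: "proj f = 0 \<longleftrightarrow> f \<in> Jh"
  by (simp_all add: proj_def quot_at_add quot_at_mult quot_at_eq_0_iff tsideal_Jh)

lemma PC_eq_proj: "PC f = PC g \<longleftrightarrow> proj f = proj g"
proof -
  have "proj (f - g) + proj g = proj f" by (simp flip: proj_add)
  then have "proj f = proj g \<longleftrightarrow> proj (f - g) = 0" by (metis add_cancel_left_left)
  then show ?thesis by (simp add: PC_eq_iff proj_eq_0_iff)
qed

lemma proj_central: "(\<And>y. x * y - y * x \<in> Jh) \<Longrightarrow> proj x * z = z * proj x"
  unfolding proj_def by (rule quot_at_central)

lemma PC_sum:
  assumes "finite B"
  shows "(\<Oplus>\<^bsub>A\<^esub>k\<in>B. PC (f k)) = PC (sum f B)"
proof -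
  interpret A: ring A by (rule A_ring)
  show ?thesis using assms
    by (induction B rule: finite_induct) (simp_all add: PC_zero A.finsum_insert PC_add A_carrier)
qed

definition pcs :: "'g free fps \<Rightarrow> nat \<Rightarrow> 'g free set" where
  "pcs G r = PC (G $ r)"

abbreviation SR where "SR \<equiv> ser_ring A"

lemma SR_carrier: "carrier SR = range pcs"
proof (intro equalityI subsetI)
  fix c assume "c \<in> carrier SR"
  then have "\<forall>r. \<exists>f. c r = PC f" by (fastforce simp: ser_ring_def A_carrier Pi_iff image_iff)
  then obtain f where "\<And>r. c r = PC (f r)" by metis
  then have "c = pcs (Abs_fps f)" by (intro ext) (simp add: pcs_def)
  then show "c \<in> range pcs" by blast
next
  fix c assume "c \<in> range pcs"
  then show "c \<in> carrier SR" by (auto simp: ser_ring_def A_carrier pcs_def)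
qed

lemma pcs_add: "pcs G \<oplus>\<^bsub>SR\<^esub> pcs H = pcs (G + H)"
  by (intro ext) (simp add: ser_ring_def pcs_def PC_add)

lemma pcs_mult: "pcs G \<otimes>\<^bsub>SR\<^esub> pcs H = pcs (G * H)"
  by (intro ext) (simp add: ser_ring_def pcs_def PC_mult PC_sum fps_mult_nth_le)

lemma pcs_1: "\<one>\<^bsub>SR\<^esub> = pcs 1"
  by (intro ext) (simp add: ser_ring_def pcs_def PC_1 PC_zero)

lemma pcs_zero: "\<zero>\<^bsub>SR\<^esub> = pcs 0"
  by (intro ext) (simp add: ser_ring_def pcs_def PC_zero)

lemma SR_ring: "ring SR"
proof (intro ringI abelian_groupI monoidI; unfold SR_carrier pcs_1 pcs_zero; (elim imageE)?)
  fix c G assume "c = pcs G"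
  then show "\<exists>H\<in>range pcs. H \<oplus>\<^bsub>SR\<^esub> c = pcs 0"
    by (intro bexI[of _ "pcs (- G)"]) (simp_all add: pcs_add)
qed (simp_all add: pcs_add pcs_mult ac_simps mult.assoc distrib_left distrib_right)

lemma pcs_minus: "pcs G \<ominus>\<^bsub>SR\<^esub> pcs H = pcs (G - H)"
proof -
  interpret SR: ring SR by (rule SR_ring)
  have "\<ominus>\<^bsub>SR\<^esub> pcs H = pcs (- H)"
    by (rule SR.minus_equality) (simp_all add: pcs_add pcs_zero SR_carrier)
  then show ?thesis by (simp add: a_minus_def pcs_add)
qed

lemma pcs_inverse:
  assumes "pcs (G * H) = pcs 1" "pcs (H * G) = pcs 1"
  shows "pcs G \<in> Units SR" "inv\<^bsub>SR\<^esub> pcs G = pcs H"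
proof -
  interpret SR: ring SR by (rule SR_ring)
  have *: "pcs G \<in> carrier SR" "pcs H \<in> carrier SR" "pcs G \<otimes>\<^bsub>SR\<^esub> pcs H = \<one>\<^bsub>SR\<^esub>" "pcs H \<otimes>\<^bsub>SR\<^esub> pcs G = \<one>\<^bsub>SR\<^esub>"
    using assms by (simp_all add: SR_carrier pcs_mult pcs_1)
  then show "pcs G \<in> Units SR" unfolding Units_def by blast
  show "inv\<^bsub>SR\<^esub> pcs G = pcs H" by (rule SR.inv_char) (use * in simp_all)
qed

lemma alg_hom_eqI:
  assumes "\<phi> \<in> alg_hom A B" "\<psi> \<in> alg_hom A B" "\<And>g. g \<in> X \<Longrightarrow> \<phi> (PC (gen g)) = \<psi> (PC (gen g))"
  shows "\<phi> (PC f) = \<psi> (PC f)"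
proof (induction f rule: free_induct)
  case (scal k)
  have "\<chi> (PC (scal k)) = k \<odot>\<^bsub>B\<^esub> \<one>\<^bsub>B\<^esub>" if "\<chi> \<in> alg_hom A B" for \<chi>
  proof -
    have "PC (scal k) = k \<odot>\<^bsub>A\<^esub> \<one>\<^bsub>A\<^esub>" by (simp add: PC_1 PC_smult)
    then show ?thesis using that by (simp add: alg_hom_def ring_hom_def A_carrier PC_1)
  qed
  from this[OF assms(1)] this[OF assms(2)] show ?case by simp
next
  case (gen g)
  show ?case
  proof (cases "g \<in> X")
    case False
    then have zero: "PC (gen g) = PC (scal 0)"
      by (simp add: PC_def retr_gen)
    have vac: "\<chi> (PC (scal 0)) = 0 \<odot>\<^bsub>B\<^esub> \<one>\<^bsub>B\<^esub>" if "\<chi> \<in> alg_hom A B" for \<chi>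
    proof -
      have "PC (scal 0) = 0 \<odot>\<^bsub>A\<^esub> \<one>\<^bsub>A\<^esub>" by (simp add: PC_1 PC_smult)
      then show ?thesis using that by (simp add: alg_hom_def ring_hom_def A_carrier PC_1)
    qed
    from vac[OF assms(1)] vac[OF assms(2)] show ?thesis unfolding zero by simp
  qed (rule assms(3))
next
  case (add f g)
  then show ?case using assms(1,2) by (simp add: alg_hom_def ring_hom_def A_carrier flip: PC_add)
next
  case (mult f g)
  then show ?case using assms(1,2) by (simp add: alg_hom_def ring_hom_def A_carrier flip: PC_mult)
qed

end

theorem theorem3p8:
  fixes n :: nat
  assumes "n \<ge> 2"
  shows "(\<forall>s. ell_ser n 0 s 1 1 \<in> Units (ser_ring (U_alg n 0))) \<and>
    (\<exists>!\<phi>. \<phi> \<in> alg_hom (U_alg n 1) (U_alg n 0) \<and> \<phi> \<in> extensional (carrier (U_alg n 1)) \<and>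
      \<phi> (U_gen n 1 Cen) = U_gen n 0 Cen \<and>
      \<phi> (U_gen n 1 CenInv) = U_gen n 0 CenInv \<and>
      (\<forall>s. \<forall>i \<in> {2..2 * n - 1}. \<forall>j \<in> {2..2 * n - 1}. \<forall>r.
         \<phi> (ell_ser n 1 s i j r) = quasidet n s i j r))"
proof -
  have n1: "1 \<le> n" using assms by simp
  note mem = idx_0_mem[OF n1]
  have mid: "n \<in> idx n 0" "n + 1 \<in> idx n 0" "n \<in> idx n 1" "n + 1 \<in> idx n 1"
    using assms by (auto simp: idx_def)
  interpret P0: presentation "gen_set n 0" "rels n 0"
    by standard (rule rels_words[OF mid(1,2)])
  interpret P1: presentation "gen_set n 1" "rels n 1"
    by standard (rule rels_words[OF mid(3,4)])
  have U: "U_alg n 0 = P0.A" "U_alg n 1 = P1.A"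
    by (simp_all add: U_alg_def)
  have gen0: "U_gen n 0 g = P0.PC (gen g)" if "g \<in> gen_set n 0" for g
    unfolding U_gen_def by (rule P0.pres_class_PC) (rule words_in_closed(4)[OF that])
  have gen1: "U_gen n 1 g = P1.PC (gen g)" if "g \<in> gen_set n 1" for g
    unfolding U_gen_def by (rule P1.pres_class_PC) (rule words_in_closed(4)[OF that])
  have Jh0: "P0.proj f = 0" if "f \<in> rels n 0" for f
    using that P0.S_Jh by (auto simp: P0.proj_eq_0_iff)
  interpret H0: coeff_hom P0.proj
  proof
    show "P0.proj (scal c) * x = x * P0.proj (scal c)" for c x
      by (rule P0.proj_central) (simp add: scal_commute P0.Jh_closed)
  qed (simp_all add: P0.proj_add P0.proj_mult)

  have rel_0: "P0.proj (gen Cen * gen CenInv - 1) = 0" "P0.proj (gen CenInv * gen Cen - 1) = 0"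
    "P0.proj (gen (Ell Pl n n 0) * gen (Ell Pl (n + 1) (n + 1) 0) - 1) = 0"
    by (rule Jh0, simp add: rels_def)+
  have rel_tri: "P0.proj (gen (Ell Pl i j 0)) = 0" "P0.proj (gen (Ell Mi j i 0)) = 0"
    if "i \<in> idx n 0" "j \<in> idx n 0" "i < j" for i j
    using that by (intro Jh0; auto simp: rels_def)+
  have rel_diag: "P0.proj (gen (Ell s i i 0) * gen (Ell (pm_op s) i i 0)) = P0.proj 1" if "i \<in> idx n 0" for s i
  proof -
    have "gen (Ell s i i 0) * gen (Ell (pm_op s) i i 0) - 1 \<in> rels n 0"
      using that by (cases s) (auto simp: rels_def pm_op_def)
    from Jh0[OF this] show ?thesis by (simp add: H0.\<Phi>_diff)
  qed
  have same: "P0.proj (rll_elem n 0 1 1 s s (a, b) (c, d) u v) = 0" if "{a, b, c, d} \<subseteq> idx n 0" for s a b c d u v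
  proof (rule Jh0)
    have "rll_elem n 0 1 1 s s (a, b) (c, d) u v \<in> rll_rels n 0 1 1 s s"
      unfolding rll_rels_eq using that by blast
    then show "rll_elem n 0 1 1 s s (a, b) (c, d) u v \<in> rels n 0"
      unfolding rels_def by (cases s) auto
  qed
  have mixed: "P0.proj (rll_elem n 0 (gen Cen ^ 2) (gen CenInv ^ 2) Pl Mi (a, b) (c, d) u v) = 0"
    if "{a, b, c, d} \<subseteq> idx n 0" for a b c d u v
  proof (rule Jh0)
    have "rll_elem n 0 (gen Cen ^ 2) (gen CenInv ^ 2) Pl Mi (a, b) (c, d) u v
        \<in> rll_rels n 0 (gen Cen ^ 2) (gen CenInv ^ 2) Pl Mi"
      unfolding rll_rels_eq using that by blast
    then show "rll_elem n 0 (gen Cen ^ 2) (gen CenInv ^ 2) Pl Mi (a, b) (c, d) u v \<in> rels n 0"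
      unfolding rels_def by auto
  qed

  have Cen_commutes: "gen Cen * y - y * gen Cen \<in> P0.Jh" for y
  proof (induction y rule: free_induct)
    case (scal k)
    show ?case by (simp add: scal_commute P0.Jh_closed)
  next
    case (gen g)
    show ?case
    proof (cases "g \<in> gen_set n 0")
      case True
      then have "gen Cen * gen g - gen g * gen Cen \<in> rels n 0" by (auto simp: rels_def)
      then show ?thesis using P0.S_Jh by blast
    next
      case False
      then show ?thesis by (simp add: P0.Jh_def retr_diff retr_mult retr_gen P0.J_0)
    qed
  next
    case (add f g)
    have "gen Cen * (f + g) - (f + g) * gen Cen = (gen Cen * f - f * gen Cen) + (gen Cen * g - g * gen Cen)"
      by (simp add: algebra_simps)
    then show ?case using tsideal_add[OF P0.tsideal_Jh add] by simp
  next
    case (mult f g)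
    have "gen Cen * (f * g) - (f * g) * gen Cen = (gen Cen * f - f * gen Cen) * g + f * (gen Cen * g - g * gen Cen)"
      by (simp add: algebra_simps)
    then show ?case
      using tsideal_add[OF P0.tsideal_Jh P0.Jh_closed(4)[OF mult(1)] P0.Jh_closed(3)[OF mult(2)]] by simp
  qed
  have Cen_central: "P0.proj (gen Cen) * x = x * P0.proj (gen Cen)" for x
    by (rule P0.proj_central) (rule Cen_commutes)
  have Cen_inv: "P0.proj (gen Cen) * P0.proj (gen CenInv) = P0.proj 1"
    "P0.proj (gen CenInv) * P0.proj (gen Cen) = P0.proj 1"
    using rel_0(1,2) by (simp_all add: H0.\<Phi>_diff H0.\<Phi>_mult)
  have CenInv_central: "P0.proj (gen CenInv) * x = x * P0.proj (gen CenInv)" for x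
  proof -
    let ?c = "P0.proj (gen Cen)" and ?c' = "P0.proj (gen CenInv)"
    have unit: "P0.proj 1 * ?c' = ?c'" "?c' * P0.proj 1 = ?c'" by (simp_all flip: H0.\<Phi>_mult)
    have "?c' * x = ?c' * P0.proj 1 * x" by (simp only: unit)
    also have "\<dots> = ?c' * x * (?c * ?c')"
      by (simp only: Cen_inv mult.assoc H0.\<Phi>_1_central)
    also have "\<dots> = ?c' * (?c * x) * ?c'"
      by (simp only: Cen_central[of x] mult.assoc)
    also have "\<dots> = P0.proj 1 * x * ?c'"
      by (simp only: mult.assoc[symmetric] Cen_inv)
    also have "\<dots> = x * (P0.proj 1 * ?c')"
      by (simp only: H0.\<Phi>_1_central[of x] mult.assoc)
    finally show ?thesis by (simp only: unit)
  qed
  have sq_central: "P0.proj (gen Cen ^ 2) * x = x * P0.proj (gen Cen ^ 2)"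
    "P0.proj (gen CenInv ^ 2) * x = x * P0.proj (gen CenInv ^ 2)" for x
    by (simp_all only: power2_eq_square H0.\<Phi>_mult mult.assoc Cen_central[of x] CenInv_central[of x])
      (simp_all only: mult.assoc[symmetric] Cen_central[of x] CenInv_central[of x])

  have h: "H0.map_ser (inv_ser s) * H0.ser s 1 1 = fps_const (H0.\<kappa> 1)"
    "H0.ser s 1 1 * H0.map_ser (inv_ser s) = fps_const (H0.\<kappa> 1)" for s
  proof -
    have "P0.proj (gen_ser s 1 1 $ 0 * gen (Ell (pm_op s) 1 1 0)) = P0.proj 1"
      "P0.proj (gen (Ell (pm_op s) 1 1 0) * gen_ser s 1 1 $ 0) = P0.proj 1"
      using rel_diag[OF mem(1), of s] rel_diag[OF mem(1), of "pm_op s"]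
      by (cases s; simp add: gen_ser_def pm_op_def)+
    note inv = H0.map_ser_inverse[OF this, folded inv_ser_def, unfolded H0.map_ser_gen H0.map_ser_1]
    show "H0.map_ser (inv_ser s) * H0.ser s 1 1 = fps_const (H0.\<kappa> 1)" by (rule inv(2))
    show "H0.ser s 1 1 * H0.map_ser (inv_ser s) = fps_const (H0.\<kappa> 1)" by (rule inv(1))
  qed
  have map_quas: "H0.map_ser (quas_ser s i j) = H0.quas s (H0.map_ser (inv_ser s)) i j" for s i j
    by (simp add: quas_ser_def H0.quas_def H0.map_ser_diff H0.map_ser_mult H0.map_ser_gen)

  define \<theta> where "\<theta> g = (case g of Cen \<Rightarrow> gen Cen | CenInv \<Rightarrow> gen CenInv | Ell s i j r \<Rightarrow> quas_ser s i j $ r)" for g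
  define \<Psi> where "\<Psi> f = P0.proj (ev \<theta> f)" for f
  interpret H1: coeff_hom \<Psi>
    by standard (simp_all add: \<Psi>_def ev_add ev_mult H0.\<Phi>_add H0.\<Phi>_mult H0.\<Phi>_scal_central)
  have \<Psi>_gen: "\<Psi> (gen Cen) = P0.proj (gen Cen)" "\<Psi> (gen CenInv) = P0.proj (gen CenInv)" "\<Psi> 1 = P0.proj 1"
    by (simp_all add: \<Psi>_def \<theta>_def)
  have \<Psi>_Ell: "\<Psi> (gen (Ell s i j r)) = H0.quas s (H0.map_ser (inv_ser s)) i j $ r" for s i j r
  proof -
    have "\<Psi> (gen (Ell s i j r)) = H0.map_ser (quas_ser s i j) $ r"
      by (simp add: \<Psi>_def \<theta>_def H0.map_ser_def)
    then show ?thesis unfolding map_quas .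
  qed
  have \<kappa>: "H1.\<kappa> = H0.\<kappa>"
    by (rule ext) (simp add: H0.\<kappa>_def H1.\<kappa>_def \<Psi>_def)
  have \<iota>: "H1.\<iota> s t \<alpha> = H0.\<iota> s t \<alpha>" for s t \<alpha>
    by (rule ext) (simp add: H0.\<iota>_def H1.\<iota>_def H0.tw_def H1.tw_def \<kappa>)
  have ser1: "half_ser s (H1.lc s i j) = H0.quas s (H0.map_ser (inv_ser s)) i j" for s i j
  proof -
    have "half_ser s (H1.lc s i j) = H1.map_ser (gen_ser s i j)"
      by (simp only: H1.map_ser_gen H1.ser_def)
    also have "\<dots> = H0.quas s (H0.map_ser (inv_ser s)) i j"
      by (rule fps_ext) (simp add: H1.map_ser_def gen_ser_def \<Psi>_Ell)
    finally show ?thesis .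
  qed
  have \<Psi>_rll: "\<Psi> (rll_elem n 1 z w s t (a, b) (c, d) u v) = 0"
    if abcd: "{a, b, c, d} \<subseteq> idx n 1" and st: "s = Pl \<or> t = Mi"
      and rll: "\<And>a b c d u v. {a, b, c, d} \<subseteq> idx n 0 \<Longrightarrow> P0.proj (rll_elem n 0 z w s t (a, b) (c, d) u v) = 0"
      and z: "\<And>x. P0.proj z * x = x * P0.proj z" and w: "\<And>x. P0.proj w * x = x * P0.proj w"
      and zw: "\<Psi> z = P0.proj z" "\<Psi> w = P0.proj w"
    for z w s t a b c d u v
  proof -
    have "H1.coeff_eq n 1 s t (\<Psi> z) (\<Psi> w) (H1.lc s) (H1.lc t) a b c d u v"
    proof (rule H1.coeffs_of_series[OF st H1.one_sided_lc H1.one_sided_lc])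
      show "(\<Sum>i\<in>idx n 1. \<Sum>j\<in>idx n 1. H1.\<iota> s t (\<Psi> z) (Rb n 1 X1 (a, b) (i, j)) *
         (emb_u s t (half_ser s (H1.lc s i c)) * emb_v s t (half_ser t (H1.lc t j d)))) =
        (\<Sum>i\<in>idx n 1. \<Sum>j\<in>idx n 1. emb_v s t (half_ser t (H1.lc t b j)) * emb_u s t (half_ser s (H1.lc s a i)) *
         H1.\<iota> s t (\<Psi> w) (Rb n 1 X1 (i, j) (c, d)))"
        unfolding ser1 \<iota> zw
        by (rule H0.rll_quas[OF n1 st _ _ z w h h]) (use same rll abcd in auto)
    qed
    then show ?thesis using H1.rll_eq_0_iff[OF abcd st] by blast
  qed
  have one_central: "P0.proj 1 * x = x * P0.proj 1" for x by (rule H0.\<Phi>_1_central)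
  have \<Psi>_sq: "\<Psi> (gen Cen ^ 2) = P0.proj (gen Cen ^ 2)" "\<Psi> (gen CenInv ^ 2) = P0.proj (gen CenInv ^ 2)"
    by (simp_all add: power2_eq_square H0.\<Phi>_mult H1.\<Phi>_mult \<Psi>_gen)
  have \<Psi>_0: "\<Psi> (gen (Ell s i j 0)) = P0.proj (gen (Ell s i j 0))"
    if "i \<in> idx n 1" "j \<in> idx n 1" for s i j
  proof -
    have ser_0: "H0.ser s i j $ 0 = P0.proj (gen (Ell s i j 0))" for s i j
      by (simp add: H0.map_ser_gen[symmetric] H0.map_ser_def gen_ser_def)
    have "H0.ser s i 1 $ 0 = 0 \<or> H0.ser s 1 j $ 0 = 0"
      using rel_tri(1)[of 1 j] rel_tri(2)[of 1 i] mem idx_1_facts(1,4)[OF that(1)] idx_1_facts(1,4)[OF that(2)]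
      by (cases s) (simp_all add: ser_0)
    then show ?thesis
      unfolding \<Psi>_Ell H0.quas_def by (auto simp: ser_0)
  qed
  have \<Psi>_rels: "\<Psi> f = 0" if f: "f \<in> rels n 1" for f
  proof -
    have same_rll: "\<Psi> f = 0" if f: "f \<in> rll_rels n 1 1 1 s s" for s
    proof -
      obtain a b c d u v where "{a, b, c, d} \<subseteq> idx n 1" and f': "f = rll_elem n 1 1 1 s s (a, b) (c, d) u v"
        using f unfolding rll_rels_eq by auto
      moreover have "s = Pl \<or> s = Mi" by (cases s) simp_all
      ultimately show ?thesis
        unfolding f' using same one_central \<Psi>_gen(3) by (intro \<Psi>_rll)
    qed
    have mixed_rll: "\<Psi> f = 0" if f: "f \<in> rll_rels n 1 (gen Cen ^ 2) (gen CenInv ^ 2) Pl Mi"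
    proof -
      obtain a b c d u v where "{a, b, c, d} \<subseteq> idx n 1"
        and f': "f = rll_elem n 1 (gen Cen ^ 2) (gen CenInv ^ 2) Pl Mi (a, b) (c, d) u v"
        using f unfolding rll_rels_eq by auto
      moreover have "Pl = Pl \<or> Mi = Mi" by simp
      ultimately show ?thesis
        unfolding f' using mixed sq_central \<Psi>_sq by (intro \<Psi>_rll)
    qed
    have cen: "\<Psi> (gen Cen * gen CenInv - 1) = 0" "\<Psi> (gen CenInv * gen Cen - 1) = 0"
      by (simp_all add: H1.\<Phi>_diff H1.\<Phi>_mult \<Psi>_gen Cen_inv)
    have comm: "\<Psi> (gen Cen * gen g - gen g * gen Cen) = 0" for g
      unfolding H1.\<Phi>_diff H1.\<Phi>_mult \<Psi>_gen(1) Cen_central[of "\<Psi> (gen g)"] by simp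
    have tri: "\<Psi> (gen (Ell Pl i j 0)) = 0" "\<Psi> (gen (Ell Mi j i 0)) = 0"
      if "i \<in> idx n 1" "j \<in> idx n 1" "i < j" for i j
      using that rel_tri[OF _ _ that(3)] by (simp_all add: \<Psi>_0 idx_1_facts(1))
    have nn: "\<Psi> (gen (Ell Pl n n 0) * gen (Ell Pl (n + 1) (n + 1) 0) - 1) = 0"
      using rel_0(3) mid by (simp add: H1.\<Phi>_diff H1.\<Phi>_mult \<Psi>_gen(3) \<Psi>_0 H0.\<Phi>_diff H0.\<Phi>_mult)
    have diag: "\<Psi> (gen (Ell Pl i i 0) * gen (Ell Mi i i 0) - 1) = 0" "\<Psi> (gen (Ell Mi i i 0) * gen (Ell Pl i i 0) - 1) = 0"
      if "i \<in> idx n 1" for i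
      using rel_diag[of i Pl] rel_diag[of i Mi] idx_1_facts(1)[OF that] that
      by (simp_all add: H1.\<Phi>_diff H1.\<Phi>_mult \<Psi>_gen(3) \<Psi>_0 H0.\<Phi>_mult pm_op_def)
    from f show ?thesis
      unfolding rels_def
    proof (elim UnE)
      assume "f \<in> {gen Cen * gen CenInv - 1, gen CenInv * gen Cen - 1}"
      then show ?thesis using cen by (elim insertE emptyE) simp_all
    next
      assume "f \<in> {gen Cen * gen g - gen g * gen Cen | g. g \<in> gen_set n 1}"
      then show ?thesis by (elim CollectE exE conjE) (simp only: comm)
    next
      assume "f \<in> {gen (Ell Pl i j 0) | i j. i \<in> idx n 1 \<and> j \<in> idx n 1 \<and> i < j}"
      then show ?thesis by (elim CollectE exE conjE) (simp only: tri)
    next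
      assume "f \<in> {gen (Ell Mi j i 0) | i j. i \<in> idx n 1 \<and> j \<in> idx n 1 \<and> i < j}"
      then show ?thesis by (elim CollectE exE conjE) (simp only: tri)
    next
      assume "f \<in> {gen (Ell Pl n n 0) * gen (Ell Pl (n + 1) (n + 1) 0) - 1}"
      then show ?thesis using nn by (elim insertE emptyE) simp_all
    next
      assume "f \<in> {gen (Ell Pl i i 0) * gen (Ell Mi i i 0) - 1 | i. i \<in> idx n 1}"
      then show ?thesis by (elim CollectE exE conjE) (simp only: diag)
    next
      assume "f \<in> {gen (Ell Mi i i 0) * gen (Ell Pl i i 0) - 1 | i. i \<in> idx n 1}"
      then show ?thesis by (elim CollectE exE conjE) (simp only: diag)
    qed (fact same_rll mixed_rll)+
  qed

  have pcs_eq: "P0.pcs F = P0.pcs G" if "H0.map_ser F = H0.map_ser G" for F G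
  proof
    fix r
    have "H0.map_ser F $ r = H0.map_ser G $ r" using that by simp
    then show "P0.pcs F r = P0.pcs G r" by (simp add: P0.pcs_def P0.PC_eq_proj H0.map_ser_def)
  qed
  have inverse: "P0.pcs (gen_ser s 1 1 * inv_ser s) = P0.pcs 1" "P0.pcs (inv_ser s * gen_ser s 1 1) = P0.pcs 1" for s
    by (rule pcs_eq, simp add: H0.map_ser_mult H0.map_ser_gen h H0.map_ser_1)+
  have ell0: "ell_ser n 0 s i j = P0.pcs (gen_ser s i j)" if "i \<in> idx n 0" "j \<in> idx n 0" for s i j
    using that by (intro ext) (simp add: ell_ser_def gen0 gen_set_mem P0.pcs_def gen_ser_def)
  have quasidet: "quasidet n s i j = P0.pcs (quas_ser s i j)" if "i \<in> idx n 1" "j \<in> idx n 1" for s i j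
    unfolding quasidet_def Let_def U
    by (simp only: ell0 idx_1_facts(1)[OF that(1)] idx_1_facts(1)[OF that(2)] mem
        P0.pcs_inverse(2)[OF inverse] P0.pcs_mult P0.pcs_minus quas_ser_def)

  define F where "F f = P0.PC (ev \<theta> (retr (gen_set n 1) f))" for f
  have F_add: "F (f + g) = F f \<oplus>\<^bsub>P0.A\<^esub> F g" and F_mult: "F (f * g) = F f \<otimes>\<^bsub>P0.A\<^esub> F g"
    and F_1: "F 1 = \<one>\<^bsub>P0.A\<^esub>" and F_scal: "F (scal k * f) = k \<odot>\<^bsub>P0.A\<^esub> F f" for f g k
    by (simp_all add: F_def retr_add retr_mult ev_add ev_mult P0.PC_add P0.PC_mult P0.PC_1 P0.PC_smult)
  have F_cong: "F f = F g" if "P1.PC f = P1.PC g" for f g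
  proof -
    have mem_Jh: "f - g \<in> P1.Jh" using that by (simp add: P1.PC_eq_iff)
    have "\<Psi> (retr (gen_set n 1) (f - g)) = 0"
      by (rule P1.Jh_kernel[where \<Psi> = \<Psi>, OF H1.\<Phi>_add H1.\<Phi>_mult \<Psi>_rels mem_Jh])
    then have "\<Psi> (retr (gen_set n 1) f) = \<Psi> (retr (gen_set n 1) g)"
      by (simp add: retr_diff H1.\<Phi>_diff)
    then show ?thesis
      by (simp add: F_def P0.PC_eq_proj \<Psi>_def)
  qed
  define \<phi> where "\<phi> = (\<lambda>c\<in>carrier P1.A. F (SOME f. P1.PC f = c))"
  have \<phi>_PC: "\<phi> (P1.PC f) = F f" for f
  proof -
    have "P1.PC (SOME f'. P1.PC f' = P1.PC f) = P1.PC f" by (rule someI) (rule refl)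
    then have "F (SOME f'. P1.PC f' = P1.PC f) = F f" by (rule F_cong)
    then show ?thesis by (simp add: \<phi>_def P1.A_carrier)
  qed
  have F_in: "F f \<in> carrier P0.A" for f by (simp add: F_def P0.A_carrier)
  have \<phi>_hom: "\<phi> \<in> alg_hom P1.A P0.A"
    unfolding alg_hom_def ring_hom_def
    by (auto simp: P1.A_carrier P1.PC_add P1.PC_mult P1.PC_1 P1.PC_smult \<phi>_PC F_add F_mult F_1 F_scal[symmetric] F_in)
  have \<phi>_gen: "\<phi> (U_gen n 1 g) = P0.PC (\<theta> g)" if "g \<in> gen_set n 1" for g
    using that by (simp add: gen1 \<phi>_PC F_def retr_gen)
  have \<phi>_cen: "\<phi> (U_gen n 1 Cen) = U_gen n 0 Cen" "\<phi> (U_gen n 1 CenInv) = U_gen n 0 CenInv"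
    by (simp_all add: \<phi>_gen gen0 gen_set_mem \<theta>_def)
  have idx_1: "{2..2 * n - 1} = idx n 1" by (auto simp: idx_def)
  have \<phi>_ell: "\<phi> (ell_ser n 1 s i j r) = quasidet n s i j r" if "i \<in> idx n 1" "j \<in> idx n 1" for s i j r
    using that by (simp add: ell_ser_def \<phi>_gen gen_set_mem quasidet P0.pcs_def \<theta>_def)
  show ?thesis
    unfolding U idx_1
  proof (intro conjI allI ex1I[of _ \<phi>])
    show "ell_ser n 0 s 1 1 \<in> Units P0.SR" for s
      unfolding ell0[OF mem(1) mem(1)] by (rule P0.pcs_inverse(1)[OF inverse])
    show "\<phi> \<in> alg_hom P1.A P0.A" by (rule \<phi>_hom)
    show "\<phi> \<in> extensional (carrier P1.A)" by (simp add: \<phi>_def)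
    show "\<phi> (U_gen n 1 Cen) = U_gen n 0 Cen" "\<phi> (U_gen n 1 CenInv) = U_gen n 0 CenInv"
      by (fact \<phi>_cen)+
    show "\<forall>i\<in>idx n 1. \<forall>j\<in>idx n 1. \<forall>r. \<phi> (ell_ser n 1 s i j r) = quasidet n s i j r" for s
      using \<phi>_ell by blast
  next
    fix \<psi>
    assume \<psi>: "\<psi> \<in> alg_hom P1.A P0.A \<and> \<psi> \<in> extensional (carrier P1.A) \<and>
      \<psi> (U_gen n 1 Cen) = U_gen n 0 Cen \<and> \<psi> (U_gen n 1 CenInv) = U_gen n 0 CenInv \<and>
      (\<forall>s. \<forall>i\<in>idx n 1. \<forall>j\<in>idx n 1. \<forall>r. \<psi> (ell_ser n 1 s i j r) = quasidet n s i j r)"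
    have gens: "\<psi> (P1.PC (gen g)) = \<phi> (P1.PC (gen g))" if "g \<in> gen_set n 1" for g
    proof (cases g)
      case (Ell s i j r)
      then have ij: "i \<in> idx n 1" "j \<in> idx n 1" using that by (simp_all add: gen_set_mem)
      have "\<psi> (ell_ser n 1 s i j r) = \<phi> (ell_ser n 1 s i j r)"
        using \<psi> ij \<phi>_ell[OF ij] by simp
      then show ?thesis
        unfolding gen1[OF that, symmetric] unfolding Ell ell_ser_def .
    next
      case Cen
      show ?thesis
        unfolding gen1[OF that, symmetric] unfolding Cen using \<psi> \<phi>_cen(1) by simp
    next
      case CenInv
      show ?thesis
        unfolding gen1[OF that, symmetric] unfolding CenInv using \<psi> \<phi>_cen(2) by simp
    qed
    show "\<psi> = \<phi>"
    proof (rule extensionalityI)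
      show "\<psi> \<in> extensional (carrier P1.A)" using \<psi> by blast
      show "\<phi> \<in> extensional (carrier P1.A)" by (simp add: \<phi>_def)
      fix c assume "c \<in> carrier P1.A"
      then obtain f where "c = P1.PC f" by (auto simp: P1.A_carrier)
      then show "\<psi> c = \<phi> c"
        using P1.alg_hom_eqI[OF _ \<phi>_hom gens] \<psi> by blast
    qed
  qed
qed

end
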